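(* Let $\alpha\in(0,1)$ and $N\in\mathbb{N}$. The critical exponent $\frac{2+N\alpha}{2+N\alpha-2\alpha}$ in the weak Harnack inequality is optimal: the inequality fails for every $p\ge\frac{2+N\alpha}{2+N\alpha-2\alpha}$. That is, for every such $p$ the following assertion is false: "For all $\nu,\Lambda,\tau>0$, $\delta\in(0,1)$, $\eta>1$ there is a constant $C=C(\nu,\Lambda,\delta,\tau,\eta,\alpha,N,p)$ such that for every $T>0$, every bounded domain $\Omega\subset\mathbb{R}^N$, every $A=(a_{ij})\in L_\infty((0,T)\times\Omega;\mathbb{R}^{N\times N})$ with $\sum_{i,j}|a_{ij}(t,x)|^2\le\Lambda^2$ and $(A(t,x)\xi|\xi)\ge\nu|\xi|^2$ for a.a. $(t,x)\in(0,T)\times\Omega$ and all $\xi\in\mathbb{R}^N$, every $u_0\in L_2(\Omega)$, every $t_0\ge0$ and $r>0$ with $t_0+2\tau r^{2/\alpha}\le T$, every ball $B(x_0,\eta r)\subset\Omega$, and every nonnegative weak supersolution $u$ of $\partial_t^\alpha(u-u_0)-\mathrm{div}(A(t,x)Du)=0$ in $(0,t_0+2\tau r^{2/\alpha})\times B(x_0,\eta r)$ with $u_0\ge0$ in $B(x_0,\eta r)$, one has $$\Big(\frac{1}{\mu_{N+1}(Q_-)}\int_{Q_-}u^p\,d\mu_{N+1}\Big)^{1/p}\le C\operatorname*{ess\,inf}_{Q_+}u,$$ where $Q_-=(t_0,t_0+\delta\tau r^{2/\alpha})\times B(x_0,\delta r)$ and $Q_+=(t_0+(2-\delta)\tau r^{2/\alpha},t_0+2\tau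 r^{2/\alpha})\times B(x_0,\delta r)$."
   Context: $B(x,r)$ is the open ball in $\mathbb{R}^N$ with center $x$ and radius $r$; $\mu_{N+1}$ is Lebesgue measure in $\mathbb{R}^{N+1}$; $(\cdot|\cdot)$ is the Euclidean inner product; $Du$ is the spatial gradient. For $\beta>0$, $g_\beta(t)=t^{\beta-1}/\Gamma(\beta)$, $t>0$. Convolution is in time on the positive half-line: $(f_1\ast f_2)(t)=\int_0^t f_1(t-\tau)f_2(\tau)\,d\tau$. The Riemann-Liouville fractional derivative is $\partial_t^\alpha v=\partial_t(g_{1-\alpha}\ast v)$. Weak (super-, sub-)solutions. For $S>0$ and a bounded domain $G\subset\mathbb{R}^N$, let $Z_\alpha$ (for $(0,S)\times G$) be the space of all $v\in L_{\frac{2}{1-\alpha},w}([0,S];L_2(G))\cap L_2([0,S];H^1_2(G))$ such that $g_{1-\alpha}\ast v\in C([0,S];L_2(G))$ and $(g_{1-\alpha}\ast v)|_{t=0}=0$. Here $L_{p,w}$ denotes the weak $L_p$ space and $H^1_2$ the $L_2$-Sobolev space of order one. A function $u$ is a weak solution (subsolution, supersolution) of $\partial_t^\alpha(u-u_0)-\mathrm{div}(A(t,x)Du)=0$ in $(0,S)\times G$ if $u\in Z_\alpha$ and for every nonnegative test function $\zeta\in H^1_2([0,S];L_2(G))\cap L_2([0,S];\mathring H^1_2(G))$ with $\zeta|_{t=S}=0$, where $\mathring H^1_2(G)$ is the closure of $C_0^\infty(G)$ in $H^1_2(G)$, $$\int_0^S\int_G\Big(-\zeta_t\,[g_{1-\alpha}\ast(u-u_0)]+(ADu|D\zeta)\Big)\,dx\,dt=(\le,\ge)\;0.$$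 *)

theory Defs
  imports "HOL-Analysis.Analysis" "HOL-Probability.Essential_Supremum"
begin

text \<open>
  Functions of time and space are functions on \<open>real \<times> (real ^ 'n)\<close>; the dimension is \<open>CARD('n)\<close>.
  Elements of function spaces are represented by Lebesgue measurable functions, and all conditions
  are invariant under changes on null sets. In particular an element of a Bochner space over
  \<open>[0,S]\<close> with values in \<open>L\<^sub>2(G)\<close> or \<open>H\<^sup>1\<^sub>2(G)\<close> is represented by a jointly measurable function on
  \<open>(0,S) \<times> G\<close>; as these spaces are separable Hilbert spaces, joint measurability yields strong
  measurability, and every strongly measurable class has such a representative.
\<close>


subsection \<open>Smooth functions with compact support\<close>

primrec Ck :: "nat \<Rightarrow> ('a::euclidean_space \<Rightarrow> real) \<Rightarrow> bool" where
  "Ck 0 f \<longleftrightarrow> continuous_on UNIV f"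
| "Ck (Suc k) f \<longleftrightarrow> (\<forall>x. f differentiable (at x)) \<and>
     (\<forall>b\<in>Basis. Ck k (\<lambda>x. frechet_derivative f (at x) b))"

definition Cc_infinity :: "'a::euclidean_space set \<Rightarrow> ('a \<Rightarrow> real) set" where
  "Cc_infinity G = {\<phi>. (\<forall>k. Ck k \<phi>) \<and> compact (closure {x. \<phi> x \<noteq> 0}) \<and> closure {x. \<phi> x \<noteq> 0} \<subseteq> G}"

definition grad :: "(real ^ 'n \<Rightarrow> real) \<Rightarrow> real ^ 'n \<Rightarrow> real ^ 'n" where
  "grad f x = (\<chi> i. frechet_derivative f (at x) (axis i 1))"


subsection \<open>Function spaces on a domain\<close>

definition L2 :: "'a::euclidean_space set \<Rightarrow> ('a \<Rightarrow> 'b::euclidean_space) set" where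
  "L2 G = {f. f \<in> borel_measurable (lebesgue_on G) \<and> integrable (lebesgue_on G) (\<lambda>x. (norm (f x))\<^sup>2)}"

definition L2_norm :: "'a::euclidean_space set \<Rightarrow> ('a \<Rightarrow> 'b::euclidean_space) \<Rightarrow> real" where
  "L2_norm G f = sqrt (\<integral>x. (norm (f x))\<^sup>2 \<partial>lebesgue_on G)"

text \<open>\<open>f \<in> H\<^sup>1\<^sub>2(G)\<close> with weak gradient \<open>Df\<close>.\<close>

definition H1_with_grad :: "(real ^ 'n) set \<Rightarrow> (real ^ 'n \<Rightarrow> real) \<Rightarrow> (real ^ 'n \<Rightarrow> real ^ 'n) \<Rightarrow> bool" where
  "H1_with_grad G f Df \<longleftrightarrow> f \<in> L2 G \<and> Df \<in> L2 G \<and>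
     (\<forall>\<phi>\<in>Cc_infinity G. \<forall>i.
        (\<integral>x. f x * grad \<phi> x $ i \<partial>lebesgue_on G) = - (\<integral>x. Df x $ i * \<phi> x \<partial>lebesgue_on G))"

text \<open>The same with \<open>f\<close> in the \<open>H\<^sup>1\<^sub>2\<close>-closure of the smooth functions with compact support in \<open>G\<close>.\<close>

definition H1_zero_with_grad :: "(real ^ 'n) set \<Rightarrow> (real ^ 'n \<Rightarrow> real) \<Rightarrow> (real ^ 'n \<Rightarrow> real ^ 'n) \<Rightarrow> bool" where
  "H1_zero_with_grad G f Df \<longleftrightarrow> H1_with_grad G f Df \<and>
     (\<exists>\<phi>. (\<forall>n::nat. \<phi> n \<in> Cc_infinity G) \<and>
        (\<lambda>n. L2_norm G (\<lambda>x. \<phi> n x - f x)) \<longlonglongrightarrow> 0 \<and>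
        (\<lambda>n. L2_norm G (\<lambda>x. grad (\<phi> n) x - Df x)) \<longlonglongrightarrow> 0)"


subsection \<open>Function spaces on a cylinder\<close>

definition cylinder :: "real \<Rightarrow> 'a set \<Rightarrow> (real \<times> 'a) set" where
  "cylinder S G = {0<..<S} \<times> G"

text \<open>\<open>v \<in> L\<^sub>2([0,S]; H\<^sup>1\<^sub>2(G))\<close> with spatial gradient \<open>Dv\<close>. By Tonelli, \<open>L2 (cylinder S G)\<close>
  represents \<open>L\<^sub>2([0,S]; L\<^sub>2(G))\<close>.\<close>

definition L2_H1_with_grad ::
  "real \<Rightarrow> (real ^ 'n) set \<Rightarrow> (real \<times> (real ^ 'n) \<Rightarrow> real) \<Rightarrow> (real \<times> (real ^ 'n) \<Rightarrow> real ^ 'n) \<Rightarrow> bool" where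
  "L2_H1_with_grad S G v Dv \<longleftrightarrow> v \<in> L2 (cylinder S G) \<and> Dv \<in> L2 (cylinder S G) \<and>
     (AE t in lebesgue_on {0<..<S}. H1_with_grad G (\<lambda>x. v (t, x)) (\<lambda>x. Dv (t, x)))"

definition L2_H1_zero_with_grad ::
  "real \<Rightarrow> (real ^ 'n) set \<Rightarrow> (real \<times> (real ^ 'n) \<Rightarrow> real) \<Rightarrow> (real \<times> (real ^ 'n) \<Rightarrow> real ^ 'n) \<Rightarrow> bool" where
  "L2_H1_zero_with_grad S G v Dv \<longleftrightarrow> v \<in> L2 (cylinder S G) \<and> Dv \<in> L2 (cylinder S G) \<and>
     (AE t in lebesgue_on {0<..<S}. H1_zero_with_grad G (\<lambda>x. v (t, x)) (\<lambda>x. Dv (t, x)))"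

text \<open>The weak space \<open>L\<^bsub>q,w\<^esub>([0,S]; L\<^sub>2(G))\<close>.\<close>

definition weak_Lq_L2 :: "real \<Rightarrow> real \<Rightarrow> (real ^ 'n) set \<Rightarrow> (real \<times> (real ^ 'n) \<Rightarrow> real) set" where
  "weak_Lq_L2 q S G = {v. v \<in> borel_measurable (lebesgue_on (cylinder S G)) \<and>
     (AE t in lebesgue_on {0<..<S}. (\<lambda>x. v (t, x)) \<in> L2 G) \<and>
     (\<exists>K. \<forall>l>0. l powr q * measure lebesgue {t \<in> {0<..<S}. L2_norm G (\<lambda>x. v (t, x)) > l} \<le> K)}"

text \<open>\<open>w\<close> is the continuous representative of \<open>v\<close> in \<open>C([0,S]; L\<^sub>2(G))\<close>.\<close>

definition cont_rep ::
  "real \<Rightarrow> (real ^ 'n) set \<Rightarrow> (real \<times> (real ^ 'n) \<Rightarrow> real) \<Rightarrow> (real \<Rightarrow> real ^ 'n \<Rightarrow> real) \<Rightarrow> bool" where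
  "cont_rep S G v w \<longleftrightarrow> (\<forall>t\<in>{0..S}. w t \<in> L2 G) \<and>
     (\<forall>t\<in>{0..S}. ((\<lambda>s. L2_norm G (\<lambda>x. w s x - w t x)) \<longlongrightarrow> 0) (at t within {0..S})) \<and>
     (AE t in lebesgue_on {0<..<S}. AE x in lebesgue_on G. w t x = v (t, x))"

text \<open>\<open>v\<close> lies in \<open>C([0,S]; L\<^sub>2(G))\<close> and vanishes at time \<open>s \<in> [0,S]\<close>.\<close>

definition C_L2_vanishing_at :: "real \<Rightarrow> real \<Rightarrow> (real ^ 'n) set \<Rightarrow> (real \<times> (real ^ 'n) \<Rightarrow> real) \<Rightarrow> bool" where
  "C_L2_vanishing_at s S G v \<longleftrightarrow> (\<exists>w. cont_rep S G v w \<and> (AE x in lebesgue_on G. w s x = 0))"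

text \<open>\<open>v \<in> H\<^sup>1\<^sub>2([0,S]; L\<^sub>2(G))\<close> with weak time derivative \<open>vt\<close>.\<close>

definition H1_L2_with_deriv ::
  "real \<Rightarrow> (real ^ 'n) set \<Rightarrow> (real \<times> (real ^ 'n) \<Rightarrow> real) \<Rightarrow> (real \<times> (real ^ 'n) \<Rightarrow> real) \<Rightarrow> bool" where
  "H1_L2_with_deriv S G v vt \<longleftrightarrow> v \<in> L2 (cylinder S G) \<and> vt \<in> L2 (cylinder S G) \<and>
     (\<forall>\<phi>\<in>Cc_infinity {0<..<S}. AE x in lebesgue_on G.
        (\<integral>t. deriv \<phi> t * v (t, x) \<partial>lebesgue_on {0<..<S}) = - (\<integral>t. \<phi> t * vt (t, x) \<partial>lebesgue_on {0<..<S}))"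


subsection \<open>Weak supersolutions of the time-fractional diffusion equation\<close>

definition g_kernel :: "real \<Rightarrow> real \<Rightarrow> real" where
  "g_kernel \<beta> t = t powr (\<beta> - 1) / Gamma \<beta>"

definition time_conv :: "(real \<Rightarrow> real) \<Rightarrow> (real \<times> 'a \<Rightarrow> real) \<Rightarrow> real \<times> 'a \<Rightarrow> real" where
  "time_conv k f = (\<lambda>(t, x). \<integral>s. k (t - s) * f (s, x) \<partial>lebesgue_on {0<..<t})"

definition Z_space :: "real \<Rightarrow> real \<Rightarrow> (real ^ 'n) set \<Rightarrow> (real \<times> (real ^ 'n) \<Rightarrow> real) set" where
  "Z_space \<alpha> S G = {v. v \<in> weak_Lq_L2 (2 / (1 - \<alpha>)) S G \<and> (\<exists>Dv. L2_H1_with_grad S G v Dv) \<and>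
     C_L2_vanishing_at 0 S G (time_conv (g_kernel (1 - \<alpha>)) v)}"

text \<open>\<open>\<zeta>\<close> is a nonnegative test function with time derivative \<open>\<zeta>t\<close> and spatial gradient \<open>D\<zeta>\<close>.\<close>

definition nonneg_test_function ::
  "real \<Rightarrow> (real ^ 'n) set \<Rightarrow> (real \<times> (real ^ 'n) \<Rightarrow> real) \<Rightarrow> (real \<times> (real ^ 'n) \<Rightarrow> real)
    \<Rightarrow> (real \<times> (real ^ 'n) \<Rightarrow> real ^ 'n) \<Rightarrow> bool" where
  "nonneg_test_function S G \<zeta> \<zeta>t D\<zeta> \<longleftrightarrow>
     H1_L2_with_deriv S G \<zeta> \<zeta>t \<and> L2_H1_zero_with_grad S G \<zeta> D\<zeta> \<and> C_L2_vanishing_at S S G \<zeta> \<and>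
     (AE z in lebesgue_on (cylinder S G). \<zeta> z \<ge> 0)"

text \<open>The gradient \<open>Du\<close> and the derivatives of \<open>\<zeta>\<close> are unique up to null sets, so it does not
  matter how they are quantified.\<close>

definition weak_supersolution ::
  "real \<Rightarrow> real \<Rightarrow> (real ^ 'n) set \<Rightarrow> (real \<times> (real ^ 'n) \<Rightarrow> real ^ 'n ^ 'n) \<Rightarrow> (real ^ 'n \<Rightarrow> real)
    \<Rightarrow> (real \<times> (real ^ 'n) \<Rightarrow> real) \<Rightarrow> bool" where
  "weak_supersolution \<alpha> S G A u0 u \<longleftrightarrow> u \<in> Z_space \<alpha> S G \<and>
     (\<exists>Du. L2_H1_with_grad S G u Du \<and>
       (\<forall>\<zeta> \<zeta>t D\<zeta>. nonneg_test_function S G \<zeta> \<zeta>t D\<zeta> \<longrightarrow>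
          (\<integral>z. - \<zeta>t z * time_conv (g_kernel (1 - \<alpha>)) (\<lambda>(s, x). u (s, x) - u0 x) z
               + (A z *v Du z) \<bullet> D\<zeta> z \<partial>lebesgue_on (cylinder S G)) \<ge> 0))"


subsection \<open>Coefficients, domains, and the two sides of the weak Harnack inequality\<close>

text \<open>The bound by \<open>\<Lambda>\<close> makes the measurable matrix function \<open>A\<close> essentially bounded.\<close>

definition admissible_coeff ::
  "real \<Rightarrow> real \<Rightarrow> (real \<times> (real ^ 'n)) set \<Rightarrow> (real \<times> (real ^ 'n) \<Rightarrow> real ^ 'n ^ 'n) \<Rightarrow> bool" where
  "admissible_coeff \<nu> \<Lambda> Q A \<longleftrightarrow> A \<in> borel_measurable (lebesgue_on Q) \<and>
     (AE z in lebesgue_on Q. (\<Sum>i\<in>UNIV. \<Sum>j\<in>UNIV. \<bar>A z $ i $ j\<bar>\<^sup>2) \<le> \<Lambda>\<^sup>2) \<and>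
     (AE z in lebesgue_on Q. \<forall>\<xi>. (A z *v \<xi>) \<bullet> \<xi> \<ge> \<nu> * (norm \<xi>)\<^sup>2)"

definition bounded_domain :: "'a::euclidean_space set \<Rightarrow> bool" where
  "bounded_domain \<Omega> \<longleftrightarrow> open \<Omega> \<and> connected \<Omega> \<and> bounded \<Omega> \<and> \<Omega> \<noteq> {}"

definition ennreal_powr :: "ennreal \<Rightarrow> real \<Rightarrow> ennreal" where
  "ennreal_powr y a = (if y = \<infinity> then \<infinity> else ennreal (enn2real y powr a))"

text \<open>The \<open>p\<close>-mean of an (a.e.) nonnegative function \<open>u\<close> over \<open>Q\<close>, for \<open>p > 0\<close>; it may be infinite.\<close>

definition p_mean :: "real \<Rightarrow> 'a::euclidean_space set \<Rightarrow> ('a \<Rightarrow> real) \<Rightarrow> ennreal" where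
  "p_mean p Q u =
     ennreal_powr ((\<integral>\<^sup>+z. ennreal (u z powr p) \<partial>lebesgue_on Q) / emeasure lebesgue Q) (1 / p)"

definition ess_inf :: "'a::euclidean_space set \<Rightarrow> ('a \<Rightarrow> real) \<Rightarrow> ereal" where
  "ess_inf Q u = - esssup (lebesgue_on Q) (\<lambda>z. - ereal (u z))"

definition Q_minus :: "real \<Rightarrow> real \<Rightarrow> real \<Rightarrow> real \<Rightarrow> 'a::metric_space \<Rightarrow> real \<Rightarrow> (real \<times> 'a) set" where
  "Q_minus \<alpha> \<delta> \<tau> t0 x0 r = {t0<..<t0 + \<delta> * \<tau> * r powr (2 / \<alpha>)} \<times> ball x0 (\<delta> * r)"

definition Q_plus :: "real \<Rightarrow> real \<Rightarrow> real \<Rightarrow> real \<Rightarrow> 'a::metric_space \<Rightarrow> real \<Rightarrow> (real \<times> 'a) set" where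
  "Q_plus \<alpha> \<delta> \<tau> t0 x0 r =
     {t0 + (2 - \<delta>) * \<tau> * r powr (2 / \<alpha>)<..<t0 + 2 * \<tau> * r powr (2 / \<alpha>)} \<times> ball x0 (\<delta> * r)"

end

(*
  The extremal object is the solution Y of d_t^alpha Y - Laplace Y = delta(t) delta(x). By scaling
  it behaves like t^(-(alpha N/2 + 1 - alpha)) for |x|^2 <= t^alpha, which just fails to be in L_p
  near the origin for the critical p. Y is approximated by nonnegative supersolutions u on (0,1)
  (A = identity, u_0 = 0) whose source has bounded mass and is concentrated near the origin.

  Such u are finite sums of functions g_b(t) cos(kappa.x) with integer frequencies kappa: a truncated
  Mittag-Leffler series for each frequency of the source (polynomial in t) * (Fejer kernel in x).
  The truncation error of the source is uniformly small and is absorbed by a multiple of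
  g_{1+alpha}(t). Positivity of u is the maximum principle; periodicity in x supplies a minimum.

  The mass of the source over a period cell bounds the integral of u there, hence ess inf u on Q_+.
  Testing the equation with a cutoff of the cylinder Z_k of spatial radius 2^-k gives
  4^k * int_{Z_k} u >= c for k = 1..K. Summing these over k and applying the Hoelder inequality
  with the weight sum_k 4^k 1_{Z_k}, whose conjugate norm to the power q is O(K), forces
  the L_p norm of u on Q_- to tend to infinity as K grows, the inequality 2 q <= N + 2/alpha
  for the conjugate exponent q being exactly the condition on p.
*)
theory Submission
  imports Defs "HOL-Real_Asymp.Real_Asymp"
begin

text \<open>The weak formulation asks for membership in Z_\<alpha>, for a continuous representative
  of a convolution, and for an inequality against all Sobolev test functions. For finite sums of
  g_b(t) cos(\<kappa>.x) all of this is explicit: convolution with a kernel only shifts b, the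
  cosine is an eigenfunction of the Laplacian, and b \<ge> 1 + \<alpha> keeps function and source
  bounded. So neither an existence theory nor estimates of the fundamental solution enter. The price
  is that every such u is bounded, so no single u refutes the inequality: for each C a suitable u is
  needed. This works because at the critical exponent all dyadic parabolic cylinders contribute
  equally by scaling. K scales force the integral of u^p over Q_- to be at least a multiple of K,
  while the mass, and with it the infimum over Q_+, is bounded independently of K. The solutions are
  never estimated pointwise from below. Testing yields only lower bounds for integrals of u over
  cylinders, and these are turned into a bound of the L_p norm by duality. A larger p has a smaller
  conjugate exponent q, which only improves the estimate of the weight.\<close>

section \<open>The kernels \<open>g\<^sub>\<beta>\<close>\<close>

lemma g_kernel_nonneg: "0 < b \<Longrightarrow> 0 \<le> g_kernel b t"
  by (simp add: g_kernel_def Gamma_real_nonneg)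

lemma g_kernel_pos: "0 < b \<Longrightarrow> 0 < t \<Longrightarrow> 0 < g_kernel b t"
  by (simp add: g_kernel_def Gamma_real_pos)

lemma g_kernel_zero [simp]: "g_kernel b 0 = 0"
  by (simp add: g_kernel_def)

lemma g_kernel_one [simp]: "0 < t \<Longrightarrow> g_kernel 1 t = 1"
  by (simp add: g_kernel_def)

lemma g_kernel_measurable [measurable]: "g_kernel b \<in> borel_measurable borel"
  unfolding g_kernel_def by measurable

lemma g_kernel_nat: "0 < t \<Longrightarrow> g_kernel (real m + 1) t = t ^ m / fact m"
  by (simp add: g_kernel_def powr_realpow Gamma_fact add.commute)

text \<open>Scaling \<open>s\<close> by \<open>t\<close> reduces the integral to Euler's Beta
  integral over (0,1). This semigroup law drives the later computations in time:
  \<open>a = 1\<close> gives primitives, \<open>a = 2\<close> linear ramps, and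
  \<open>a = 1 - \<alpha>\<close> the convolution inside the fractional derivative.\<close>

lemma has_bochner_integral_g_kernel_conv:
  assumes a: "0 < a" and b: "0 < b" and t: "0 < t"
  shows "has_bochner_integral lborel
           (\<lambda>s. indicator {0<..<t} s * (g_kernel a (t - s) * g_kernel b s)) (g_kernel (a + b) t)"
proof -
  let ?B = "\<lambda>s::real. s powr (b - 1) * (1 - s) powr (a - 1)"
  have "(?B has_integral Beta b a) {0<..<1}"
    using has_integral_Beta_real[OF b a] by (simp add: has_integral_Icc_iff_Ioo)
  then have "(\<integral>\<^sup>+ s. ennreal (indicator {0<..<1} s * ?B s) \<partial>lborel) = ennreal (Beta b a)"
    by (rule nn_integral_has_integral_lebesgue[rotated]) auto
  moreover have "0 \<le> Beta b a"
    unfolding Beta_def using a b by (intro divide_nonneg_pos mult_nonneg_nonneg Gamma_real_nonneg Gamma_real_pos) auto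
  ultimately have "has_bochner_integral lborel (\<lambda>s. indicator {0<..<1} s * ?B s) (Beta b a)"
    by (intro has_bochner_integral_nn_integral) (auto intro!: AE_I2 mult_nonneg_nonneg)
  then have "has_bochner_integral lborel (\<lambda>s. indicator {0<..<1} (0 + (1/t) * s) * ?B (0 + (1/t) * s)) (Beta b a /\<^sub>R \<bar>1/t\<bar>)"
    using t by (subst (asm) lborel_has_bochner_integral_real_affine_iff[where c="1/t" and t=0]) auto
  then have "has_bochner_integral lborel (\<lambda>s. (t powr (a + b - 2) / (Gamma a * Gamma b)) *
      (indicator {0<..<1} (0 + (1/t) * s) * ?B (0 + (1/t) * s)))
      ((t powr (a + b - 2) / (Gamma a * Gamma b)) * (Beta b a /\<^sub>R \<bar>1/t\<bar>))"
    by (intro has_bochner_integral_mult_right) auto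
  moreover have "(t powr (a + b - 2) / (Gamma a * Gamma b)) *
      (indicator {0<..<1} (0 + (1/t) * s) * ?B (0 + (1/t) * s)) =
      indicator {0<..<t} s * (g_kernel a (t - s) * g_kernel b s)" for s
  proof (cases "s \<in> {0<..<t}")
    case True
    then have s: "0 < s" "s < t" by auto
    have "(1 - s / t) = (t - s) / t" using t by (simp add: field_simps)
    then have "(s/t) powr (b - 1) * (1 - s/t) powr (a - 1) = s powr (b-1) * (t - s) powr (a - 1) / (t powr (b-1) * t powr (a-1))"
      using s t by (simp add: powr_divide)
    moreover have "t powr (b-1) * t powr (a-1) = t powr (a + b - 2)"
      by (simp add: powr_add[symmetric] algebra_simps)
    ultimately show ?thesis using s t by (simp add: g_kernel_def)
  next
    case False
    then have "(1/t) * s \<notin> {0<..<1}" using t by (auto simp: field_simps)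
    then show ?thesis using False by simp
  qed
  moreover have "(t powr (a + b - 2) / (Gamma a * Gamma b)) * (Beta b a /\<^sub>R \<bar>1/t\<bar>) = g_kernel (a + b) t"
  proof -
    have "t powr (a + b - 2) * t = t powr (a + b - 1)"
      using t powr_add[of t "a+b-2" 1] by simp
    moreover have "Gamma a \<noteq> 0" "Gamma b \<noteq> 0" using a b by (auto simp: Gamma_real_pos less_imp_neq[THEN not_sym])
    ultimately show ?thesis using t
      by (simp add: g_kernel_def Beta_def field_simps)
  qed
  ultimately show ?thesis by simp
qed

lemma has_bochner_integral_g_kernel:
  assumes "0 < b" "0 < t"
  shows "has_bochner_integral lborel (\<lambda>s. indicator {0<..<t} s * g_kernel b s) (g_kernel (b + 1) t)"
proof -
  have "has_bochner_integral lborel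
           (\<lambda>s. indicator {0<..<t} s * (g_kernel 1 (t - s) * g_kernel b s)) (g_kernel (1 + b) t)"
    using assms by (intro has_bochner_integral_g_kernel_conv) auto
  also have "(\<lambda>s. indicator {0<..<t} s * (g_kernel 1 (t - s) * g_kernel b s)) = (\<lambda>s. indicator {0<..<t} s * g_kernel b s)"
    by (auto simp: fun_eq_iff indicator_def)
  finally show ?thesis by (simp add: add.commute)
qed

lemma g_kernel_has_derivative:
  assumes "1 < b" "0 < t"
  shows "(g_kernel b has_real_derivative g_kernel (b - 1) t) (at t)"
proof -
  have "Gamma b = (b - 1) * Gamma (b - 1)"
    using Gamma_plus1[of "b - 1"] assms by (auto simp: nonpos_Ints_def)
  moreover have "Gamma (b - 1) > 0" "Gamma b > 0" using assms by (auto intro!: Gamma_real_pos)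
  ultimately have "(b - 1) * t powr (b - 1 - 1) / Gamma b = g_kernel (b - 1) t"
    using assms by (simp add: g_kernel_def)
  moreover have "((\<lambda>t. t powr (b - 1) / Gamma b) has_real_derivative (b - 1) * t powr (b - 1 - 1) / Gamma b) (at t)"
    using assms has_real_derivative_powr[of t "b - 1"] by (intro DERIV_cdivide) auto
  ultimately show ?thesis by (simp add: g_kernel_def[abs_def])
qed

lemma g_kernel_continuous:
  assumes "1 < b" shows "continuous_on {0..} (g_kernel b)"
  unfolding g_kernel_def[abs_def] divide_inverse using assms by (intro continuous_intros continuous_on_powr') auto

lemma g_kernel_antimono:
  assumes "0 < b" "b \<le> 1" "0 < s" "s \<le> t"
  shows "g_kernel b t \<le> g_kernel b s"
  unfolding g_kernel_def using assms
  by (intro divide_right_mono powr_mono2' Gamma_real_nonneg) auto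

lemma g_kernel_mono:
  assumes "1 \<le> b" "0 \<le> s" "s \<le> t"
  shows "g_kernel b s \<le> g_kernel b t"
  unfolding g_kernel_def using assms
  by (intro divide_right_mono powr_mono2 Gamma_real_nonneg) auto

text \<open>Only the part of the Gamma integral over [R, oo) is kept; there the power of t is at
  least that of R because x \<ge> 1. As R is free, Gamma outgrows every exponential.\<close>

lemma Gamma_ge_powr:
  fixes R x :: real
  assumes "1 \<le> x" "0 < R"
  shows "R powr (x - 1) * exp (- R) \<le> Gamma x"
proof -
  have "((\<lambda>t. t powr (x - 1) / exp t) has_integral Gamma x) {0..}"
    using assms by (intro Gamma_integral_real) auto
  moreover have "((\<lambda>t. exp (-1 * t) * R powr (x-1)) has_integral exp (-1 * R)/1 * R powr (x-1)) {R..}"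
    by (intro has_integral_mult_left has_integral_exp_minus_to_infinity) auto
  then have "((\<lambda>t. if t \<in> {R..} then exp (-1 * t) * R powr (x-1) else 0) has_integral exp (-1 * R)/1 * R powr (x-1)) {0..}"
    using assms by (subst has_integral_restrict) auto
  ultimately have "exp (-1 * R)/1 * R powr (x-1) \<le> Gamma x"
    using assms by (elim has_integral_le) (auto simp: exp_minus field_simps intro!: powr_mono2)
  then show ?thesis by (simp add: mult.commute)
qed

text \<open>These are the remainder terms of a Mittag-Leffler series: \<open>l\<close> stands for
  |\<kappa>|^2, and time 1 is the worst case on (0,1] for kernels with exponent at least 1.\<close>

lemma power_over_Gamma_tendsto_0:
  fixes \<alpha> c l :: real
  assumes "0 < \<alpha>" "1 \<le> c" "0 \<le> l"
  shows "(\<lambda>J. l ^ J * g_kernel (c + \<alpha> * real J) 1) \<longlonglongrightarrow> 0"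
proof -
  \<comment> \<open>With R^\<alpha> = 2l + 1 the lower bound for Gamma contains the factor (2l +
    1)^J, and l/(2l + 1) \<le> 1/2 gives geometric decay. The summand 1 keeps R positive when l =
    0.\<close>
  define R where "R = (2 * l + 1) powr (1 / \<alpha>)"
  have R: "0 < R" "R powr \<alpha> = 2 * l + 1" using assms by (auto simp: R_def powr_powr)
  define C where "C = exp R / R powr (c - 1)"
  have C: "0 < C" using R by (auto simp: C_def)
  have "l ^ J * g_kernel (c + \<alpha> * real J) 1 \<le> C * (1/2) ^ J" for J
  proof -
    have "0 \<le> \<alpha> * real J" using assms by simp
    then have x1: "1 \<le> c + \<alpha> * real J" using assms(2) by linarith
    have "R powr (c + \<alpha> * real J - 1) = R powr (c - 1) * (2 * l + 1) ^ J"
      using R powr_add[of R "c - 1" "\<alpha> * real J"] powr_powr[of R \<alpha> "real J"] assms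
      by (simp add: powr_realpow algebra_simps)
    then have "R powr (c - 1) * (2 * l + 1) ^ J * exp (-R) \<le> Gamma (c + \<alpha> * real J)"
      using Gamma_ge_powr[OF x1 R(1)] by simp
    moreover have p: "0 < R powr (c - 1) * (2 * l + 1) ^ J * exp (-R)" using R assms by auto
    ultimately have "g_kernel (c + \<alpha> * real J) 1 \<le> 1 / (R powr (c - 1) * (2 * l + 1) ^ J * exp (-R))"
      by (simp add: g_kernel_def frac_le)
    also have "\<dots> = C * (1 / (2 * l + 1)) ^ J" by (simp add: C_def exp_minus power_one_over field_simps)
    finally have "l ^ J * g_kernel (c + \<alpha> * real J) 1 \<le> l ^ J * (C * (1 / (2 * l + 1)) ^ J)"
      using assms by (intro mult_left_mono) auto
    also have "\<dots> = C * (l / (2 * l + 1)) ^ J" by (simp add: power_divide)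
    also have "\<dots> \<le> C * (1/2) ^ J" using assms C
      by (intro mult_left_mono power_mono) (auto simp: field_simps)
    finally show ?thesis .
  qed
  note upper = this
  have lower: "0 \<le> l ^ J * g_kernel (c + \<alpha> * real J) 1" for J
    using assms by (intro mult_nonneg_nonneg g_kernel_nonneg add_pos_nonneg) auto
  have "(\<lambda>J. C * (1/2::real) ^ J) \<longlonglongrightarrow> C * 0"
    by (intro tendsto_intros) auto
  then have "(\<lambda>J. C * (1/2::real) ^ J) \<longlonglongrightarrow> 0"
    by (metis mult_zero_right)
  then show ?thesis
    by (rule tendsto_sandwich[OF always_eventually[OF allI[OF lower]] always_eventually[OF allI[OF upper]] tendsto_const])
qed

section \<open>Integrals of products of functions of single coordinates\<close>

lemma
  fixes h :: "'a::euclidean_space \<Rightarrow> real \<Rightarrow> 'b::{real_normed_field,banach,second_countable_topology}"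
  assumes "\<And>b. b \<in> Basis \<Longrightarrow> integrable lborel (h b)"
  shows integral_lborel_prod_Basis:
      "(\<integral>x. (\<Prod>b\<in>Basis. h b (x \<bullet> b)) \<partial>lborel) = (\<Prod>b\<in>Basis. integral\<^sup>L lborel (h b))"
    and integrable_lborel_prod_Basis:
      "integrable lborel (\<lambda>x. \<Prod>b\<in>Basis. h b (x \<bullet> b))"
proof -
  interpret product_sigma_finite "\<lambda>_::'a. lborel :: real measure" by standard
  have h[measurable]: "\<And>b. b \<in> Basis \<Longrightarrow> h b \<in> borel_measurable borel"
    using assms[THEN borel_measurable_integrable] by simp
  have m: "(\<lambda>f. \<Sum>b\<in>Basis. f b *\<^sub>R b) \<in> (\<Pi>\<^sub>M b\<in>Basis. lborel) \<rightarrow>\<^sub>M (borel :: 'a measure)"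
    by measurable
  have m2: "(\<lambda>x. \<Prod>b\<in>Basis. h b (x \<bullet> b)) \<in> borel_measurable (borel :: 'a measure)"
    by measurable
  have eq: "(\<Prod>b\<in>Basis. h b ((\<Sum>b\<in>Basis. f b *\<^sub>R b) \<bullet> b)) = (\<Prod>b\<in>Basis. h b (f b))" for f :: "'a \<Rightarrow> real"
    by (intro prod.cong) (auto simp: inner_sum_left inner_Basis if_distrib cong: if_cong)
  show "(\<integral>x. (\<Prod>b\<in>Basis. h b (x \<bullet> b)) \<partial>lborel) = (\<Prod>b\<in>Basis. integral\<^sup>L lborel (h b))"
    by (subst lborel_eq, subst integral_distr[OF m m2], subst eq)
       (intro product_integral_prod assms finite_Basis)
  show "integrable lborel (\<lambda>x. \<Prod>b\<in>Basis. h b (x \<bullet> b))"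
    by (subst lborel_eq, subst integrable_distr_eq[OF m m2], subst eq)
       (intro product_integrable_prod assms finite_Basis)
qed

section \<open>Integration by parts in space\<close>

lemma integrable_continuous_bounded_support:
  fixes f :: "'a::euclidean_space \<Rightarrow> 'b::euclidean_space"
  assumes c: "continuous_on UNIV f" and R: "\<And>x. norm x > R \<Longrightarrow> f x = 0"
  shows "integrable lborel f"
proof -
  have "integrable lborel (\<lambda>x. indicator (cball 0 R) x *\<^sub>R f x)"
    by (rule borel_integrable_compact) (auto intro: continuous_on_subset[OF c])
  moreover have "indicator (cball 0 R) x *\<^sub>R f x = f x" for x
    using R[of x] by (cases "x \<in> cball 0 R") (auto simp: not_le)
  ultimately show ?thesis by simp
qed

lemma integral_lborel_translation:
  fixes f :: "'a::euclidean_space \<Rightarrow> 'b::{banach,second_countable_topology}"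
  assumes [measurable]: "f \<in> borel_measurable borel"
  shows "(\<integral>x. f (x + c) \<partial>lborel) = integral\<^sup>L lborel f"
proof -
  have "integral\<^sup>L (distr lborel borel ((+) c)) f = (\<integral>x. f (c + x) \<partial>lborel)"
    by (rule integral_distr) auto
  then show ?thesis by (simp add: lborel_distr_plus add.commute)
qed

text \<open>Integrate f(x + e) - f(x) over all x. By translation invariance the result is 0; by the
  fundamental theorem along the segment from x to x + e and by Fubini it is the integral over s in
  (0,1) of the integral of f'(x + s e) in x, which is the integral of f'.\<close>

lemma integral_directional_derivative_eq_0:
  fixes f f' :: "'a::euclidean_space \<Rightarrow> real"
  assumes d: "\<And>x. ((\<lambda>s. f (x + s *\<^sub>R e)) has_real_derivative f' x) (at 0)"
    and c: "continuous_on UNIV f" and c': "continuous_on UNIV f'"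
    and R: "\<And>x. norm x > R \<Longrightarrow> f x = 0" and R': "\<And>x. norm x > R \<Longrightarrow> f' x = 0"
  shows "(\<integral>x. f' x \<partial>lborel) = 0"
proof -
  have [measurable]: "f \<in> borel_measurable borel" "f' \<in> borel_measurable borel"
    using c c' by (auto intro: borel_measurable_continuous_onI)
  have i: "integrable lborel f" "integrable lborel f'"
    by (auto intro!: integrable_continuous_bounded_support[of _ R] c c' R R')
  have d2: "((\<lambda>s. f (x + s *\<^sub>R e)) has_real_derivative f' (x + s *\<^sub>R e)) (at s)" for x s
  proof -
    have "((\<lambda>r. f ((x + s *\<^sub>R e) + r *\<^sub>R e)) has_real_derivative f' (x + s *\<^sub>R e)) (at 0)" by (rule d)
    then have "((\<lambda>r. f (x + (r + s) *\<^sub>R e)) has_real_derivative f' (x + s *\<^sub>R e)) (at 0)"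
      by (simp add: algebra_simps)
    then show ?thesis
      using DERIV_shift[of "\<lambda>s. f (x + s *\<^sub>R e)" "f' (x + s *\<^sub>R e)" 0 s] by simp
  qed
  have ftc: "(\<integral>s. indicator {0..1} s *\<^sub>R f' (x + s *\<^sub>R e) \<partial>lborel) = f (x + e) - f x" for x
  proof -
    have "continuous_on UNIV (\<lambda>s. f' (x + s *\<^sub>R e))"
      by (intro continuous_on_compose2[OF c'] continuous_intros) auto
    then have "isCont (\<lambda>s. f' (x + s *\<^sub>R e)) s" for s
      by (simp add: continuous_on_eq_continuous_at)
    then show ?thesis
      using integral_FTC_Icc_real[of 0 1 "\<lambda>s. f (x + s *\<^sub>R e)" "\<lambda>s. f' (x + s *\<^sub>R e)"] d2
      by (simp add: mult.commute)
  qed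
  let ?g = "\<lambda>(s, x). indicator {0..1} s *\<^sub>R f' (x + s *\<^sub>R e)"
  have "integrable (lborel \<Otimes>\<^sub>M lborel) ?g"
  proof -
    \<comment> \<open>Enlarging the radius by |e| covers the supports of all translates by s e with
      s in [0,1], so the integrand lives on a compact set.\<close>
    have "integrable (lborel :: (real \<times> 'a) measure) (\<lambda>z. indicator ({0..1} \<times> cball 0 (R + norm e)) z *\<^sub>R f' (snd z + fst z *\<^sub>R e))"
      by (rule borel_integrable_compact)
         (auto intro!: compact_Times continuous_intros continuous_on_compose2[OF c'])
    also have "(\<lambda>z. indicator ({0..1} \<times> cball 0 (R + norm e)) z *\<^sub>R f' (snd z + fst z *\<^sub>R e)) = ?g"
    proof (rule ext, clarify)
      fix s :: real and x :: 'a
      show "indicator ({0..1} \<times> cball 0 (R + norm e)) (s,x) *\<^sub>R f' (snd (s,x) + fst (s,x) *\<^sub>R e)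
         = indicator {0..1} s *\<^sub>R f' (x + s *\<^sub>R e)"
      proof (cases "s \<in> {0..1} \<and> norm x > R + norm e")
        case True
        then have "norm (s *\<^sub>R e) \<le> norm e" by (auto simp: mult_left_le_one_le)
        moreover have "norm x \<le> norm (x + s *\<^sub>R e) + norm (s *\<^sub>R e)"
          by (metis add_diff_cancel_right' norm_triangle_ineq4)
        ultimately have "norm (x + s *\<^sub>R e) > R" using True by linarith
        then show ?thesis using R' by simp
      qed (auto simp: indicator_def)
    qed
    finally show ?thesis by (simp add: lborel_prod)
  qed
  then have "(\<integral>s. (\<integral>x. indicator {0..1} s *\<^sub>R f' (x + s *\<^sub>R e) \<partial>lborel) \<partial>lborel)
     = (\<integral>x. (\<integral>s. indicator {0..1} s *\<^sub>R f' (x + s *\<^sub>R e) \<partial>lborel) \<partial>lborel)"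
    by (intro lborel_pair.Fubini_integral[symmetric]) simp
  also have "\<dots> = (\<integral>x. f (x + e) - f x \<partial>lborel)" by (simp only: ftc)
  also have "\<dots> = (\<integral>x. f (x + e) \<partial>lborel) - integral\<^sup>L lborel f"
  proof (rule Bochner_Integration.integral_diff[OF integrable_continuous_bounded_support[of _ "R + norm e"] i(1)])
    show "continuous_on UNIV (\<lambda>x. f (x + e))"
      by (intro continuous_on_compose2[OF c] continuous_intros) auto
    show "f (x + e) = 0" if "R + norm e < norm x" for x
      using that norm_triangle_ineq4[of "x + e" e] by (intro R) simp
  qed
  also have "\<dots> = 0" by (simp add: integral_lborel_translation)
  also have "(\<integral>s. (\<integral>x. indicator {0..1} s *\<^sub>R f' (x + s *\<^sub>R e) \<partial>lborel) \<partial>lborel)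
     = (\<integral>s. indicator {0..1::real} s *\<^sub>R (\<integral>x. f' x \<partial>lborel) \<partial>lborel)"
    by (simp add: integral_lborel_translation)
  finally show ?thesis by simp
qed

text \<open>Bounded support is asked of \<open>g\<close> only, so that \<open>f\<close> can be a
  trigonometric function on the whole space.\<close>

lemma integral_by_parts_directional:
  fixes f f' g g' :: "'a::euclidean_space \<Rightarrow> real"
  assumes df: "\<And>x. ((\<lambda>s. f (x + s *\<^sub>R e)) has_real_derivative f' x) (at 0)"
    and dg: "\<And>x. ((\<lambda>s. g (x + s *\<^sub>R e)) has_real_derivative g' x) (at 0)"
    and c: "continuous_on UNIV f" "continuous_on UNIV f'" "continuous_on UNIV g" "continuous_on UNIV g'"
    and R: "\<And>x. norm x > R \<Longrightarrow> g x = 0" and R': "\<And>x. norm x > R \<Longrightarrow> g' x = 0"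
  shows "(\<integral>x. f x * g' x \<partial>lborel) = - (\<integral>x. f' x * g x \<partial>lborel)"
proof -
  have "(\<integral>x. f x * g' x + f' x * g x \<partial>lborel) = 0"
  proof (rule integral_directional_derivative_eq_0[where R=R and f="\<lambda>x. f x * g x" and e=e])
    show "((\<lambda>s. f (x + s *\<^sub>R e) * g (x + s *\<^sub>R e)) has_real_derivative f x * g' x + f' x * g x) (at 0)" for x
      using DERIV_mult[OF df dg, of x x] by (simp add: algebra_simps)
  qed (auto intro!: continuous_intros c simp: R R')
  moreover have "integrable lborel (\<lambda>x. f x * g' x)" "integrable lborel (\<lambda>x. f' x * g x)"
    by (auto intro!: integrable_continuous_bounded_support[where R=R] continuous_intros c simp: R R')
  ultimately show ?thesis by simp
qed

section \<open>Smooth functions with compact support as test functions\<close>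

lemma Cc_infinity_bounded_support:
  assumes "\<phi> \<in> Cc_infinity G"
  obtains R where "\<And>x. norm x > R \<Longrightarrow> \<phi> x = 0"
proof -
  have "bounded (closure {x. \<phi> x \<noteq> 0})" using assms by (auto simp: Cc_infinity_def compact_imp_bounded)
  then obtain R where "\<And>x. x \<in> closure {x. \<phi> x \<noteq> 0} \<Longrightarrow> norm x \<le> R" by (auto simp: bounded_iff)
  moreover have "x \<in> closure {x. \<phi> x \<noteq> 0}" if "\<phi> x \<noteq> 0" for x
    using that closure_subset[of "{x. \<phi> x \<noteq> 0}"] by blast
  ultimately show ?thesis using that[of R] by (metis not_le)
qed

lemma Cc_infinity_differentiable:
  assumes "\<phi> \<in> Cc_infinity G" shows "\<phi> differentiable (at x)"
proof -
  have "Ck (Suc 0) \<phi>" using assms unfolding Cc_infinity_def by blast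
  then show ?thesis by simp
qed

lemma Cc_infinity_continuous:
  assumes "\<phi> \<in> Cc_infinity G" shows "continuous_on UNIV \<phi>"
  using Cc_infinity_differentiable[OF assms]
  by (intro continuous_at_imp_continuous_on ballI differentiable_imp_continuous_within)

lemma Cc_infinity_grad_continuous:
  fixes \<phi> :: "real ^ 'n \<Rightarrow> real"
  assumes "\<phi> \<in> Cc_infinity G" shows "continuous_on UNIV (\<lambda>x. grad \<phi> x $ i)"
proof -
  have "Ck (Suc 0) \<phi>" using assms unfolding Cc_infinity_def by blast
  moreover have "axis i (1::real) \<in> Basis" by simp
  ultimately show ?thesis by (simp add: grad_def)
qed

lemma Cc_infinity_zero_outside: "\<phi> \<in> Cc_infinity G \<Longrightarrow> x \<notin> G \<Longrightarrow> \<phi> x = 0"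
  unfolding Cc_infinity_def using closure_subset[of "{x. \<phi> x \<noteq> 0}"] by auto

lemma grad_zero_off_support:
  assumes "x \<notin> closure {x. \<phi> x \<noteq> 0}" shows "grad \<phi> x = 0"
proof -
  have "open (- closure {x. \<phi> x \<noteq> 0})" by blast
  moreover have "\<phi> y = 0" if "y \<in> - closure {x. \<phi> x \<noteq> 0}" for y
    using that closure_subset[of "{x. \<phi> x \<noteq> 0}"] by auto
  ultimately have "(\<phi> has_derivative (\<lambda>_. 0)) (at x)"
    by (intro has_derivative_transform_within_open[OF has_derivative_const[of 0]
          \<open>open (- closure {x. \<phi> x \<noteq> 0})\<close>]) (use assms in blast, metis)
  then have "frechet_derivative \<phi> (at x) = (\<lambda>_. 0)" by (metis frechet_derivative_at)
  then show ?thesis by (simp add: grad_def vec_eq_iff)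
qed

lemma Cc_infinity_grad_zero_outside:
  assumes "\<phi> \<in> Cc_infinity G" "x \<notin> G" shows "grad \<phi> x = 0"
  using assms by (intro grad_zero_off_support) (auto simp: Cc_infinity_def)

lemma Cc_infinity_directional_derivative:
  fixes \<phi> :: "real ^ 'n \<Rightarrow> real"
  assumes "\<phi> \<in> Cc_infinity G"
  shows "((\<lambda>s. \<phi> (x + s *\<^sub>R axis i 1)) has_real_derivative grad \<phi> x $ i) (at 0)"
proof -
  have "(\<phi> has_derivative frechet_derivative \<phi> (at x)) (at x)"
    using Cc_infinity_differentiable[OF assms] by (simp add: frechet_derivative_works)
  then have *: "(\<phi> has_derivative frechet_derivative \<phi> (at x)) (at (x + 0 *\<^sub>R axis i 1))" by simp
  have "((\<lambda>s. x + s *\<^sub>R axis i 1) has_derivative (\<lambda>s. s *\<^sub>R axis i 1)) (at (0::real))"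
    by (auto intro!: derivative_eq_intros)
  from has_derivative_compose[OF this *]
  have "((\<lambda>s. \<phi> (x + s *\<^sub>R axis i 1)) has_derivative (\<lambda>s. frechet_derivative \<phi> (at x) (s *\<^sub>R axis i 1))) (at 0)" .
  moreover have "frechet_derivative \<phi> (at x) (s *\<^sub>R axis i 1) = s *\<^sub>R frechet_derivative \<phi> (at x) (axis i 1)" for s
    using linear_frechet_derivative[OF Cc_infinity_differentiable[OF assms]] by (simp add: linear_scale)
  ultimately show ?thesis
    by (simp add: has_field_derivative_def grad_def mult_commute_abs)
qed

lemma integral_lebesgue_on_eq_lborel:
  fixes f :: "'a::euclidean_space \<Rightarrow> 'b::{banach, second_countable_topology}"
  assumes "G \<in> sets borel" "f \<in> borel_measurable borel" "\<And>x. x \<notin> G \<Longrightarrow> f x = 0"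
  shows "integral\<^sup>L (lebesgue_on G) f = integral\<^sup>L lborel f"
proof -
  have "integral\<^sup>L (lebesgue_on G) f = (\<integral>x. indicator G x *\<^sub>R f x \<partial>lebesgue)"
    by (rule integral_restrict_space) (simp add: assms(1))
  also have "(\<lambda>x. indicator G x *\<^sub>R f x) = f" using assms(3) by (auto simp: fun_eq_iff indicator_def)
  finally show ?thesis using assms by (simp add: integral_completion)
qed

text \<open>Turns classical derivatives into weak ones; \<open>f\<close> will be a mode sum or a
  sine factor from the gradient of a mode. As \<phi> and its gradient vanish outside
  \<open>G\<close>, both integrals extend to the whole space, whatever the boundary of
  \<open>G\<close> looks like.\<close>

lemma Cc_infinity_by_parts:
  fixes \<phi> f f' :: "real ^ 'n \<Rightarrow> real"
  assumes \<phi>: "\<phi> \<in> Cc_infinity G" and G: "open G"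
    and c: "continuous_on UNIV f" "continuous_on UNIV f'"
    and d: "\<And>x. ((\<lambda>s. f (x + s *\<^sub>R axis i 1)) has_real_derivative f' x) (at 0)"
  shows "(\<integral>x. f x * grad \<phi> x $ i \<partial>lebesgue_on G) = - (\<integral>x. f' x * \<phi> x \<partial>lebesgue_on G)"
proof -
  obtain R where R: "\<And>x. norm x > R \<Longrightarrow> \<phi> x = 0" using Cc_infinity_bounded_support[OF \<phi>] by blast
  note c\<phi> = Cc_infinity_continuous[OF \<phi>] Cc_infinity_grad_continuous[OF \<phi>]
  have R': "grad \<phi> x = 0" if "norm x > R" for x
  proof -
    have "closure {x. \<phi> x \<noteq> 0} \<subseteq> cball 0 R"
    proof (rule closure_minimal)
      show "{x. \<phi> x \<noteq> 0} \<subseteq> cball 0 R" using R by (metis (mono_tags) mem_Collect_eq mem_cball_0 not_le subsetI)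
    qed simp
    then show ?thesis using that by (intro grad_zero_off_support) auto
  qed
  have [measurable]: "f \<in> borel_measurable borel" "f' \<in> borel_measurable borel" "\<phi> \<in> borel_measurable borel"
     "(\<lambda>x. grad \<phi> x $ i) \<in> borel_measurable borel"
    using c c\<phi> by (auto intro: borel_measurable_continuous_onI)
  have "(\<integral>x. f x * grad \<phi> x $ i \<partial>lborel) = - (\<integral>x. f' x * \<phi> x \<partial>lborel)"
    by (rule integral_by_parts_directional[OF d Cc_infinity_directional_derivative[OF \<phi>] c c\<phi>, where R=R])
       (simp_all add: R R')
  moreover have "(\<integral>x. f x * grad \<phi> x $ i \<partial>lebesgue_on G) = (\<integral>x. f x * grad \<phi> x $ i \<partial>lborel)"
    using G by (intro integral_lebesgue_on_eq_lborel) (auto simp: Cc_infinity_grad_zero_outside[OF \<phi>])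
  moreover have "(\<integral>x. f' x * \<phi> x \<partial>lebesgue_on G) = (\<integral>x. f' x * \<phi> x \<partial>lborel)"
    using G by (intro integral_lebesgue_on_eq_lborel) (auto simp: Cc_infinity_zero_outside[OF \<phi>])
  ultimately show ?thesis by simp
qed

section \<open>Bump functions and the lemma of du Bois-Reymond\<close>

text \<open>On the line the only basis vector is 1, so the recursion in \<open>Ck\<close> concerns
  the ordinary derivative. This rule and the elimination rule below keep Frechet derivatives out of
  the rest of the section.\<close>

lemma Ck_Suc_realI:
  fixes f f' :: "real \<Rightarrow> real"
  assumes "\<And>x. (f has_real_derivative f' x) (at x)" "Ck k f'"
  shows "Ck (Suc k) f"
proof -
  have "frechet_derivative f (at x) = (*) (f' x)" for x
    using assms(1)[of x] by (metis frechet_derivative_at has_field_derivative_def)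
  moreover have "f differentiable (at x)" for x
    using assms(1)[of x] by (auto simp: has_field_derivative_def differentiable_def)
  ultimately show ?thesis using assms(2) by simp
qed

lemma Ck_Suc_realE:
  fixes f :: "real \<Rightarrow> real"
  assumes "Ck (Suc k) f"
  obtains f' where "\<And>x. (f has_real_derivative f' x) (at x)" "Ck k f'"
proof
  have d: "f differentiable (at x)" for x using assms by simp
  show "(f has_real_derivative frechet_derivative f (at x) 1) (at x)" for x
  proof -
    have "(f has_derivative frechet_derivative f (at x)) (at x)"
      using d[of x] by (simp add: frechet_derivative_works)
    moreover have "frechet_derivative f (at x) y = frechet_derivative f (at x) 1 * y" for y
      using linear_scale[OF linear_frechet_derivative[OF d[of x]], of y 1] by simp
    then have "frechet_derivative f (at x) = (*) (frechet_derivative f (at x) 1)"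
      by (rule ext)
    ultimately show ?thesis
      unfolding has_field_derivative_def by simp
  qed
  show "Ck k (\<lambda>x. frechet_derivative f (at x) 1)" using assms by simp
qed

text \<open>For the product rule: in f' g the factor g is used with one derivative less than it
  has.\<close>

lemma Ck_real_mono:
  fixes f :: "real \<Rightarrow> real"
  assumes "Ck (Suc k) f" shows "Ck k f"
  using assms
proof (induction k arbitrary: f)
  case 0
  then obtain f' where "\<And>x. (f has_real_derivative f' x) (at x)" by (rule Ck_Suc_realE) blast
  then show ?case by (auto intro!: continuous_at_imp_continuous_on DERIV_isCont)
next
  case (Suc k)
  from Suc.prems obtain f' where f': "\<And>x. (f has_real_derivative f' x) (at x)" "Ck (Suc k) f'"
    by (rule Ck_Suc_realE) blast
  show ?case by (rule Ck_Suc_realI[OF f'(1) Suc.IH[OF f'(2)]])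
qed

lemma Ck_real_add:
  fixes f g :: "real \<Rightarrow> real"
  assumes "Ck k f" "Ck k g" shows "Ck k (\<lambda>x. f x + g x)"
  using assms
proof (induction k arbitrary: f g)
  case 0
  then show ?case by (auto intro!: continuous_intros)
next
  case (Suc k)
  obtain f' where f': "\<And>x. (f has_real_derivative f' x) (at x)" "Ck k f'"
    using Suc.prems(1) by (rule Ck_Suc_realE) blast
  obtain g' where g': "\<And>x. (g has_real_derivative g' x) (at x)" "Ck k g'"
    using Suc.prems(2) by (rule Ck_Suc_realE) blast
  show ?case
    by (rule Ck_Suc_realI[OF DERIV_add[OF f'(1) g'(1)] Suc.IH[OF f'(2) g'(2)]])
qed

lemma Ck_real_mult:
  fixes f g :: "real \<Rightarrow> real"
  assumes "Ck k f" "Ck k g" shows "Ck k (\<lambda>x. f x * g x)"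
  using assms
proof (induction k arbitrary: f g)
  case 0
  then show ?case by (auto intro!: continuous_intros)
next
  case (Suc k)
  obtain f' where f': "\<And>x. (f has_real_derivative f' x) (at x)" "Ck k f'"
    using Suc.prems(1) by (rule Ck_Suc_realE) blast
  obtain g' where g': "\<And>x. (g has_real_derivative g' x) (at x)" "Ck k g'"
    using Suc.prems(2) by (rule Ck_Suc_realE) blast
  show ?case
    by (rule Ck_Suc_realI[OF DERIV_mult[OF f'(1) g'(1)]
          Ck_real_add[OF Suc.IH[OF f'(2) Ck_real_mono[OF Suc.prems(2)]] Suc.IH[OF g'(2) Ck_real_mono[OF Suc.prems(1)]]]])
qed

lemma Ck_real_affine:
  fixes f :: "real \<Rightarrow> real"
  assumes "Ck k f" shows "Ck k (\<lambda>x. c * f (a + b * x))"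
  using assms
proof (induction k arbitrary: f c)
  case 0
  then have "continuous_on UNIV f" by simp
  then have "continuous_on UNIV (\<lambda>x. f (a + b * x))"
    by (rule continuous_on_compose2) (auto intro!: continuous_intros)
  then show ?case by (auto intro!: continuous_intros)
next
  case (Suc k)
  obtain f' where f': "\<And>x. (f has_real_derivative f' x) (at x)" "Ck k f'"
    using Suc.prems(1) by (rule Ck_Suc_realE) blast
  have "((\<lambda>x. c * f (a + b * x)) has_real_derivative (c * b) * f' (a + b * x)) (at x)" for x
    by (rule derivative_eq_intros DERIV_chain2[OF f'(1)] refl)+ (simp_all add: algebra_simps)
  then show ?case using Suc.IH[OF f'(2), of "c * b"] by (rule Ck_Suc_realI)
qed

text \<open>The functions p(1/x) exp(-1/x), continued by 0, form a family closed under
  differentiation, so one induction over all p proves all of them smooth; \<open>flat_exp 1\<close>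
  is the usual exp(-1/x).\<close>

definition flat_exp :: "real poly \<Rightarrow> real \<Rightarrow> real" where
  "flat_exp p x = (if 0 < x then poly p (1 / x) * exp (- (1 / x)) else 0)"

lemma poly_times_exp_tendsto_0:
  "((\<lambda>y. poly p y * exp (- y)) \<longlongrightarrow> (0::real)) at_top"
proof -
  have "((\<lambda>y. \<Sum>i\<le>degree p. coeff p i * (y ^ i / exp y)) \<longlongrightarrow> (\<Sum>i\<le>degree p. coeff p i * 0)) at_top"
    by (intro tendsto_intros tendsto_power_div_exp_0)
  moreover have "(\<Sum>i\<le>degree p. coeff p i * (y ^ i / exp y)) = poly p y * exp (- y)" for y
    by (simp add: poly_altdef sum_distrib_right exp_minus divide_inverse mult.assoc)
  ultimately show ?thesis by simp
qed

text \<open>With y = 1/x, the derivative in x of p(y) exp(-y) is y^2 (p(y) - p'(y)) exp(-y), whence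
  the polynomial. Only x = 0 needs a limit.\<close>

lemma flat_exp_has_derivative:
  "(flat_exp p has_real_derivative flat_exp ([:0, 0, 1:] * (p - pderiv p)) x) (at x)"
proof -
  consider "x < 0" | "x > 0" | "x = 0" by linarith
  then show ?thesis
  proof cases
    case 1
    have "((\<lambda>_. 0) has_real_derivative 0) (at x)" by simp
    then have "(flat_exp p has_real_derivative 0) (at x)"
      by (rule has_field_derivative_transform_within_open[of _ _ _ "{..<0}"]) (use 1 in \<open>auto simp: flat_exp_def\<close>)
    then show ?thesis using 1 by (simp add: flat_exp_def)
  next
    case 2
    have "((\<lambda>x. poly p (1 / x) * exp (- (1 / x))) has_real_derivative
        (poly (pderiv p) (1 / x) * (- (1 / x^2))) * exp (- (1 / x)) + (exp (- (1 / x)) * (1 / x^2)) * poly p (1 / x)) (at x)"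
      using 2 by (auto intro!: derivative_eq_intros DERIV_chain2[OF poly_DERIV] simp: power2_eq_square divide_simps)
    then have "(flat_exp p has_real_derivative
        (poly (pderiv p) (1 / x) * (- (1 / x^2))) * exp (- (1 / x)) + (exp (- (1 / x)) * (1 / x^2)) * poly p (1 / x)) (at x)"
      using 2 by (intro has_field_derivative_transform_within_open[of _ _ _ "{0<..}" "flat_exp p"]) (auto simp: flat_exp_def)
    moreover have "(poly (pderiv p) (1 / x) * (- (1 / x^2))) * exp (- (1 / x)) + (exp (- (1 / x)) * (1 / x^2)) * poly p (1 / x)
       = flat_exp ([:0, 0, 1:] * (p - pderiv p)) x"
      using 2 by (simp add: flat_exp_def power2_eq_square field_simps)
    ultimately show ?thesis by simp
  next
    case 3
    have "((\<lambda>h. flat_exp p h / h) \<longlongrightarrow> 0) (at_right 0)"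
    proof -
      \<comment> \<open>Dividing by h multiplies the polynomial by its variable 1/h, which replaces
        p by \<open>pCons 0 p\<close>.\<close>
      have "((\<lambda>h. poly (pCons 0 p) (inverse h) * exp (- inverse h)) \<longlongrightarrow> (0::real)) (at_right 0)"
        by (rule filterlim_compose[OF poly_times_exp_tendsto_0 filterlim_inverse_at_top_right])
      moreover have "eventually (\<lambda>h::real. h \<in> {0<..}) (at_right 0)"
        by (auto simp: eventually_at_right_less)
      then have "eventually (\<lambda>h. poly (pCons 0 p) (inverse h) * exp (- inverse h) = flat_exp p h / h) (at_right 0)"
        by eventually_elim (simp add: flat_exp_def field_simps)
      ultimately show ?thesis by (rule Lim_transform_eventually)
    qed
    moreover have "((\<lambda>h. flat_exp p h / h) \<longlongrightarrow> 0) (at_left 0)"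
      by (rule Lim_transform_eventually[OF tendsto_const])
         (auto simp: flat_exp_def eventually_at_left_field intro!: exI[of _ "-1"])
    ultimately have "((\<lambda>h. flat_exp p h / h) \<longlongrightarrow> 0) (at 0)"
      by (simp add: filterlim_at_split)
    then show ?thesis using 3 by (simp add: has_field_derivative_iff flat_exp_def)
  qed
qed

lemma Ck_flat_exp: "Ck k (flat_exp p)"
proof (induction k arbitrary: p)
  case 0
  then show ?case
    by (auto intro!: continuous_at_imp_continuous_on DERIV_isCont[OF flat_exp_has_derivative])
next
  case (Suc k)
  show ?case by (rule Ck_Suc_realI[OF flat_exp_has_derivative Suc.IH])
qed

text \<open>Positive exactly on (0,1). It is left unnormalised, since its integral is a common
  factor that cancels in the comparison of two means.\<close>

definition bump :: "real \<Rightarrow> real" where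
  "bump x = flat_exp 1 x * flat_exp 1 (1 - x)"

lemma bump_pos: "0 < x \<Longrightarrow> x < 1 \<Longrightarrow> 0 < bump x"
  by (simp add: bump_def flat_exp_def)

lemma bump_nonneg: "0 \<le> bump x"
  by (simp add: bump_def flat_exp_def)

lemma bump_eq_0: "x \<notin> {0<..<1} \<Longrightarrow> bump x = 0"
  by (auto simp: bump_def flat_exp_def)

lemma Ck_bump: "Ck k bump"
proof -
  have "Ck k (\<lambda>x. flat_exp 1 x * (1 * flat_exp 1 (1 + (-1) * x)))"
    by (intro Ck_real_mult Ck_real_affine Ck_flat_exp)
  then show ?thesis by (simp add: bump_def[abs_def])
qed

lemma bump_continuous: "continuous_on UNIV bump"
  using Ck_bump[of 0] by simp

lemma bump_integrable: "integrable lborel bump"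
  by (rule integrable_continuous_bounded_support[OF bump_continuous, of 1]) (auto intro!: bump_eq_0)

lemma bump_integral_pos: "0 < integral\<^sup>L lborel bump"
proof -
  have "integral\<^sup>L lborel bump \<noteq> 0"
  proof
    assume "integral\<^sup>L lborel bump = 0"
    then have "AE x in lborel. bump x = 0"
      using integral_nonneg_eq_0_iff_AE[OF bump_integrable] bump_nonneg by auto
    then have "AE x in lborel. x \<notin> {0<..<1::real}"
      by eventually_elim (use bump_pos in force)
    then have "emeasure lborel {0<..<1::real} = 0"
      by (subst (asm) AE_iff_measurable[of "{0<..<1}"]) auto
    then show False by simp
  qed
  moreover have "0 \<le> integral\<^sup>L lborel bump" by (simp add: bump_nonneg)
  ultimately show ?thesis by simp
qed

text \<open>A primitive of the bump is constant on either side of (0,1), so the difference of two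
  shifted and scaled copies vanishes outside [a, b + h]. Testing with its derivative compares a
  weighted mean just to the right of \<open>a\<close> with one just to the right of
  \<open>b\<close>.\<close>

lemma smooth_plateau_exists:
  assumes "0 < a" "a < b" "0 < h" "b + h < S"
  obtains \<phi> where "\<phi> \<in> Cc_infinity {0<..<S}"
    "\<And>t. deriv \<phi> t = bump ((t - a) / h) / h - bump ((t - b) / h) / h"
proof -
  obtain \<Psi> where "\<And>x::real. (\<Psi> has_vector_derivative bump x) (at x)"
    using einterval_antiderivative[of "-\<infinity>" \<infinity> bump] bump_continuous
    by (auto simp: continuous_on_eq_continuous_at)
  then have d: "(\<Psi> has_real_derivative bump x) (at x)" for x
    by (simp add: has_real_derivative_iff_has_vector_derivative)
  have const: "\<Psi> x = \<Psi> y" if xy: "x \<le> y" and xy': "y \<le> 0 \<or> 1 \<le> x" for x y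
  proof (cases "x = y")
    case False
    then obtain z where z: "x < z" "z < y" "\<Psi> y - \<Psi> x = (y - x) * bump z"
      using MVT2[of x y \<Psi> bump] d xy order_le_imp_less_or_eq[of x y] by blast
    then have "bump z = 0" using xy' by (intro bump_eq_0) auto
    then show ?thesis using z by simp
  qed simp
  define \<phi> where "\<phi> t = \<Psi> ((t - a) / h) - \<Psi> ((t - b) / h)" for t
  have d\<phi>: "(\<phi> has_real_derivative bump ((t - a) / h) / h - bump ((t - b) / h) / h) (at t)" for t
    unfolding \<phi>_def[abs_def] using assms
    by (auto intro!: derivative_eq_intros DERIV_chain2[OF d])
  have "Ck k (\<lambda>t. bump ((t - a) / h) / h - bump ((t - b) / h) / h)" for k
  proof -
    have "Ck k (\<lambda>t. (1/h) * bump (- a / h + (1/h) * t) + (- (1/h)) * bump (- b / h + (1/h) * t))"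
      by (intro Ck_real_add Ck_real_affine Ck_bump)
    also have "(\<lambda>t. (1/h) * bump (- a / h + (1/h) * t) + (- (1/h)) * bump (- b / h + (1/h) * t))
      = (\<lambda>t. bump ((t - a) / h) / h - bump ((t - b) / h) / h)"
      by (auto simp: diff_divide_distrib)
    finally show ?thesis .
  qed
  then have "Ck k \<phi>" for k
    using Ck_Suc_realI[OF d\<phi>] Ck_real_mono by blast
  moreover have supp: "closure {t. \<phi> t \<noteq> 0} \<subseteq> {a..b+h}"
  proof (rule closure_minimal)
    show "{t. \<phi> t \<noteq> 0} \<subseteq> {a..b+h}"
    proof safe
      fix t assume t: "\<phi> t \<noteq> 0"
      have "\<phi> t = 0" if "t < a"
        using const[of "(t - b)/h" "(t - a)/h"] assms that by (auto simp: \<phi>_def divide_simps)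
      moreover have "\<phi> t = 0" if "t > b + h"
        using const[of "(t - b)/h" "(t - a)/h"] assms that by (auto simp: \<phi>_def divide_simps)
      ultimately show "t \<in> {a..b+h}" using t by force
    qed
  qed simp
  then have "compact (closure {t. \<phi> t \<noteq> 0})"
    by (meson bounded_closed_interval bounded_subset closed_closure compact_eq_bounded_closed)
  moreover have "{a..b+h} \<subseteq> {0<..<S}" using assms by auto
  ultimately have "\<phi> \<in> Cc_infinity {0<..<S}"
    using supp unfolding Cc_infinity_def by blast
  then show ?thesis using that DERIV_imp_deriv[OF d\<phi>] by blast
qed

text \<open>Substituting t = a + s/(n + 1) moves n into the argument of \<open>e\<close>, where
  continuity and dominated convergence apply.\<close>

lemma bump_average_tendsto:
  fixes e :: "real \<Rightarrow> real"
  assumes c: "continuous_on UNIV e" and M: "\<And>t. \<bar>e t\<bar> \<le> M"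
  shows "(\<lambda>n. \<integral>t. bump ((t - a) / (1 / real (Suc n))) / (1 / real (Suc n)) * e t \<partial>lborel)
          \<longlonglongrightarrow> integral\<^sup>L lborel bump * e a"
proof -
  have [measurable]: "e \<in> borel_measurable borel" "bump \<in> borel_measurable borel"
    using c bump_continuous by (auto intro: borel_measurable_continuous_onI)
  have "(\<lambda>n. \<integral>s. bump s * e (a + 1 / real (Suc n) * s) \<partial>lborel) \<longlonglongrightarrow> (\<integral>s. bump s * e a \<partial>lborel)"
  proof (rule integral_dominated_convergence[where w="\<lambda>s. M * bump s"])
    show "AE s in lborel. (\<lambda>n. bump s * e (a + 1 / real (Suc n) * s)) \<longlonglongrightarrow> bump s * e a"
    proof (intro AE_I2 tendsto_intros)
      fix s
      have "(\<lambda>n. a + 1 / real (Suc n) * s) \<longlonglongrightarrow> a + 0 * s"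
        by (intro tendsto_intros LIMSEQ_Suc[OF lim_1_over_n])
      moreover have "isCont e a" using c by (simp add: continuous_on_eq_continuous_at)
      ultimately show "(\<lambda>n. e (a + 1 / real (Suc n) * s)) \<longlonglongrightarrow> e a"
        using isCont_tendsto_compose[of a e] by simp
    qed
    show "AE s in lborel. norm (bump s * e (a + 1 / real (Suc n) * s)) \<le> M * bump s" for n
    proof (rule AE_I2)
      fix s
      show "norm (bump s * e (a + 1 / real (Suc n) * s)) \<le> M * bump s"
        using mult_left_mono[OF M bump_nonneg] bump_nonneg by (simp only: abs_mult real_norm_def abs_of_nonneg mult.commute)
    qed
  qed (use bump_integrable in \<open>auto intro: integrable_mult_right\<close>)
  also have "(\<lambda>n. \<integral>s. bump s * e (a + 1 / real (Suc n) * s) \<partial>lborel) =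
     (\<lambda>n. \<integral>t. bump ((t - a) / (1 / real (Suc n))) / (1 / real (Suc n)) * e t \<partial>lborel)"
  proof
    fix n
    define h where "h = 1 / real (Suc n)"
    have h: "h > 0" by (simp add: h_def)
    have "(\<integral>t. bump ((t - a) / h) / h * e t \<partial>lborel) = h * (\<integral>s. (1/h) * (bump s * e (a + h * s)) \<partial>lborel)"
      using h by (subst lborel_integral_real_affine[of h _ a]) simp_all
    also have "\<dots> = (\<integral>s. bump s * e (a + h * s) \<partial>lborel)"
      using h by (subst integral_mult_right_zero) simp
    finally show "(\<integral>s. bump s * e (a + 1 / real (Suc n) * s) \<partial>lborel) =
       (\<integral>t. bump ((t - a) / (1 / real (Suc n))) / (1 / real (Suc n)) * e t \<partial>lborel)"
      by (simp only: h_def)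
  qed
  finally show ?thesis by simp
qed

text \<open>Tested with plateaus of shrinking flanks, the hypothesis says that the bump-weighted
  means of \<open>e\<close> next to two interior points agree; in the limit these means become the
  same multiple of the two values. End points are reached by closure.\<close>

lemma du_Bois_Reymond:
  fixes e :: "real \<Rightarrow> real"
  assumes S: "0 < S" and c: "continuous_on {0..S} e"
    and weak: "\<And>\<phi>. \<phi> \<in> Cc_infinity {0<..<S} \<Longrightarrow> (\<integral>t. deriv \<phi> t * e t \<partial>lebesgue_on {0<..<S}) = 0"
    and ab: "a \<in> {0..S}" "b \<in> {0..S}"
  shows "e a = e b"
proof -
  \<comment> \<open>The constant continuation is bounded and continuous on the whole line, as the
    means require, and it agrees with \<open>e\<close> on [0,S].\<close>
  define E where "E t = e (max 0 (min S t))" for t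
  have cE: "continuous_on UNIV E"
    unfolding E_def[abs_def] using S by (intro continuous_on_compose2[OF c] continuous_intros) auto
  have Ee: "E t = e t" if "t \<in> {0..S}" for t using that by (auto simp: E_def)
  have "compact (e ` {0..S})" using c by (intro compact_continuous_image) auto
  then obtain M where M: "\<And>t. t \<in> {0..S} \<Longrightarrow> \<bar>e t\<bar> \<le> M"
    by (meson bounded_real compact_imp_bounded imageI)
  then have ME: "\<bar>E t\<bar> \<le> M" for t using S by (auto simp: E_def)
  have [measurable]: "E \<in> borel_measurable borel" "bump \<in> borel_measurable borel"
    using cE bump_continuous by (auto intro: borel_measurable_continuous_onI)
  have inner: "E a = E b" if ab: "0 < a" "a < b" "b < S" for a b
  proof -
    define I where "I a n = (\<integral>t. bump ((t - a) / (1 / real (Suc n))) / (1 / real (Suc n)) * E t \<partial>lborel)" for a n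
    have "eventually (\<lambda>n. 1 / real (Suc n) < S - b) sequentially"
      using ab by (intro order_tendstoD(2)[OF LIMSEQ_Suc[OF lim_1_over_n]]) auto
    then have "eventually (\<lambda>n. I a n - I b n = 0) sequentially"
    proof eventually_elim
      case (elim n)
      define h where "h = 1 / real (Suc n)"
      have h: "0 < h" "b + h < S" using elim by (auto simp: h_def)
      obtain \<phi> where \<phi>: "\<phi> \<in> Cc_infinity {0<..<S}"
        "\<And>t. deriv \<phi> t = bump ((t - a) / h) / h - bump ((t - b) / h) / h"
        using smooth_plateau_exists[OF ab(1,2) h] by blast
      have int: "integrable lborel (\<lambda>t. bump ((t - a) / h) / h * E t)" for a
      proof (rule integrable_continuous_bounded_support[of _ "\<bar>a\<bar> + h"])
        show "continuous_on UNIV (\<lambda>t. bump ((t - a) / h) / h * E t)"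
          using h by (intro continuous_intros continuous_on_compose2[OF bump_continuous] cE) auto
        show "bump ((t - a) / h) / h * E t = 0" if "\<bar>a\<bar> + h < norm t" for t
          using that h by (subst bump_eq_0) (auto simp: divide_simps)
      qed
      have "I a n - I b n = (\<integral>t. bump ((t - a) / h) / h * E t - bump ((t - b) / h) / h * E t \<partial>lborel)"
        unfolding I_def h_def[symmetric] by (intro Bochner_Integration.integral_diff[symmetric] int)
      also have "\<dots> = (\<integral>t. deriv \<phi> t * E t \<partial>lborel)"
        by (simp add: \<phi> left_diff_distrib)
      also have "\<dots> = (\<integral>t. deriv \<phi> t * E t \<partial>lebesgue_on {0<..<S})"
      proof (rule integral_lebesgue_on_eq_lborel[symmetric])
        show "(\<lambda>t. deriv \<phi> t * E t) \<in> borel_measurable borel" unfolding \<phi> by measurable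
        show "deriv \<phi> t * E t = 0" if "t \<notin> {0<..<S}" for t
          unfolding \<phi> using that h ab by (subst (1 2) bump_eq_0) (auto simp: divide_simps)
      qed simp
      also have "\<dots> = (\<integral>t. deriv \<phi> t * e t \<partial>lebesgue_on {0<..<S})"
        by (intro Bochner_Integration.integral_cong) (auto simp: Ee)
      also have "\<dots> = 0" by (rule weak[OF \<phi>(1)])
      finally show ?case .
    qed
    then have "(\<lambda>n. I a n - I b n) \<longlonglongrightarrow> 0"
      by (rule tendsto_eventually)
    moreover have "(\<lambda>n. I a n - I b n) \<longlonglongrightarrow> integral\<^sup>L lborel bump * E a - integral\<^sup>L lborel bump * E b"
      unfolding I_def by (intro tendsto_diff bump_average_tendsto[OF cE ME])
    ultimately have "integral\<^sup>L lborel bump * E a - integral\<^sup>L lborel bump * E b = 0"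
      using LIMSEQ_unique by blast
    then show ?thesis using bump_integral_pos by simp
  qed
  have mid: "E t = E (S/2)" if "t \<in> {0<..<S}" for t
  proof (cases t "S/2" rule: linorder_cases)
    case less
    then show ?thesis using that S by (intro inner) auto
  next
    case greater
    then show ?thesis using that S by (intro inner[symmetric]) auto
  qed (simp only:)
  have "{0..S} \<subseteq> {t. E t = E (S/2)}"
  proof -
    have "closed {t. E t = E (S/2)}"
      by (rule closed_Collect_eq[OF cE continuous_on_const])
    then have "closure {0<..<S} \<subseteq> {t. E t = E (S/2)}"
      by (rule closure_minimal[rotated]) (blast intro: mid)
    then show ?thesis using S by (simp only: closure_greaterThanLessThan)
  qed
  then have "E a = E (S/2)" "E b = E (S/2)" using ab by blast+
  then show ?thesis using Ee[OF ab(1)] Ee[OF ab(2)] by (simp only:)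
qed

section \<open>Fubini's theorem for Lebesgue measurable functions\<close>

lemma integrable_lebesgue_AE_eq:
  fixes h k :: "'a::euclidean_space \<Rightarrow> real"
  assumes k: "integrable lborel k" and eq: "AE x in lborel. h x = k x"
  shows "integrable lebesgue h" "integral\<^sup>L lebesgue h = integral\<^sup>L lborel k"
proof -
  have km: "k \<in> borel_measurable lborel" using k by auto
  have eq': "AE x in lebesgue. k x = h x" using eq by (auto simp: AE_completion_iff)
  have hm: "h \<in> borel_measurable lebesgue"
    using km eq' by (intro borel_measurable_AE[OF measurable_completion[OF km]])
  have "integrable lebesgue k" using k km by (simp add: integrable_completion)
  then show "integrable lebesgue h"
    using integrable_cong_AE[OF measurable_completion[OF km] hm eq'] by blast
  have "integral\<^sup>L lebesgue h = integral\<^sup>L lebesgue k"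
    using eq' by (intro integral_cong_AE hm measurable_completion[OF km]) auto
  also have "\<dots> = integral\<^sup>L lborel k" using km by (rule integral_completion)
  finally show "integral\<^sup>L lebesgue h = integral\<^sup>L lborel k" .
qed

text \<open>Lebesgue measure on the product is only the completion of the product measure, so Fubini
  has to be applied to a Borel version \<open>g\<close> of \<open>f\<close>. The set where they
  differ is enclosed in a Borel null set \<open>N\<close>; the two statements about slices express
  that almost all sections of \<open>N\<close>, in either direction, are null.\<close>

lemma lebesgue_pair_representative:
  fixes f :: "'a::euclidean_space \<times> 'b::euclidean_space \<Rightarrow> real"
  assumes f: "integrable lebesgue f"
  obtains g where "integrable (lborel \<Otimes>\<^sub>M lborel) g" "AE t in lborel. AE x in lborel. f (t, x) = g (t, x)"
    "AE x in lborel. AE t in lborel. f (t, x) = g (t, x)"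
    "integral\<^sup>L lebesgue f = integral\<^sup>L (lborel \<Otimes>\<^sub>M lborel) g"
proof -
  have fm: "f \<in> borel_measurable lebesgue" using f by auto
  then obtain g where g: "g \<in> borel_measurable lborel" "AE z in lborel. f z = g z"
    using completion_ex_borel_measurable_real by blast
  have eq': "AE z in lebesgue. f z = g z" using g by (auto simp: AE_completion_iff)
  have "integrable lebesgue g"
    using integrable_cong_AE[OF fm measurable_completion[OF g(1)] eq'] f by simp
  then have gi: "integrable lborel g" using g(1) by (simp add: integrable_completion)
  have "integral\<^sup>L lebesgue f = integral\<^sup>L lborel g"
    using integral_cong_AE[OF fm measurable_completion[OF g(1)] eq'] integral_completion[OF g(1)] by simp
  obtain N where N: "{z \<in> space lborel. f z \<noteq> g z} \<subseteq> N" "N \<in> null_sets lborel"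
    using g(2) by (auto elim!: AE_E simp: null_sets_def)
  have N': "N \<in> sets (lborel \<Otimes>\<^sub>M lborel)" "AE z in lborel \<Otimes>\<^sub>M lborel. z \<notin> N"
    unfolding lborel_prod using N(2) AE_not_in[OF N(2)] by blast+
  have 1: "AE t in lborel. AE x in lborel. (t, x) \<notin> N"
    using lborel_pair.AE_pair[OF N'(2)] by simp
  have 2: "AE x in lborel. AE t in lborel. (t, x) \<notin> N"
  proof -
    have "{z\<in>space (lborel \<Otimes>\<^sub>M lborel). (fst z, snd z) \<notin> N} = space (lborel \<Otimes>\<^sub>M lborel) - N" by auto
    then have "{z\<in>space (lborel \<Otimes>\<^sub>M lborel). (fst z, snd z) \<notin> N} \<in> sets (lborel \<Otimes>\<^sub>M lborel)"
      using sets.compl_sets[OF N'(1)] by (simp only:)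
    then show ?thesis
      using lborel_pair.AE_commute[of "\<lambda>t x. (t, x) \<notin> N"] 1 by blast
  qed
  have fg: "f (t, x) = g (t, x)" if "(t, x) \<notin> N" for t x using N(1) that by auto
  have 1: "AE t in lborel. AE x in lborel. f (t, x) = g (t, x)"
    using 1 by eventually_elim (erule eventually_mono, rule fg)
  have 2: "AE x in lborel. AE t in lborel. f (t, x) = g (t, x)"
    using 2 by eventually_elim (erule eventually_mono, rule fg)
  show ?thesis
    using that[of g, unfolded lborel_prod, OF gi 1 2] \<open>integral\<^sup>L lebesgue f = integral\<^sup>L lborel g\<close> by blast
qed

lemma
  fixes f :: "'a::euclidean_space \<times> 'b::euclidean_space \<Rightarrow> real"
  assumes f: "integrable lebesgue f"
  shows AE_integrable_lebesgue_fst: "AE t in lebesgue. integrable lebesgue (\<lambda>x. f (t, x))"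
    and integrable_lebesgue_fst: "integrable lebesgue (\<lambda>t. \<integral>x. f (t, x) \<partial>lebesgue)"
    and integral_lebesgue_fst: "(\<integral>t. \<integral>x. f (t, x) \<partial>lebesgue \<partial>lebesgue) = integral\<^sup>L lebesgue f"
    and integrable_lebesgue_snd: "integrable lebesgue (\<lambda>x. \<integral>t. f (t, x) \<partial>lebesgue)"
    and integral_lebesgue_snd: "(\<integral>x. \<integral>t. f (t, x) \<partial>lebesgue \<partial>lebesgue) = integral\<^sup>L lebesgue f"
proof -
  obtain g where g: "integrable (lborel \<Otimes>\<^sub>M lborel) g"
    and 1: "AE t in lborel. AE x in lborel. f (t, x) = g (t, x)"
    and 2: "AE x in lborel. AE t in lborel. f (t, x) = g (t, x)"
    and I: "integral\<^sup>L lebesgue f = integral\<^sup>L (lborel \<Otimes>\<^sub>M lborel) g"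
    using lebesgue_pair_representative[OF f] by blast
  have a: "AE t in lborel. integrable lebesgue (\<lambda>x. f (t, x)) \<and> (\<integral>x. f (t, x) \<partial>lebesgue) = (\<integral>x. g (t, x) \<partial>lborel)"
    using 1 lborel_pair.AE_integrable_fst'[OF g]
    by eventually_elim (rule conjI; rule integrable_lebesgue_AE_eq; assumption)
  have g': "integrable (lborel \<Otimes>\<^sub>M lborel) (\<lambda>(t, x). g (t, x))" using g by simp
  have "AE x in lborel. integrable lborel (\<lambda>t. g (t, x))"
    using lborel_pair.AE_integrable_snd[OF g'] by simp
  with 2 have b: "AE x in lborel. integrable lebesgue (\<lambda>t. f (t, x)) \<and> (\<integral>t. f (t, x) \<partial>lebesgue) = (\<integral>t. g (t, x) \<partial>lborel)"
    by eventually_elim (rule conjI; rule integrable_lebesgue_AE_eq; assumption)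
  show "AE t in lebesgue. integrable lebesgue (\<lambda>x. f (t, x))"
    using a by (auto simp: AE_completion_iff)
  have a': "AE t in lborel. (\<integral>x. f (t, x) \<partial>lebesgue) = (\<integral>x. g (t, x) \<partial>lborel)" using a by eventually_elim simp
  have b': "AE x in lborel. (\<integral>t. f (t, x) \<partial>lebesgue) = (\<integral>t. g (t, x) \<partial>lborel)" using b by eventually_elim simp
  note A = integrable_lebesgue_AE_eq[OF lborel_pair.integrable_fst'[OF g] a']
  note B = integrable_lebesgue_AE_eq[OF lborel_pair.integrable_snd[OF g'] b']
  show "integrable lebesgue (\<lambda>t. \<integral>x. f (t, x) \<partial>lebesgue)" by (rule A(1))
  show "integrable lebesgue (\<lambda>x. \<integral>t. f (t, x) \<partial>lebesgue)" by (rule B(1))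
  show "(\<integral>t. \<integral>x. f (t, x) \<partial>lebesgue \<partial>lebesgue) = integral\<^sup>L lebesgue f"
    using A(2) lborel_pair.integral_fst'[OF g] I by simp
  show "(\<integral>x. \<integral>t. f (t, x) \<partial>lebesgue \<partial>lebesgue) = integral\<^sup>L lebesgue f"
    using B(2) lborel_pair.integral_snd[OF g'] I by simp
qed

lemma cylinder_sets: "open G \<Longrightarrow> cylinder S G \<in> sets lebesgue"
  unfolding cylinder_def using borel_open[OF open_Times[of "{0<..<S}" G]] by simp

text \<open>The function is continued by zero outside the cylinder; the indicator of the cylinder
  factors, so it can be split between the two iterated integrals.\<close>

lemma
  fixes f :: "real \<times> 'b::euclidean_space \<Rightarrow> real"
  assumes G: "open G" and f: "integrable (lebesgue_on (cylinder S G)) f"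
  shows AE_integrable_cylinder_fst: "AE t in lebesgue_on {0<..<S}. integrable (lebesgue_on G) (\<lambda>x. f (t, x))"
    and integrable_cylinder_fst: "integrable (lebesgue_on {0<..<S}) (\<lambda>t. \<integral>x. f (t, x) \<partial>lebesgue_on G)"
    and integral_cylinder_fst: "(\<integral>t. \<integral>x. f (t, x) \<partial>lebesgue_on G \<partial>lebesgue_on {0<..<S}) = integral\<^sup>L (lebesgue_on (cylinder S G)) f"
    and integrable_cylinder_snd: "integrable (lebesgue_on G) (\<lambda>x. \<integral>t. f (t, x) \<partial>lebesgue_on {0<..<S})"
    and integral_cylinder_snd: "(\<integral>x. \<integral>t. f (t, x) \<partial>lebesgue_on {0<..<S} \<partial>lebesgue_on G) = integral\<^sup>L (lebesgue_on (cylinder S G)) f"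
proof -
  let ?F = "\<lambda>z. indicator (cylinder S G) z *\<^sub>R f z"
  have S: "{0<..<S} \<inter> space lebesgue \<in> sets lebesgue" "G \<inter> space lebesgue \<in> sets lebesgue"
    "cylinder S G \<inter> space lebesgue \<in> sets lebesgue"
    using G cylinder_sets[OF G] by auto
  have F: "integrable lebesgue ?F"
    using f integrable_restrict_space[OF S(3)] by blast
  have eq: "?F (t, x) = indicator {0<..<S} t *\<^sub>R (indicator G x *\<^sub>R f (t, x))" for t x
    by (simp add: cylinder_def indicator_times)
  have eq': "?F (t, x) = indicator G x *\<^sub>R (indicator {0<..<S} t *\<^sub>R f (t, x))" for t x
    by (simp add: cylinder_def indicator_times)
  have ix: "(\<integral>x. ?F (t, x) \<partial>lebesgue) = indicator {0<..<S} t *\<^sub>R (\<integral>x. f (t, x) \<partial>lebesgue_on G)" for t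
    unfolding eq integral_restrict_space[OF S(2)] by (simp add: indicator_def)
  have it: "(\<integral>t. ?F (t, x) \<partial>lebesgue) = indicator G x *\<^sub>R (\<integral>t. f (t, x) \<partial>lebesgue_on {0<..<S})" for x
    unfolding eq' integral_restrict_space[OF S(1)] by (simp add: indicator_def)
  show "AE t in lebesgue_on {0<..<S}. integrable (lebesgue_on G) (\<lambda>x. f (t, x))"
    unfolding AE_restrict_space_iff[OF S(1)] integrable_restrict_space[OF S(2)]
    using AE_integrable_lebesgue_fst[OF F] unfolding eq by eventually_elim (auto simp: indicator_def)
  show "integrable (lebesgue_on {0<..<S}) (\<lambda>t. \<integral>x. f (t, x) \<partial>lebesgue_on G)"
    unfolding integrable_restrict_space[OF S(1)] using integrable_lebesgue_fst[OF F] unfolding ix .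
  show "integrable (lebesgue_on G) (\<lambda>x. \<integral>t. f (t, x) \<partial>lebesgue_on {0<..<S})"
    unfolding integrable_restrict_space[OF S(2)] using integrable_lebesgue_snd[OF F] unfolding it .
  show "(\<integral>t. \<integral>x. f (t, x) \<partial>lebesgue_on G \<partial>lebesgue_on {0<..<S}) = integral\<^sup>L (lebesgue_on (cylinder S G)) f"
    unfolding integral_restrict_space[OF S(1)] integral_restrict_space[OF S(3)]
    using integral_lebesgue_fst[OF F] unfolding ix .
  show "(\<integral>x. \<integral>t. f (t, x) \<partial>lebesgue_on {0<..<S} \<partial>lebesgue_on G) = integral\<^sup>L (lebesgue_on (cylinder S G)) f"
    unfolding integral_restrict_space[OF S(2)] integral_restrict_space[OF S(3)]
    using integral_lebesgue_snd[OF F] unfolding it .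
qed

section \<open>Integration by parts in time\<close>

lemma
  fixes p :: "'a::euclidean_space \<Rightarrow> real" and q :: "'b::euclidean_space \<Rightarrow> real"
  assumes p: "integrable lborel p" and q: "integrable lborel q"
  shows integrable_lborel_mult: "integrable (lborel \<Otimes>\<^sub>M lborel) (\<lambda>z. p (fst z) * q (snd z))"
    and integral_lborel_mult: "(\<integral>z. p (fst z) * q (snd z) \<partial>(lborel \<Otimes>\<^sub>M lborel)) = integral\<^sup>L lborel p * integral\<^sup>L lborel q"
proof -
  have [measurable]: "p \<in> borel_measurable lborel" "q \<in> borel_measurable lborel" using p q by auto
  show i: "integrable (lborel \<Otimes>\<^sub>M lborel) (\<lambda>z. p (fst z) * q (snd z))"
    using p q by (intro lborel_pair.Fubini_integrable) (auto simp: abs_mult)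
  show "(\<integral>z. p (fst z) * q (snd z) \<partial>(lborel \<Otimes>\<^sub>M lborel)) = integral\<^sup>L lborel p * integral\<^sup>L lborel q"
    using lborel_pair.integral_fst'[OF i] by simp
qed

lemma
  fixes f g :: "'a \<Rightarrow> 'b::euclidean_space"
  assumes [measurable]: "f \<in> borel_measurable M" "g \<in> borel_measurable M"
    and f2: "integrable M (\<lambda>x. (norm (f x))\<^sup>2)" and g2: "integrable M (\<lambda>x. (norm (g x))\<^sup>2)"
  shows integrable_inner_L2: "integrable M (\<lambda>x. f x \<bullet> g x)"
    and integral_Cauchy_Schwarz:
      "\<bar>\<integral>x. f x \<bullet> g x \<partial>M\<bar> \<le> sqrt (\<integral>x. (norm (f x))\<^sup>2 \<partial>M) * sqrt (\<integral>x. (norm (g x))\<^sup>2 \<partial>M)"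
proof -
  let ?A = "\<integral>x. (norm (f x))\<^sup>2 \<partial>M" and ?B = "\<integral>x. f x \<bullet> g x \<partial>M" and ?C = "\<integral>x. (norm (g x))\<^sup>2 \<partial>M"
  show fg: "integrable M (\<lambda>x. f x \<bullet> g x)"
  proof (rule Bochner_Integration.integrable_bound[OF Bochner_Integration.integrable_add[OF f2 g2]])
    show "AE x in M. norm (f x \<bullet> g x) \<le> norm ((norm (f x))\<^sup>2 + (norm (g x))\<^sup>2)"
    proof (rule AE_I2)
      fix x
      have "\<bar>f x \<bullet> g x\<bar> \<le> norm (f x) * norm (g x)" by (rule Cauchy_Schwarz_ineq2)
      also have "\<dots> \<le> (norm (f x))\<^sup>2 + (norm (g x))\<^sup>2"
        using sum_squares_bound[of "norm (f x)" "norm (g x)"] mult_nonneg_nonneg[OF norm_ge_zero[of "f x"] norm_ge_zero[of "g x"]]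
        by linarith
      finally show "norm (f x \<bullet> g x) \<le> norm ((norm (f x))\<^sup>2 + (norm (g x))\<^sup>2)" by simp
    qed
  qed measurable
  \<comment> \<open>Expand the integral of |f - r g|^2 and use the discriminant. If C > 0, take r =
    B/C; if C = 0 and B were not 0, then r = (A + 1)/(2 B) would give the value -1.\<close>
  have q: "0 \<le> ?A - 2 * r * ?B + r\<^sup>2 * ?C" for r
  proof -
    have "0 \<le> (\<integral>x. (norm (f x - r *\<^sub>R g x))\<^sup>2 \<partial>M)" by simp
    also have "(\<lambda>x. (norm (f x - r *\<^sub>R g x))\<^sup>2) = (\<lambda>x. (norm (f x))\<^sup>2 - (2 * r) * (f x \<bullet> g x) + r\<^sup>2 * (norm (g x))\<^sup>2)"
      unfolding power2_norm_eq_inner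
      by (auto simp: inner_diff_left inner_diff_right inner_commute power2_eq_square algebra_simps)
    also have "(\<integral>x. (norm (f x))\<^sup>2 - (2 * r) * (f x \<bullet> g x) + r\<^sup>2 * (norm (g x))\<^sup>2 \<partial>M) = ?A - 2 * r * ?B + r\<^sup>2 * ?C"
      using f2 g2 fg by simp
    finally show ?thesis .
  qed
  have "?B\<^sup>2 \<le> ?A * ?C"
  proof (cases "?C = 0")
    case True
    have "?B = 0"
    proof (rule ccontr)
      assume "?B \<noteq> 0"
      then show False using q[of "(?A + 1) / (2 * ?B)"] True by simp
    qed
    then show ?thesis using True by simp
  next
    case False
    then have "?C > 0" by (simp add: order_less_le)
    then show ?thesis using q[of "?B / ?C"] by (simp add: field_simps power2_eq_square)
  qed
  then have "sqrt (?B\<^sup>2) \<le> sqrt (?A * ?C)" by (rule real_sqrt_le_mono)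
  then show "\<bar>?B\<bar> \<le> sqrt ?A * sqrt ?C" by (simp add: real_sqrt_mult)
qed

text \<open>Fubini's theorem on the triangle \<open>0 < t < s < S\<close>.\<close>

lemma integral_primitive_tail:
  fixes z v w :: "real \<Rightarrow> real"
  assumes z: "integrable (lebesgue_on {0<..<S}) z"
    and v[measurable]: "v \<in> borel_measurable borel" and M: "\<And>t. t \<in> {0<..<S} \<Longrightarrow> \<bar>v t\<bar> \<le> M"
    and w: "\<And>s. s \<in> {0<..<S} \<Longrightarrow> w s = (\<integral>t. indicator {0<..<s} t * v t \<partial>lborel)"
  shows "(\<integral>s. w s * z s \<partial>lebesgue_on {0<..<S}) =
         (\<integral>t. v t * (\<integral>s. z s \<partial>lebesgue_on {t<..<S}) \<partial>lebesgue_on {0<..<S})"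
proof -
  have m: "A \<inter> space lebesgue \<in> sets lebesgue" if "A \<in> sets borel" for A :: "real set"
    using that by simp
  have "integrable lebesgue (\<lambda>s. indicator {0<..<S} s *\<^sub>R z s)"
    using z by (subst (asm) integrable_restrict_space[OF m]) auto
  then obtain z' where z'm[measurable]: "z' \<in> borel_measurable lborel"
      and z'eq: "AE s in lborel. indicator {0<..<S} s *\<^sub>R z s = z' s"
    using completion_ex_borel_measurable_real borel_measurable_integrable by blast
  have "integrable lebesgue z'"
    using integrable_cong_AE[OF borel_measurable_integrable[OF \<open>integrable lebesgue (\<lambda>s. indicator {0<..<S} s *\<^sub>R z s)\<close>]
        measurable_completion[OF z'm]] z'eq AE_completion \<open>integrable lebesgue (\<lambda>s. indicator {0<..<S} s *\<^sub>R z s)\<close> by blast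
  then have z'i: "integrable lborel z'" using z'm by (simp add: integrable_completion)
  \<comment> \<open>The integrand is continued by zero from the triangle to the plane, with
    \<open>z\<close> replaced by its Borel version; its two iterated integrals are the two sides of
    the claim.\<close>
  define F where "F = (\<lambda>(t, s). indicator {0<..<S} t * indicator {t<..<S} s * v t * z' s)"
  have Fm: "F \<in> borel_measurable (lborel \<Otimes>\<^sub>M lborel)"
  proof -
    have "(\<lambda>(t, s). (if 0 < t \<and> t < s \<and> s < S then 1 else 0) * v t * z' s) \<in> borel_measurable (borel \<Otimes>\<^sub>M borel)"
      by measurable
    also have "(\<lambda>(t, s). (if 0 < t \<and> t < s \<and> s < S then 1 else 0) * v t * z' s) = F"
      by (auto simp: F_def indicator_def fun_eq_iff)
    finally show ?thesis by simp
  qed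
  have Fi: "integrable (lborel \<Otimes>\<^sub>M lborel) F"
  proof (rule Bochner_Integration.integrable_bound[OF _ Fm])
    show "integrable (lborel \<Otimes>\<^sub>M lborel) (\<lambda>z. (M * indicator {0<..<S} (fst z)) * z' (snd z))"
      by (rule integrable_lborel_mult[OF integrable_mult_right[OF integrable_real_indicator] z'i])
         (cases "0 \<le> S"; simp)+
    show "AE x in lborel \<Otimes>\<^sub>M lborel. norm (F x) \<le> norm (M * indicator {0<..<S} (fst x) * z' (snd x))"
    proof (intro AE_I2, clarify)
      fix t s :: real
      show "norm (F (t, s)) \<le> norm (M * indicator {0<..<S} (fst (t, s)) * z' (snd (t, s)))"
        using M[of t] by (auto simp: F_def indicator_def abs_mult intro!: mult_right_mono)
    qed
  qed
  have F': "integrable (lborel \<Otimes>\<^sub>M lborel) (\<lambda>(t, s). F (t, s))" using Fi by simp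
  have 1: "AE s in lborel. indicator {0<..<S} s *\<^sub>R (w s * z s) = (\<integral>t. F (t, s) \<partial>lborel)"
    using z'eq
  proof eventually_elim
    case (elim s)
    have "(\<integral>t. F (t, s) \<partial>lborel) = (\<integral>t. (indicator {0<..<S} s * z' s) * (indicator {0<..<s} t * v t) \<partial>lborel)"
      by (rule Bochner_Integration.integral_cong) (auto simp: F_def indicator_def)
    also have "\<dots> = (indicator {0<..<S} s * z' s) * (\<integral>t. indicator {0<..<s} t * v t \<partial>lborel)"
      by (rule integral_mult_right_zero)
    finally show ?case using elim w[of s] by (auto simp: indicator_def mult_ac)
  qed
  have "(\<integral>s. w s * z s \<partial>lebesgue_on {0<..<S}) = (\<integral>s. indicator {0<..<S} s *\<^sub>R (w s * z s) \<partial>lebesgue)"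
    by (rule integral_restrict_space[OF m]) simp
  also have "\<dots> = (\<integral>s. (\<integral>t. F (t, s) \<partial>lborel) \<partial>lborel)"
    by (rule integrable_lebesgue_AE_eq(2)[OF lborel_pair.integrable_snd[OF F'] 1])
  also have "\<dots> = (\<integral>t. (\<integral>s. F (t, s) \<partial>lborel) \<partial>lborel)"
    using lborel_pair.integral_snd[OF F'] lborel_pair.integral_fst'[OF Fi] by simp
  also have "\<dots> = (\<integral>t. indicator {0<..<S} t *\<^sub>R (v t * (\<integral>s. z s \<partial>lebesgue_on {t<..<S})) \<partial>lebesgue)"
  proof (rule integrable_lebesgue_AE_eq(2)[OF lborel_pair.integrable_fst'[OF Fi], symmetric], rule AE_I2)
    fix t :: real
    show "indicator {0<..<S} t *\<^sub>R (v t * (\<integral>s. z s \<partial>lebesgue_on {t<..<S})) = (\<integral>s. F (t, s) \<partial>lborel)"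
    proof (cases "t \<in> {0<..<S}")
      case True
      have "(\<integral>s. z s \<partial>lebesgue_on {t<..<S}) = (\<integral>s. indicator {t<..<S} s *\<^sub>R z s \<partial>lebesgue)"
        by (rule integral_restrict_space[OF m]) simp
      also have "\<dots> = (\<integral>s. indicator {t<..<S} s * z' s \<partial>lborel)"
      proof (rule integrable_lebesgue_AE_eq(2))
        show "integrable lborel (\<lambda>s. indicator {t<..<S} s * z' s)"
          using integrable_real_mult_indicator[OF _ z'i, of "{t<..<S}"] by (simp add: mult.commute)
        show "AE s in lborel. indicator {t<..<S} s *\<^sub>R z s = indicator {t<..<S} s * z' s"
          using z'eq by eventually_elim (use True in \<open>auto simp: indicator_def\<close>)
      qed
      also have "v t * \<dots> = (\<integral>s. v t * (indicator {t<..<S} s * z' s) \<partial>lborel)"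
        by (rule integral_mult_right_zero[symmetric])
      finally show ?thesis using True by (simp add: F_def mult_ac)
    qed (simp add: F_def)
  qed
  also have "\<dots> = (\<integral>t. v t * (\<integral>s. z s \<partial>lebesgue_on {t<..<S}) \<partial>lebesgue_on {0<..<S})"
    by (rule integral_restrict_space[OF m, symmetric]) simp
  finally show ?thesis .
qed

section \<open>Pairings in L2 on domains and cylinders\<close>

lemma lmeasurable_cylinder:
  assumes "open G" "bounded G" shows "cylinder S G \<in> lmeasurable"
proof -
  have "bounded (cylinder S G)" unfolding cylinder_def using assms by (intro bounded_Times) auto
  then show ?thesis using cylinder_sets[OF assms(1)] by (intro bounded_set_imp_lmeasurable)
qed

lemma integrable_L2_mult_bounded:
  fixes f k :: "'a::euclidean_space \<Rightarrow> real"
  assumes f: "f \<in> L2 Q" and Q: "Q \<in> lmeasurable"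
    and [measurable]: "k \<in> borel_measurable (lebesgue_on Q)" and K: "\<And>x. x \<in> Q \<Longrightarrow> \<bar>k x\<bar> \<le> K"
  shows "integrable (lebesgue_on Q) (\<lambda>x. f x * k x)"
proof -
  interpret finite_measure "lebesgue_on Q" using Q by (rule finite_measure_lebesgue_on)
  have [measurable]: "f \<in> borel_measurable (lebesgue_on Q)" and f2: "integrable (lebesgue_on Q) (\<lambda>x. (norm (f x))\<^sup>2)"
    using f by (auto simp: L2_def)
  have "integrable (lebesgue_on Q) (\<lambda>x. K * (1 + (norm (f x))\<^sup>2))"
    using f2 by simp
  then show ?thesis
  proof (rule Bochner_Integration.integrable_bound)
    show "AE x in lebesgue_on Q. norm (f x * k x) \<le> norm (K * (1 + (norm (f x))\<^sup>2))"
    proof (rule AE_I2)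
      fix x assume "x \<in> space (lebesgue_on Q)"
      then have k: "\<bar>k x\<bar> \<le> K" using K by auto
      have "\<bar>f x\<bar> \<le> 1 + (f x)\<^sup>2"
        using sum_squares_bound[of "\<bar>f x\<bar>" 1] by simp
      then have "\<bar>f x\<bar> * \<bar>k x\<bar> \<le> (1 + (f x)\<^sup>2) * K" using k by (intro mult_mono) auto
      moreover have "0 \<le> K" using k by linarith
      ultimately show "norm (f x * k x) \<le> norm (K * (1 + (norm (f x))\<^sup>2))" by (simp add: abs_mult mult.commute)
    qed
  qed measurable
qed

lemma borel_measurable_lebesgue_on:
  "f \<in> borel_measurable borel \<Longrightarrow> f \<in> borel_measurable (lebesgue_on Q)"
  by (intro measurable_restrict_space1 measurable_completion) simp

lemma integrable_lebesgue_on_Ioo: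
  fixes f :: "real \<Rightarrow> real"
  assumes "continuous_on {0..S} f"
  shows "integrable (lebesgue_on {0<..<S}) f"
proof -
  have "set_integrable lebesgue {0..S} f"
    using continuous_imp_integrable_real[OF assms] by (simp add: integrable_restrict_space set_integrable_def)
  then have "set_integrable lebesgue {0<..<S} f"
    by (rule set_integrable_subset) auto
  then show ?thesis by (simp add: integrable_restrict_space set_integrable_def)
qed

lemma L2_D:
  assumes "f \<in> L2 G"
  shows "f \<in> borel_measurable (lebesgue_on G)" "integrable (lebesgue_on G) (\<lambda>x. (norm (f x))\<^sup>2)"
  using assms by (auto simp: L2_def)

lemma L2_diff:
  assumes "f \<in> L2 G" "g \<in> L2 G" shows "(\<lambda>x. f x - g x) \<in> L2 G"
proof -
  note f = L2_D[OF assms(1)] and g = L2_D[OF assms(2)]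
  have "integrable (lebesgue_on G) (\<lambda>x. (norm (f x - g x))\<^sup>2)"
  proof (rule Bochner_Integration.integrable_bound[where f="\<lambda>x. 2 * (norm (f x))\<^sup>2 + 2 * (norm (g x))\<^sup>2"])
    show "AE x in lebesgue_on G. norm ((norm (f x - g x))\<^sup>2) \<le> norm (2 * (norm (f x))\<^sup>2 + 2 * (norm (g x))\<^sup>2)"
    proof (rule AE_I2)
      fix x
      have "(norm (f x - g x))\<^sup>2 + (norm (f x + g x))\<^sup>2 = 2 * (norm (f x))\<^sup>2 + 2 * (norm (g x))\<^sup>2"
        by (simp add: power2_norm_eq_inner inner_diff_left inner_diff_right inner_add_left inner_add_right inner_commute)
      then have "(norm (f x - g x))\<^sup>2 \<le> 2 * (norm (f x))\<^sup>2 + 2 * (norm (g x))\<^sup>2"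
        using zero_le_power2[of "norm (f x + g x)"] by linarith
      then show "norm ((norm (f x - g x))\<^sup>2) \<le> norm (2 * (norm (f x))\<^sup>2 + 2 * (norm (g x))\<^sup>2)" by simp
    qed
  qed (use f g in auto)
  then show ?thesis using f g by (auto simp: L2_def)
qed

lemma L2_inner_bound:
  assumes "f \<in> L2 G" "g \<in> L2 G"
  shows "\<bar>\<integral>x. f x \<bullet> g x \<partial>lebesgue_on G\<bar> \<le> L2_norm G f * L2_norm G g"
  unfolding L2_norm_def
  by (rule integral_Cauchy_Schwarz[OF L2_D(1)[OF assms(1)] L2_D(1)[OF assms(2)] L2_D(2)[OF assms(1)] L2_D(2)[OF assms(2)]])

lemma L2_inner_integrable:
  assumes "f \<in> L2 G" "g \<in> L2 G"
  shows "integrable (lebesgue_on G) (\<lambda>x. f x \<bullet> g x)"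
  by (rule integrable_inner_L2[OF L2_D(1)[OF assms(1)] L2_D(1)[OF assms(2)] L2_D(2)[OF assms(1)] L2_D(2)[OF assms(2)]])

lemma bounded_in_L2:
  fixes f :: "'a::euclidean_space \<Rightarrow> 'b::euclidean_space"
  assumes "f \<in> borel_measurable borel" "G \<in> lmeasurable" "\<And>x. x \<in> G \<Longrightarrow> norm (f x) \<le> K"
  shows "f \<in> L2 G"
proof -
  interpret finite_measure "lebesgue_on G" using assms(2) by (rule finite_measure_lebesgue_on)
  have m[measurable]: "f \<in> borel_measurable (lebesgue_on G)"
    using assms(1) by (rule borel_measurable_lebesgue_on)
  have "integrable (lebesgue_on G) (\<lambda>x. (norm (f x))\<^sup>2)"
  proof (rule integrable_const_bound[where B="K\<^sup>2"])
    show "AE x in lebesgue_on G. norm ((norm (f x))\<^sup>2) \<le> K\<^sup>2"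
      by (rule AE_I2) (use assms(3) in \<open>auto intro: power_mono\<close>)
  qed measurable
  then show ?thesis using m by (auto simp: L2_def)
qed

lemma Cc_infinity_real_deriv:
  fixes \<phi> :: "real \<Rightarrow> real"
  assumes "\<phi> \<in> Cc_infinity G"
  shows "(\<phi> has_real_derivative deriv \<phi> t) (at t)" "continuous_on UNIV (deriv \<phi>)"
proof -
  have "Ck (Suc 0) \<phi>" using assms unfolding Cc_infinity_def by blast
  then obtain \<phi>' where \<phi>': "\<And>x. (\<phi> has_real_derivative \<phi>' x) (at x)" "Ck 0 \<phi>'"
    by (rule Ck_Suc_realE) blast
  then have "deriv \<phi> = \<phi>'" by (auto intro: DERIV_imp_deriv)
  then show "(\<phi> has_real_derivative deriv \<phi> t) (at t)" "continuous_on UNIV (deriv \<phi>)"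
    using \<phi>' by auto
qed

lemma continuous_on_bounded_Ioo:
  fixes f :: "real \<Rightarrow> real"
  assumes "continuous_on {0..S} f"
  obtains M where "\<And>t. t \<in> {0..S} \<Longrightarrow> \<bar>f t\<bar> \<le> M"
proof -
  have "compact (f ` {0..S})" using assms by (intro compact_continuous_image) auto
  then show ?thesis using that by (meson bounded_real compact_imp_bounded imageI)
qed

lemma tail_integral_continuous:
  fixes z :: "real \<Rightarrow> real"
  assumes z: "integrable (lebesgue_on {0<..<S}) z"
  shows "continuous_on {0..S} (\<lambda>t. \<integral>s. z s \<partial>lebesgue_on {t<..<S})"
proof -
  have "z integrable_on {0<..<S}" using z by (rule integrable_on_lebesgue_on) simp
  then have "z integrable_on {0..S}" by (simp add: integrable_on_Icc_iff_Ioo)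
  then have "continuous_on {0..S} (\<lambda>t. integral {t..S} z)"
    by (rule indefinite_integral_continuous_1')
  then show ?thesis
  proof (rule continuous_on_eq)
    fix t assume that: "t \<in> {0..S}"
    have "set_integrable lebesgue {0<..<S} z" using z by (simp add: integrable_restrict_space set_integrable_def)
    then have "set_integrable lebesgue {t<..<S} z" by (rule set_integrable_subset) (use that in auto)
    then have "integrable (lebesgue_on {t<..<S}) z" by (simp add: integrable_restrict_space set_integrable_def)
    then have "(\<integral>s. z s \<partial>lebesgue_on {t<..<S}) = integral {t<..<S} z"
      by (rule lebesgue_integral_eq_integral) simp
    then show "integral {t..S} z = (\<integral>s. z s \<partial>lebesgue_on {t<..<S})" by (simp add: integral_open_interval_real)
  qed
qed

text \<open>No boundary terms arise: \<open>w\<close> is the primitive of \<open>v\<close> starting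
  from 0, and \<zeta> vanishes at time S. But the weak time derivative is tested only with functions
  of compact support in (0,S), and \<open>w\<close> has none. So the problem is made scalar: pairing
  with \<open>h\<close> in space gives functions y and z of time with y' = z weakly; du Bois-Reymond
  upgrades this to y(t) = - (integral of z over (t,S)), and Fubini on the triangle exchanges
  \<open>w\<close> and \<open>v\<close>. Later \<open>h\<close> is a cosine and \<open>v\<close>,
  \<open>w\<close> are kernels.\<close>

lemma weak_time_identity:
  fixes \<zeta> \<zeta>t :: "real \<times> (real ^ 'n) \<Rightarrow> real"
  assumes S: "0 < S" and G: "open G" "bounded G"
    and \<zeta>: "H1_L2_with_deriv S G \<zeta> \<zeta>t" and C: "C_L2_vanishing_at S S G \<zeta>"
    and h[measurable]: "h \<in> borel_measurable borel" and h1: "\<And>x. \<bar>h x\<bar> \<le> 1"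
    and v[measurable]: "v \<in> borel_measurable borel" and vM: "\<And>t. t \<in> {0<..<S} \<Longrightarrow> \<bar>v t\<bar> \<le> M"
    and wm[measurable]: "w \<in> borel_measurable borel" and wM: "\<And>t. t \<in> {0<..<S} \<Longrightarrow> \<bar>w t\<bar> \<le> M"
    and w: "\<And>s. s \<in> {0<..<S} \<Longrightarrow> w s = (\<integral>t. indicator {0<..<s} t * v t \<partial>lborel)"
  shows "(\<integral>z. \<zeta>t z * (w (fst z) * h (snd z)) \<partial>lebesgue_on (cylinder S G)) =
       - (\<integral>z. \<zeta> z * (v (fst z) * h (snd z)) \<partial>lebesgue_on (cylinder S G))"
proof -
  note Q = lmeasurable_cylinder[OF G, of S]
  have Gm: "G \<in> lmeasurable" using G by (simp add: lmeasurable_open)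
  have \<zeta>L: "\<zeta> \<in> L2 (cylinder S G)" and \<zeta>tL: "\<zeta>t \<in> L2 (cylinder S G)"
    and weak: "\<And>\<phi>. \<phi> \<in> Cc_infinity {0<..<S} \<Longrightarrow> AE x in lebesgue_on G.
        (\<integral>t. deriv \<phi> t * \<zeta> (t, x) \<partial>lebesgue_on {0<..<S}) = - (\<integral>t. \<phi> t * \<zeta>t (t, x) \<partial>lebesgue_on {0<..<S})"
    using \<zeta> by (auto simp: H1_L2_with_deriv_def)
  have prod_int: "integrable (lebesgue_on (cylinder S G)) (\<lambda>z. F z * (k (fst z) * h (snd z)))"
    if F: "F \<in> L2 (cylinder S G)" and k[measurable]: "k \<in> borel_measurable borel"
      and K: "\<And>t. t \<in> {0<..<S} \<Longrightarrow> \<bar>k t\<bar> \<le> K" for F k K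
  proof (rule integrable_L2_mult_bounded[OF F Q, where K=K])
    have "(\<lambda>z. k (fst z) * h (snd z)) \<in> borel_measurable (borel \<Otimes>\<^sub>M borel)" by measurable
    then show "(\<lambda>z. k (fst z) * h (snd z)) \<in> borel_measurable (lebesgue_on (cylinder S G))"
      by (intro borel_measurable_lebesgue_on) (simp add: borel_prod)
    fix z assume "z \<in> cylinder S G"
    then have "\<bar>k (fst z)\<bar> \<le> K" using K by (auto simp: cylinder_def)
    then show "\<bar>k (fst z) * h (snd z)\<bar> \<le> K"
      using mult_mono[of "\<bar>k (fst z)\<bar>" K "\<bar>h (snd z)\<bar>" 1] h1[of "snd z"] by (simp add: abs_mult)
  qed
  have iter: "(\<integral>t. k t * (\<integral>x. F (t, x) * h x \<partial>lebesgue_on G) \<partial>lebesgue_on {0<..<S})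
        = (\<integral>z. F z * (k (fst z) * h (snd z)) \<partial>lebesgue_on (cylinder S G))"
    "(\<integral>x. h x * (\<integral>t. k t * F (t, x) \<partial>lebesgue_on {0<..<S}) \<partial>lebesgue_on G)
        = (\<integral>z. F z * (k (fst z) * h (snd z)) \<partial>lebesgue_on (cylinder S G))"
    if F: "F \<in> L2 (cylinder S G)" and k[measurable]: "k \<in> borel_measurable borel"
      and K: "\<And>t. t \<in> {0<..<S} \<Longrightarrow> \<bar>k t\<bar> \<le> K" for F k K
  proof -
    have "(\<integral>x. F (t, x) * (k t * h x) \<partial>lebesgue_on G) = k t * (\<integral>x. F (t, x) * h x \<partial>lebesgue_on G)" for t
      by (subst integral_mult_right_zero[symmetric]) (simp only: mult_ac)
    then show "(\<integral>t. k t * (\<integral>x. F (t, x) * h x \<partial>lebesgue_on G) \<partial>lebesgue_on {0<..<S})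
        = (\<integral>z. F z * (k (fst z) * h (snd z)) \<partial>lebesgue_on (cylinder S G))"
      using integral_cylinder_fst[OF G(1) prod_int[OF F k K]] by simp
    have "(\<integral>t. F (t, x) * (k t * h x) \<partial>lebesgue_on {0<..<S}) = h x * (\<integral>t. k t * F (t, x) \<partial>lebesgue_on {0<..<S})" for x
      by (subst integral_mult_right_zero[symmetric]) (simp only: mult_ac)
    then show "(\<integral>x. h x * (\<integral>t. k t * F (t, x) \<partial>lebesgue_on {0<..<S}) \<partial>lebesgue_on G)
        = (\<integral>z. F z * (k (fst z) * h (snd z)) \<partial>lebesgue_on (cylinder S G))"
      using integral_cylinder_snd[OF G(1) prod_int[OF F k K]] by simp
  qed
  obtain W where W: "cont_rep S G \<zeta> W" and WS: "AE x in lebesgue_on G. W S x = 0"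
    using C by (auto simp: C_L2_vanishing_at_def)
  have WL: "W t \<in> L2 G" if "t \<in> {0..S}" for t using W that by (auto simp: cont_rep_def)
  have hL: "h \<in> L2 G" using h1 by (intro bounded_in_L2[OF h Gm, of 1]) simp
  \<comment> \<open>\<open>y\<close> is built from the continuous representative \<open>W\<close>
    because its continuity and its value at S are needed; for almost every t it is also the pairing
    of \<zeta> with \<open>h\<close>.\<close>
  define y where "y t = (\<integral>x. W t x * h x \<partial>lebesgue_on G)" for t
  define z where "z t = (\<integral>x. \<zeta>t (t, x) * h x \<partial>lebesgue_on G)" for t
  define Z where "Z t = (\<integral>s. z s \<partial>lebesgue_on {t<..<S})" for t
  have y_cont: "continuous_on {0..S} y"
    unfolding continuous_on_def
  proof
    fix t assume t: "t \<in> {0..S}"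
    have "((\<lambda>s. L2_norm G (\<lambda>x. W s x - W t x) * L2_norm G h) \<longlongrightarrow> 0 * L2_norm G h) (at t within {0..S})"
      using W t by (intro tendsto_intros) (auto simp: cont_rep_def)
    moreover have "\<forall>\<^sub>F s in at t within {0..S}. norm (y s - y t) \<le> L2_norm G (\<lambda>x. W s x - W t x) * L2_norm G h"
    proof -
      have "norm (y s - y t) \<le> L2_norm G (\<lambda>x. W s x - W t x) * L2_norm G h" if s: "s \<in> {0..S}" for s
      proof -
        have "y s - y t = (\<integral>x. (W s x - W t x) * h x \<partial>lebesgue_on G)"
          unfolding y_def left_diff_distrib
          using L2_inner_integrable[OF WL[OF s] hL] L2_inner_integrable[OF WL[OF t] hL] by simp
        then show ?thesis using L2_inner_bound[OF L2_diff[OF WL[OF s] WL[OF t]] hL] by simp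
      qed
      then show ?thesis by (auto simp: eventually_at_filter)
    qed
    ultimately have "((\<lambda>s. y s - y t) \<longlongrightarrow> 0) (at t within {0..S})"
      using Lim_null_comparison[of "\<lambda>s. y s - y t" "\<lambda>s. L2_norm G (\<lambda>x. W s x - W t x) * L2_norm G h"] by simp
    then show "(y \<longlongrightarrow> y t) (at t within {0..S})" by (simp add: LIM_zero_iff)
  qed
  have yS: "y S = 0"
  proof -
    have "y S = (\<integral>x. 0 \<partial>lebesgue_on G)"
      unfolding y_def using WS S
      by (intro integral_cong_AE borel_measurable_times L2_D(1)[OF WL] L2_D(1)[OF hL]) (auto elim: eventually_mono)
    then show ?thesis by simp
  qed
  have y_ae: "AE t in lebesgue_on {0<..<S}. y t = (\<integral>x. \<zeta> (t, x) * h x \<partial>lebesgue_on G)"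
  proof -
    have "AE t in lebesgue_on {0<..<S}. AE x in lebesgue_on G. W t x = \<zeta> (t, x)"
      using W by (auto simp: cont_rep_def)
    moreover have "AE t in lebesgue_on {0<..<S}. t \<in> {0<..<S}" by (rule AE_I2) simp
    moreover have "AE t in lebesgue_on {0<..<S}. integrable (lebesgue_on G) (\<lambda>x. \<zeta> (t, x) * h x)"
      using AE_integrable_cylinder_fst[OF G(1) prod_int[OF \<zeta>L, of "\<lambda>_. 1" 1]] by simp
    ultimately show ?thesis
    proof eventually_elim
      case (elim t)
      then have "t \<in> {0..S}" by simp
      show ?case unfolding y_def
        using elim(1)
        by (intro integral_cong_AE borel_measurable_times L2_D(1)[OF WL[OF \<open>t \<in> {0..S}\<close>]] L2_D(1)[OF hL]
            borel_measurable_integrable[OF elim(3)]) (auto elim: eventually_mono)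
    qed
  qed
  have z_int: "integrable (lebesgue_on {0<..<S}) z"
    using integrable_cylinder_fst[OF G(1) prod_int[OF \<zeta>tL, of "\<lambda>_. 1" 1]] by (simp add: z_def[abs_def])
  have Z_cont: "continuous_on {0..S} Z"
    unfolding Z_def[abs_def] by (rule tail_integral_continuous[OF z_int])
  have y_int: "(\<integral>t. k t * y t \<partial>lebesgue_on {0<..<S}) = (\<integral>z. \<zeta> z * (k (fst z) * h (snd z)) \<partial>lebesgue_on (cylinder S G))"
    if k[measurable]: "k \<in> borel_measurable borel" and K: "\<And>t. t \<in> {0<..<S} \<Longrightarrow> \<bar>k t\<bar> \<le> K" for k K
  proof -
    have km: "k \<in> borel_measurable (lebesgue_on {0<..<S})" by (rule borel_measurable_lebesgue_on[OF k])
    have "(\<integral>t. k t * y t \<partial>lebesgue_on {0<..<S}) = (\<integral>t. k t * (\<integral>x. \<zeta> (t, x) * h x \<partial>lebesgue_on G) \<partial>lebesgue_on {0<..<S})"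
    proof (rule integral_cong_AE)
      show "(\<lambda>t. k t * y t) \<in> borel_measurable (lebesgue_on {0<..<S})"
        by (intro borel_measurable_times km borel_measurable_integrable[OF integrable_lebesgue_on_Ioo[OF y_cont]])
      show "(\<lambda>t. k t * (\<integral>x. \<zeta> (t, x) * h x \<partial>lebesgue_on G)) \<in> borel_measurable (lebesgue_on {0<..<S})"
        using integrable_cylinder_fst[OF G(1) prod_int[OF \<zeta>L, of "\<lambda>_. 1" 1]]
        by (intro borel_measurable_times km) auto
    qed (use y_ae in \<open>auto elim: eventually_mono\<close>)
    then show ?thesis using iter(1)[OF \<zeta>L k K] by simp
  qed
  \<comment> \<open>Tested with the derivative of \<phi>, \<open>y\<close> gives minus the integral
    of \<phi> z by the weak derivative, and \<open>Z\<close> gives plus the same integral by Fubini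
    on the triangle with \<phi> as the primitive. So \<open>y + Z\<close> has weak derivative
    0.\<close>
  have yZ: "y t + Z t = y S + Z S" if t: "t \<in> {0..S}" for t
  proof (rule du_Bois_Reymond[OF S _ _ t])
    show "continuous_on {0..S} (\<lambda>t. y t + Z t)" by (intro continuous_intros y_cont Z_cont)
    show "S \<in> {0..S}" using S by simp
    fix \<phi> :: "real \<Rightarrow> real" assume \<phi>: "\<phi> \<in> Cc_infinity {0<..<S}"
    note d = Cc_infinity_real_deriv[OF \<phi>]
    have c: "continuous_on {0..S} \<phi>" "continuous_on {0..S} (deriv \<phi>)"
      using d(2) Cc_infinity_continuous[OF \<phi>] by (auto intro: continuous_on_subset)
    obtain K where K: "\<And>t. t \<in> {0..S} \<Longrightarrow> \<bar>\<phi> t\<bar> \<le> K" using continuous_on_bounded_Ioo[OF c(1)] by blast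
    obtain K' where K': "\<And>t. t \<in> {0..S} \<Longrightarrow> \<bar>deriv \<phi> t\<bar> \<le> K'" using continuous_on_bounded_Ioo[OF c(2)] by blast
    have m: "\<phi> \<in> borel_measurable borel" "deriv \<phi> \<in> borel_measurable borel"
      using d(2) Cc_infinity_continuous[OF \<phi>] by (auto intro: borel_measurable_continuous_onI)
    have "(\<integral>t. deriv \<phi> t * y t \<partial>lebesgue_on {0<..<S}) = (\<integral>z. \<zeta> z * (deriv \<phi> (fst z) * h (snd z)) \<partial>lebesgue_on (cylinder S G))"
      using K' by (intro y_int[OF m(2), of K']) auto
    also have "\<dots> = (\<integral>x. h x * (\<integral>t. deriv \<phi> t * \<zeta> (t, x) \<partial>lebesgue_on {0<..<S}) \<partial>lebesgue_on G)"
      using K' by (intro iter(2)[OF \<zeta>L m(2), of K', symmetric]) auto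
    \<comment> \<open>The exceptional null set of points x may depend on \<phi>; this is harmless
      because \<phi> is fixed here.\<close>
    also have "\<dots> = (\<integral>x. - (h x * (\<integral>t. \<phi> t * \<zeta>t (t, x) \<partial>lebesgue_on {0<..<S})) \<partial>lebesgue_on G)"
    proof (rule integral_cong_AE)
      have *: "(\<lambda>x. h x * (\<integral>t. k t * F (t, x) \<partial>lebesgue_on {0<..<S})) \<in> borel_measurable (lebesgue_on G)"
        if F: "F \<in> L2 (cylinder S G)" and k: "k \<in> borel_measurable borel" "\<And>t. t \<in> {0<..<S} \<Longrightarrow> \<bar>k t\<bar> \<le> K" for F k K
      proof -
        have "(\<integral>t. F (t, x) * (k t * h x) \<partial>lebesgue_on {0<..<S}) = h x * (\<integral>t. k t * F (t, x) \<partial>lebesgue_on {0<..<S})" for x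
          by (subst integral_mult_right_zero[symmetric]) (simp only: mult_ac)
        then show ?thesis
          using borel_measurable_integrable[OF integrable_cylinder_snd[OF G(1) prod_int[OF F k]]] by simp
      qed
      show "(\<lambda>x. h x * (\<integral>t. deriv \<phi> t * \<zeta> (t, x) \<partial>lebesgue_on {0<..<S})) \<in> borel_measurable (lebesgue_on G)"
        using K' by (intro *[OF \<zeta>L m(2), of K']) auto
      show "(\<lambda>x. - (h x * (\<integral>t. \<phi> t * \<zeta>t (t, x) \<partial>lebesgue_on {0<..<S}))) \<in> borel_measurable (lebesgue_on G)"
        using K by (intro borel_measurable_uminus *[OF \<zeta>tL m(1), of K]) auto
      show "AE x in lebesgue_on G. h x * (\<integral>t. deriv \<phi> t * \<zeta> (t, x) \<partial>lebesgue_on {0<..<S})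
          = - (h x * (\<integral>t. \<phi> t * \<zeta>t (t, x) \<partial>lebesgue_on {0<..<S}))"
        using weak[OF \<phi>] by eventually_elim simp
    qed
    also have "\<dots> = - (\<integral>x. h x * (\<integral>t. \<phi> t * \<zeta>t (t, x) \<partial>lebesgue_on {0<..<S}) \<partial>lebesgue_on G)" by simp
    also have "\<dots> = - (\<integral>t. \<phi> t * z t \<partial>lebesgue_on {0<..<S})"
      using K iter[OF \<zeta>tL m(1), of K] by (simp add: z_def)
    finally have 1: "(\<integral>t. deriv \<phi> t * y t \<partial>lebesgue_on {0<..<S}) = - (\<integral>t. \<phi> t * z t \<partial>lebesgue_on {0<..<S})" .
    have 2: "(\<integral>t. \<phi> t * z t \<partial>lebesgue_on {0<..<S}) = (\<integral>t. deriv \<phi> t * Z t \<partial>lebesgue_on {0<..<S})"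
      unfolding Z_def
    proof (rule integral_primitive_tail[OF z_int m(2), of K'])
      show "\<bar>deriv \<phi> t\<bar> \<le> K'" if "t \<in> {0<..<S}" for t using K' that by auto
      fix s assume s: "s \<in> {0<..<S}"
      have "(\<integral>t. deriv \<phi> t * indicator {0..s} t \<partial>lborel) = \<phi> s - \<phi> 0"
        using s d by (intro integral_FTC_Icc_real) (auto simp: continuous_on_eq_continuous_at)
      moreover have "\<phi> 0 = 0" by (rule Cc_infinity_zero_outside[OF \<phi>]) simp
      moreover have "(\<integral>t. deriv \<phi> t * indicator {0..s} t \<partial>lborel) = (\<integral>t. indicator {0<..<s} t * deriv \<phi> t \<partial>lborel)"
        using AE_lborel_singleton[of 0] AE_lborel_singleton[of s] m(2)
        by (intro integral_cong_AE) (auto simp: indicator_def elim!: eventually_elim2)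
      ultimately show "\<phi> s = (\<integral>t. indicator {0<..<s} t * deriv \<phi> t \<partial>lborel)" by simp
    qed
    have "(\<integral>t. deriv \<phi> t * (y t + Z t) \<partial>lebesgue_on {0<..<S})
       = (\<integral>t. deriv \<phi> t * y t \<partial>lebesgue_on {0<..<S}) + (\<integral>t. deriv \<phi> t * Z t \<partial>lebesgue_on {0<..<S})"
      unfolding distrib_left
      by (intro Bochner_Integration.integral_add integrable_lebesgue_on_Ioo continuous_on_mult c y_cont Z_cont)
    then show "(\<integral>t. deriv \<phi> t * (y t + Z t) \<partial>lebesgue_on {0<..<S}) = 0" using 1 2 by simp
  qed
  have "Z S = 0" by (simp add: Z_def lebesgue_integral_eq_integral)
  then have Zy: "Z t = - y t" if "t \<in> {0..S}" for t using yZ[OF that] yS by simp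
  have "(\<integral>z. \<zeta>t z * (w (fst z) * h (snd z)) \<partial>lebesgue_on (cylinder S G)) = (\<integral>t. w t * z t \<partial>lebesgue_on {0<..<S})"
    using iter(1)[OF \<zeta>tL wm wM] by (simp add: z_def)
  also have "\<dots> = (\<integral>t. v t * Z t \<partial>lebesgue_on {0<..<S})"
    unfolding Z_def by (rule integral_primitive_tail[OF z_int v vM w])
  also have "\<dots> = (\<integral>t. - (v t * y t) \<partial>lebesgue_on {0<..<S})"
    by (intro Bochner_Integration.integral_cong) (auto simp: Zy)
  also have "\<dots> = - (\<integral>t. v t * y t \<partial>lebesgue_on {0<..<S})" by simp
  also have "(\<integral>t. v t * y t \<partial>lebesgue_on {0<..<S}) = (\<integral>z. \<zeta> z * (v (fst z) * h (snd z)) \<partial>lebesgue_on (cylinder S G))"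
    by (rule y_int[OF v vM])
  finally show ?thesis .
qed

section \<open>Sums of modes\<close>

lemma cos_directional_derivative:
  fixes \<kappa> x :: "real ^ 'n"
  shows "((\<lambda>s. cos (\<kappa> \<bullet> (x + s *\<^sub>R axis i 1))) has_real_derivative - (\<kappa> $ i * sin (\<kappa> \<bullet> x))) (at 0)"
    and "((\<lambda>s. sin (\<kappa> \<bullet> (x + s *\<^sub>R axis i 1))) has_real_derivative \<kappa> $ i * cos (\<kappa> \<bullet> x)) (at 0)"
  by (auto intro!: derivative_eq_intros simp: inner_add_right inner_axis)

lemma Cc_infinity_in_L2:
  fixes \<phi> :: "real ^ 'n \<Rightarrow> real"
  assumes \<phi>: "\<phi> \<in> Cc_infinity G" and G: "G \<in> lmeasurable"
  shows "\<phi> \<in> L2 G" "grad \<phi> \<in> L2 G"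
proof -
  have K: "compact (closure {x. \<phi> x \<noteq> 0})" using \<phi> unfolding Cc_infinity_def by blast
  have c1: "continuous_on UNIV \<phi>" by (rule Cc_infinity_continuous[OF \<phi>])
  have "continuous_on UNIV (\<lambda>x. \<chi> i. grad \<phi> x $ i)"
    by (intro continuous_on_vec_lambda Cc_infinity_grad_continuous[OF \<phi>])
  then have c2: "continuous_on UNIV (grad \<phi>)" by simp
  have "bounded (\<phi> ` closure {x. \<phi> x \<noteq> 0})" "bounded (grad \<phi> ` closure {x. \<phi> x \<noteq> 0})"
    using K c1 c2 by (auto intro!: compact_imp_bounded compact_continuous_image intro: continuous_on_subset)
  then obtain B1 B2 where B1: "\<And>x. x \<in> closure {x. \<phi> x \<noteq> 0} \<Longrightarrow> norm (\<phi> x) \<le> B1"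
    and B2: "\<And>x. x \<in> closure {x. \<phi> x \<noteq> 0} \<Longrightarrow> norm (grad \<phi> x) \<le> B2"
    unfolding bounded_iff by auto
  have "norm (\<phi> x) \<le> max 0 B1" for x
    using B1[of x] closure_subset[of "{x. \<phi> x \<noteq> 0}"] by (cases "\<phi> x = 0") auto
  then show "\<phi> \<in> L2 G"
    using c1 by (intro bounded_in_L2[OF _ G] borel_measurable_continuous_onI)
  have "norm (grad \<phi> x) \<le> max 0 B2" for x
    using B2[of x] grad_zero_off_support[of x \<phi>] by (cases "x \<in> closure {x. \<phi> x \<noteq> 0}") auto
  then show "grad \<phi> \<in> L2 G"
    using c2 by (intro bounded_in_L2[OF _ G] borel_measurable_continuous_onI)
qed

lemma L2_inner_tendsto:
  assumes F: "F \<in> L2 G" and g: "g \<in> L2 G" and gn: "\<And>n. gn n \<in> L2 G"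
    and lim: "(\<lambda>n. L2_norm G (\<lambda>x. gn n x - g x)) \<longlonglongrightarrow> 0"
  shows "(\<lambda>n. \<integral>x. F x \<bullet> gn n x \<partial>lebesgue_on G) \<longlonglongrightarrow> (\<integral>x. F x \<bullet> g x \<partial>lebesgue_on G)"
proof -
  have "(\<lambda>n. L2_norm G F * L2_norm G (\<lambda>x. gn n x - g x)) \<longlonglongrightarrow> L2_norm G F * 0"
    by (intro tendsto_intros lim)
  then have "(\<lambda>n. L2_norm G F * L2_norm G (\<lambda>x. gn n x - g x)) \<longlonglongrightarrow> 0" by (simp only: mult_zero_right)
  moreover have "\<forall>\<^sub>F n in sequentially. norm ((\<integral>x. F x \<bullet> gn n x \<partial>lebesgue_on G) - (\<integral>x. F x \<bullet> g x \<partial>lebesgue_on G))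
     \<le> L2_norm G F * L2_norm G (\<lambda>x. gn n x - g x)"
  proof (intro always_eventually allI)
    fix n
    have "(\<integral>x. F x \<bullet> gn n x \<partial>lebesgue_on G) - (\<integral>x. F x \<bullet> g x \<partial>lebesgue_on G) = (\<integral>x. F x \<bullet> (gn n x - g x) \<partial>lebesgue_on G)"
      unfolding inner_diff_right
      by (intro Bochner_Integration.integral_diff[symmetric] L2_inner_integrable F g gn)
    then show "norm ((\<integral>x. F x \<bullet> gn n x \<partial>lebesgue_on G) - (\<integral>x. F x \<bullet> g x \<partial>lebesgue_on G))
     \<le> L2_norm G F * L2_norm G (\<lambda>x. gn n x - g x)"
      using L2_inner_bound[OF F L2_diff[OF gn g], of n] by simp
  qed
  ultimately have "(\<lambda>n. (\<integral>x. F x \<bullet> gn n x \<partial>lebesgue_on G) - (\<integral>x. F x \<bullet> g x \<partial>lebesgue_on G)) \<longlonglongrightarrow> 0"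
    by (rule Lim_null_comparison[rotated])
  then show ?thesis by (simp add: LIM_zero_iff)
qed

text \<open>The cosine is an eigenfunction of the negative Laplacian with eigenvalue |\<kappa>|^2.
  For smooth compactly supported functions the identity is two-fold use of integration by parts
  written once for the gradient of the cosine; both sides are continuous under convergence of f and
  Df in L2, so it passes to the closure. The zero boundary values of f matter, since the cosine does
  not vanish on the boundary of \<open>G\<close>.\<close>

lemma H1_zero_cos_identity:
  fixes \<kappa> :: "real ^ 'n"
  assumes G: "open G" "bounded G" and f: "H1_zero_with_grad G f Df"
  shows "(\<integral>x. (- (sin (\<kappa> \<bullet> x) *\<^sub>R \<kappa>)) \<bullet> Df x \<partial>lebesgue_on G)
       = (norm \<kappa>)\<^sup>2 * (\<integral>x. f x * cos (\<kappa> \<bullet> x) \<partial>lebesgue_on G)"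
proof -
  have Gm: "G \<in> lmeasurable" using G by (simp add: lmeasurable_open)
  have fL: "f \<in> L2 G" "Df \<in> L2 G" using f by (auto simp: H1_zero_with_grad_def H1_with_grad_def)
  obtain \<phi> where \<phi>: "\<And>n::nat. \<phi> n \<in> Cc_infinity G"
    and l: "(\<lambda>n. L2_norm G (\<lambda>x. \<phi> n x - f x)) \<longlonglongrightarrow> 0" "(\<lambda>n. L2_norm G (\<lambda>x. grad (\<phi> n) x - Df x)) \<longlonglongrightarrow> 0"
    using f unfolding H1_zero_with_grad_def by blast
  let ?F = "\<lambda>x. - (sin (\<kappa> \<bullet> x) *\<^sub>R \<kappa>)"
  have cL: "(\<lambda>x. cos (\<kappa> \<bullet> x)) \<in> L2 G"
    by (rule bounded_in_L2[OF _ Gm, of _ 1]) auto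
  have sL: "?F \<in> L2 G"
    by (rule bounded_in_L2[OF _ Gm, of _ "norm \<kappa>"]) (auto simp: mult_left_le_one_le)
  have eq: "(\<integral>x. ?F x \<bullet> grad (\<phi> n) x \<partial>lebesgue_on G) = (norm \<kappa>)\<^sup>2 * (\<integral>x. cos (\<kappa> \<bullet> x) \<bullet> \<phi> n x \<partial>lebesgue_on G)" for n
  proof -
    have c: "continuous_on UNIV (\<lambda>x. - (\<kappa> $ i * sin (\<kappa> \<bullet> x)))" "continuous_on UNIV (\<lambda>x. - (\<kappa> $ i * (\<kappa> $ i * cos (\<kappa> \<bullet> x))))" for i
      by (auto intro!: continuous_intros)
    have "(\<integral>x. ?F x \<bullet> grad (\<phi> n) x \<partial>lebesgue_on G) = (\<integral>x. (\<Sum>i\<in>UNIV. (- (\<kappa> $ i * sin (\<kappa> \<bullet> x))) * grad (\<phi> n) x $ i) \<partial>lebesgue_on G)"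
      by (simp add: inner_vec_def mult_ac)
    also have "\<dots> = (\<Sum>i\<in>UNIV. (\<integral>x. (- (\<kappa> $ i * sin (\<kappa> \<bullet> x))) * grad (\<phi> n) x $ i \<partial>lebesgue_on G))"
    proof (rule Bochner_Integration.integral_sum)
      fix i
      have gL: "grad (\<phi> n) \<in> L2 G" by (rule Cc_infinity_in_L2(2)[OF \<phi> Gm])
      have sL': "(\<lambda>x. (- (\<kappa> $ i * sin (\<kappa> \<bullet> x))) *\<^sub>R (axis i 1 :: real^'n)) \<in> L2 G"
        by (rule bounded_in_L2[OF _ Gm, of _ "\<bar>\<kappa> $ i\<bar>"]) (auto simp: abs_mult mult_left_le)
      show "integrable (lebesgue_on G) (\<lambda>x. - (\<kappa> $ i * sin (\<kappa> \<bullet> x)) * grad (\<phi> n) x $ i)"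
        using L2_inner_integrable[OF sL' gL] by (simp add: inner_axis')
    qed
    also have "\<dots> = (\<Sum>i\<in>UNIV. (\<kappa> $ i)\<^sup>2 * (\<integral>x. cos (\<kappa> \<bullet> x) \<bullet> \<phi> n x \<partial>lebesgue_on G))"
    proof (rule sum.cong[OF refl])
      fix i
      have "(\<integral>x. (- (\<kappa> $ i * sin (\<kappa> \<bullet> x))) * grad (\<phi> n) x $ i \<partial>lebesgue_on G)
          = - (\<integral>x. (- (\<kappa> $ i * (\<kappa> $ i * cos (\<kappa> \<bullet> x)))) * \<phi> n x \<partial>lebesgue_on G)"
        by (rule Cc_infinity_by_parts[OF \<phi> G(1) c]) (intro DERIV_minus DERIV_cmult cos_directional_derivative)
      also have "\<dots> = (\<integral>x. (\<kappa> $ i)\<^sup>2 * (cos (\<kappa> \<bullet> x) \<bullet> \<phi> n x) \<partial>lebesgue_on G)"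
        by (subst integral_minus[symmetric]) (simp add: power2_eq_square mult_ac)
      also have "\<dots> = (\<kappa> $ i)\<^sup>2 * (\<integral>x. cos (\<kappa> \<bullet> x) \<bullet> \<phi> n x \<partial>lebesgue_on G)"
        by (rule integral_mult_right_zero)
      finally show "(\<integral>x. (- (\<kappa> $ i * sin (\<kappa> \<bullet> x))) * grad (\<phi> n) x $ i \<partial>lebesgue_on G)
        = (\<kappa> $ i)\<^sup>2 * (\<integral>x. cos (\<kappa> \<bullet> x) \<bullet> \<phi> n x \<partial>lebesgue_on G)" .
    qed
    also have "\<dots> = (norm \<kappa>)\<^sup>2 * (\<integral>x. cos (\<kappa> \<bullet> x) \<bullet> \<phi> n x \<partial>lebesgue_on G)"
      by (simp only: sum_distrib_right[symmetric] power2_norm_eq_inner inner_vec_def) (simp add: power2_eq_square)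
    finally show ?thesis .
  qed
  have "(\<lambda>n. \<integral>x. ?F x \<bullet> grad (\<phi> n) x \<partial>lebesgue_on G) \<longlonglongrightarrow> (\<integral>x. ?F x \<bullet> Df x \<partial>lebesgue_on G)"
    by (rule L2_inner_tendsto[OF sL fL(2) Cc_infinity_in_L2(2)[OF \<phi> Gm] l(2)])
  moreover have "(\<lambda>n. (norm \<kappa>)\<^sup>2 * (\<integral>x. cos (\<kappa> \<bullet> x) \<bullet> \<phi> n x \<partial>lebesgue_on G)) \<longlonglongrightarrow> (norm \<kappa>)\<^sup>2 * (\<integral>x. cos (\<kappa> \<bullet> x) \<bullet> f x \<partial>lebesgue_on G)"
    by (intro tendsto_intros L2_inner_tendsto[OF cL fL(1) Cc_infinity_in_L2(1)[OF \<phi> Gm] l(1)])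
  ultimately have "(\<integral>x. ?F x \<bullet> Df x \<partial>lebesgue_on G) = (norm \<kappa>)\<^sup>2 * (\<integral>x. cos (\<kappa> \<bullet> x) \<bullet> f x \<partial>lebesgue_on G)"
    unfolding eq by (rule LIMSEQ_unique)
  then show ?thesis by (simp add: mult.commute)
qed

text \<open>A finite cosine series with kernels as coefficients in time. Convolution with
  \<open>g_kernel a\<close> shifts each \<open>b i\<close> to \<open>a + b i\<close>, and the
  Laplacian multiplies each term by -|\<kappa>|^2, so both operators act term by term within such
  sums.\<close>

definition mode_sum :: "'i set \<Rightarrow> ('i \<Rightarrow> real) \<Rightarrow> ('i \<Rightarrow> real) \<Rightarrow> ('i \<Rightarrow> real ^ 'n) \<Rightarrow> real \<Rightarrow> real ^ 'n \<Rightarrow> real" where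
  "mode_sum J A b \<kappa> t x = (\<Sum>i\<in>J. A i * g_kernel (b i) t * cos (\<kappa> i \<bullet> x))"

text \<open>Since \<open>g\<^bsub>1-\<alpha>\<^esub> * g\<^sub>b = g\<^bsub>b+1-\<alpha>\<^esub>\<close>, this is \<open>\<partial>\<^sub>t\<^sup>\<alpha> u - \<Delta> u\<close> for \<open>u\<close> the \<open>mode_sum\<close>.\<close>

definition mode_source :: "real \<Rightarrow> 'i set \<Rightarrow> ('i \<Rightarrow> real) \<Rightarrow> ('i \<Rightarrow> real) \<Rightarrow> ('i \<Rightarrow> real ^ 'n) \<Rightarrow> real \<Rightarrow> real ^ 'n \<Rightarrow> real" where
  "mode_source \<alpha> J A b \<kappa> t x =
     (\<Sum>i\<in>J. A i * (g_kernel (b i - \<alpha>) t + (norm (\<kappa> i))\<^sup>2 * g_kernel (b i) t) * cos (\<kappa> i \<bullet> x))"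

definition mode_grad :: "'i set \<Rightarrow> ('i \<Rightarrow> real) \<Rightarrow> ('i \<Rightarrow> real) \<Rightarrow> ('i \<Rightarrow> real ^ 'n) \<Rightarrow> real \<Rightarrow> real ^ 'n \<Rightarrow> real ^ 'n" where
  "mode_grad J A b \<kappa> t x = (\<Sum>i\<in>J. (A i * g_kernel (b i) t) *\<^sub>R (- (sin (\<kappa> i \<bullet> x) *\<^sub>R \<kappa> i)))"

lemma mode_sum_measurable: "(\<lambda>z. mode_sum J A b \<kappa> (fst z) (snd z)) \<in> borel_measurable borel"
  and mode_grad_measurable: "(\<lambda>z. mode_grad J A b \<kappa> (fst z) (snd z)) \<in> borel_measurable borel"
  unfolding mode_sum_def mode_grad_def borel_prod[symmetric] by measurable

lemma mode_sum_continuous: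
  assumes "\<And>i. i \<in> J \<Longrightarrow> 1 < b i" shows "continuous_on ({0..} \<times> UNIV) (\<lambda>z. mode_sum J A b \<kappa> (fst z) (snd z))"
  unfolding mode_sum_def
  by (intro continuous_intros continuous_on_compose2[OF g_kernel_continuous[OF assms]]) auto

lemma mode_sum_bound:
  assumes b: "\<And>i. i \<in> J \<Longrightarrow> 1 \<le> b i" and t: "0 \<le> t" "t \<le> S"
  shows "\<bar>mode_sum J A b \<kappa> t x\<bar> \<le> (\<Sum>i\<in>J. \<bar>A i\<bar> * g_kernel (b i) S)"
  unfolding mode_sum_def
proof (rule order_trans[OF sum_abs sum_mono])
  fix i assume i: "i \<in> J"
  have "\<bar>A i * g_kernel (b i) t * cos (\<kappa> i \<bullet> x)\<bar> \<le> \<bar>A i\<bar> * g_kernel (b i) S * 1"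
    using g_kernel_mono[OF b[OF i] t] g_kernel_nonneg[of "b i" t] b[OF i]
    unfolding abs_mult by (intro mult_mono) auto
  then show "\<bar>A i * g_kernel (b i) t * cos (\<kappa> i \<bullet> x)\<bar> \<le> \<bar>A i\<bar> * g_kernel (b i) S" by simp
qed

lemma mode_grad_bound:
  assumes b: "\<And>i. i \<in> J \<Longrightarrow> 1 \<le> b i" and t: "0 \<le> t" "t \<le> S"
  shows "norm (mode_grad J A b \<kappa> t x) \<le> (\<Sum>i\<in>J. \<bar>A i\<bar> * g_kernel (b i) S * norm (\<kappa> i))"
  unfolding mode_grad_def
proof (rule order_trans[OF norm_sum sum_mono])
  fix i assume i: "i \<in> J"
  have "\<bar>A i\<bar> * g_kernel (b i) t * (\<bar>sin (\<kappa> i \<bullet> x)\<bar> * norm (\<kappa> i)) \<le> \<bar>A i\<bar> * g_kernel (b i) S * (1 * norm (\<kappa> i))"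
    using g_kernel_mono[OF b[OF i] t] g_kernel_nonneg[of "b i" t] b[OF i]
    by (intro mult_mono) auto
  then show "norm ((A i * g_kernel (b i) t) *\<^sub>R - (sin (\<kappa> i \<bullet> x) *\<^sub>R \<kappa> i)) \<le> \<bar>A i\<bar> * g_kernel (b i) S * norm (\<kappa> i)"
    using g_kernel_nonneg[of "b i" t] b[OF i] by (simp add: abs_mult)
qed

lemma mode_H1_with_grad:
  fixes \<kappa> :: "'i \<Rightarrow> real ^ 'n"
  assumes G: "open G" "bounded G" and J: "finite J"
  shows "H1_with_grad G (mode_sum J A b \<kappa> t) (mode_grad J A b \<kappa> t)"
proof -
  have Gm: "G \<in> lmeasurable" using G by (simp add: lmeasurable_open)
  have m: "mode_sum J A b \<kappa> t \<in> borel_measurable borel" "mode_grad J A b \<kappa> t \<in> borel_measurable borel"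
    unfolding mode_sum_def[abs_def] mode_grad_def[abs_def] by measurable
  have c: "continuous_on UNIV (mode_sum J A b \<kappa> t)" "continuous_on UNIV (\<lambda>x. mode_grad J A b \<kappa> t x $ i)" for i
    unfolding mode_sum_def[abs_def] mode_grad_def[abs_def] sum_component by (auto intro!: continuous_intros)
  have "norm (mode_sum J A b \<kappa> t x) \<le> (\<Sum>i\<in>J. \<bar>A i * g_kernel (b i) t\<bar>)" for x
    unfolding mode_sum_def real_norm_def
    by (rule order_trans[OF sum_abs sum_mono]) (simp add: abs_mult mult_left_le)
  moreover have "norm (mode_grad J A b \<kappa> t x) \<le> (\<Sum>i\<in>J. \<bar>A i * g_kernel (b i) t\<bar> * norm (\<kappa> i))" for x
    unfolding mode_grad_def
    by (rule order_trans[OF norm_sum sum_mono]) (auto simp: abs_mult mult_left_le intro!: mult_right_mono)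
  ultimately have "mode_sum J A b \<kappa> t \<in> L2 G" "mode_grad J A b \<kappa> t \<in> L2 G"
    using bounded_in_L2[OF m(1) Gm] bounded_in_L2[OF m(2) Gm] by blast+
  moreover have "(\<integral>x. mode_sum J A b \<kappa> t x * grad \<phi> x $ i \<partial>lebesgue_on G) = - (\<integral>x. mode_grad J A b \<kappa> t x $ i * \<phi> x \<partial>lebesgue_on G)"
    if "\<phi> \<in> Cc_infinity G" for \<phi> i
  proof (rule Cc_infinity_by_parts[OF that G(1) c])
    fix x
    have "((\<lambda>s. mode_sum J A b \<kappa> t (x + s *\<^sub>R axis i 1)) has_real_derivative (\<Sum>j\<in>J. A j * g_kernel (b j) t * - (\<kappa> j $ i * sin (\<kappa> j \<bullet> x)))) (at 0)"
      unfolding mode_sum_def by (intro DERIV_sum DERIV_cmult cos_directional_derivative)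
    also have "(\<Sum>j\<in>J. A j * g_kernel (b j) t * - (\<kappa> j $ i * sin (\<kappa> j \<bullet> x))) = mode_grad J A b \<kappa> t x $ i"
      by (simp add: mode_grad_def mult_ac)
    finally show "((\<lambda>s. mode_sum J A b \<kappa> t (x + s *\<^sub>R axis i 1)) has_real_derivative mode_grad J A b \<kappa> t x $ i) (at 0)" .
  qed
  ultimately show ?thesis by (auto simp: H1_with_grad_def)
qed

lemma has_bochner_integral_mode_conv:
  assumes "finite J" "\<And>i. i \<in> J \<Longrightarrow> 0 < b i" "0 < a" "0 < t"
  shows "has_bochner_integral lborel (\<lambda>s. indicator {0<..<t} s * (g_kernel a (t - s) * mode_sum J A b \<kappa> s x))
      (mode_sum J A (\<lambda>i. a + b i) \<kappa> t x)"
proof -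
  have "has_bochner_integral lborel
     (\<lambda>s. \<Sum>i\<in>J. (A i * cos (\<kappa> i \<bullet> x)) * (indicator {0<..<t} s * (g_kernel a (t - s) * g_kernel (b i) s)))
     (\<Sum>i\<in>J. (A i * cos (\<kappa> i \<bullet> x)) * g_kernel (a + b i) t)"
    using assms by (intro has_bochner_integral_sum has_bochner_integral_mult_right has_bochner_integral_g_kernel_conv) auto
  then show ?thesis by (simp add: mode_sum_def sum_distrib_left mult_ac)
qed

lemma time_conv_mode_sum:
  assumes "finite J" "\<And>i. i \<in> J \<Longrightarrow> 0 < b i" "0 < a" "0 < t"
  shows "time_conv (g_kernel a) (\<lambda>(s, x). mode_sum J A b \<kappa> s x) (t, x) = mode_sum J A (\<lambda>i. a + b i) \<kappa> t x"
proof -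
  have [measurable]: "(\<lambda>s. mode_sum J A b \<kappa> s x) \<in> borel_measurable borel"
    unfolding mode_sum_def by measurable
  have "time_conv (g_kernel a) (\<lambda>(s, x). mode_sum J A b \<kappa> s x) (t, x)
      = (\<integral>s. indicator {0<..<t} s *\<^sub>R (g_kernel a (t - s) * mode_sum J A b \<kappa> s x) \<partial>lebesgue)"
    unfolding time_conv_def prod.case by (rule integral_restrict_space) simp
  also have "\<dots> = (\<integral>s. indicator {0<..<t} s *\<^sub>R (g_kernel a (t - s) * mode_sum J A b \<kappa> s x) \<partial>lborel)"
    by (rule integral_completion) measurable
  also have "\<dots> = mode_sum J A (\<lambda>i. a + b i) \<kappa> t x"
    using has_bochner_integral_integral_eq[OF has_bochner_integral_mode_conv[OF assms]] by simp
  finally show ?thesis .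
qed

lemma L2_norm_bound:
  fixes f :: "'a::euclidean_space \<Rightarrow> 'b::euclidean_space"
  assumes "G \<in> lmeasurable" "f \<in> borel_measurable borel" "\<And>x. x \<in> G \<Longrightarrow> norm (f x) \<le> K" "0 \<le> K"
  shows "L2_norm G f \<le> K * sqrt (measure lebesgue G)"
proof -
  have fL: "f \<in> L2 G" by (rule bounded_in_L2[OF assms(2,1,3)])
  have kL: "(\<lambda>_. K) \<in> L2 G" by (rule bounded_in_L2[OF _ assms(1), of _ K]) (use assms(4) in auto)
  have "(\<integral>x. (norm (f x))\<^sup>2 \<partial>lebesgue_on G) \<le> (\<integral>x. (norm K)\<^sup>2 \<partial>lebesgue_on G)"
    by (intro integral_mono L2_D(2)[OF fL] L2_D(2)[OF kL] power_mono) (use assms(3,4) in auto)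
  also have "\<dots> = K\<^sup>2 * measure lebesgue G"
    using assms(1) by (simp add: measure_restrict_space fmeasurableD)
  finally have "sqrt (\<integral>x. (norm (f x))\<^sup>2 \<partial>lebesgue_on G) \<le> sqrt (K\<^sup>2 * measure lebesgue G)"
    by (rule real_sqrt_le_mono)
  then show ?thesis using assms(4) by (simp add: L2_norm_def real_sqrt_mult)
qed

text \<open>The bound on \<open>b\<close> makes the exponents \<open>b i\<close>,
  \<open>b i - \<alpha>\<close> and \<open>1 - \<alpha> + b i\<close> at least 1. In that range the
  kernels are nondecreasing in time, hence bounded on (0,S) by their value at S.\<close>

locale mode_data =
  fixes \<alpha> S :: real and G :: "(real ^ 'n) set" and J :: "'i set" and A b :: "'i \<Rightarrow> real" and \<kappa> :: "'i \<Rightarrow> real ^ 'n"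
  assumes \<alpha>: "0 < \<alpha>" "\<alpha> < 1" and S: "0 < S" and G: "open G" "bounded G"
    and J: "finite J" and b: "\<And>i. i \<in> J \<Longrightarrow> 1 + \<alpha> \<le> b i"
begin

lemma b1: "i \<in> J \<Longrightarrow> 1 < b i" using b[of i] \<alpha> by linarith

lemma Gm: "G \<in> lmeasurable" using G by (simp add: lmeasurable_open)

lemma weak_Lq:
  assumes q: "0 \<le> q"
  shows "(\<lambda>z. mode_sum J A b \<kappa> (fst z) (snd z)) \<in> weak_Lq_L2 q S G"
proof -
  let ?K = "(\<Sum>i\<in>J. \<bar>A i\<bar> * g_kernel (b i) S)"
  let ?E = "\<lambda>l. {t \<in> {0<..<S}. L2_norm G (\<lambda>x. mode_sum J A b \<kappa> t x) > l}"
  have K: "0 \<le> ?K" by (intro sum_nonneg mult_nonneg_nonneg g_kernel_nonneg) (auto dest!: b1)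
  have m: "(\<lambda>x. mode_sum J A b \<kappa> t x) \<in> borel_measurable borel" for t
    unfolding mode_sum_def by measurable
  have bd: "norm (mode_sum J A b \<kappa> t x) \<le> ?K" if "t \<in> {0<..<S}" for t x
    using mode_sum_bound[of J b t S A \<kappa> x] b1 that by (simp add: less_imp_le)
  define M where "M = ?K * sqrt (measure lebesgue G)"
  have n: "L2_norm G (\<lambda>x. mode_sum J A b \<kappa> t x) \<le> M" if "t \<in> {0<..<S}" for t
    unfolding M_def by (rule L2_norm_bound[OF Gm m bd[OF that] K])
  have "l powr q * measure lebesgue (?E l) \<le> M powr q * S" if l: "l > 0" for l
  proof (cases "l < M")
    case True
    \<comment> \<open>The superlevel set need not be shown measurable: \<open>measure\<close> has
      the default value 0 on nonmeasurable sets.\<close>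
    have "measure lebesgue (?E l) \<le> S"
    proof (cases "?E l \<in> sets lebesgue")
      case True
      then have "measure lebesgue (?E l) \<le> measure lebesgue {0<..<S}"
        by (intro measure_mono_fmeasurable) auto
      then show ?thesis using S by simp
    qed (use S in \<open>simp add: measure_notin_sets\<close>)
    moreover have "l powr q \<le> M powr q" using True l q by (intro powr_mono2) auto
    ultimately show ?thesis using S by (intro mult_mono) auto
  next
    case False
    have "\<not> L2_norm G (\<lambda>x. mode_sum J A b \<kappa> t x) > l" if "t \<in> {0<..<S}" for t
      using n[OF that] False by linarith
    then have "?E l = {}" by blast
    then have "measure lebesgue (?E l) = 0" by (simp only: measure_empty)
    then show ?thesis using S by simp
  qed
  moreover have "(\<lambda>x. mode_sum J A b \<kappa> t x) \<in> L2 G" if "t \<in> {0<..<S}" for t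
    by (rule bounded_in_L2[OF m Gm bd[OF that]])
  ultimately show ?thesis
    unfolding weak_Lq_L2_def
    by (auto intro!: borel_measurable_lebesgue_on mode_sum_measurable AE_I2)
qed

lemma L2_H1: "L2_H1_with_grad S G (\<lambda>z. mode_sum J A b \<kappa> (fst z) (snd z)) (\<lambda>z. mode_grad J A b \<kappa> (fst z) (snd z))"
  unfolding L2_H1_with_grad_def
proof (intro conjI)
  note Q = lmeasurable_cylinder[OF G, of S]
  show "(\<lambda>z. mode_sum J A b \<kappa> (fst z) (snd z)) \<in> L2 (cylinder S G)"
    using mode_sum_bound[of J b _ S A \<kappa>] b1
    by (intro bounded_in_L2[OF mode_sum_measurable Q, of _ _ _ _ "\<Sum>i\<in>J. \<bar>A i\<bar> * g_kernel (b i) S"])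
       (auto simp: cylinder_def less_imp_le)
  show "(\<lambda>z. mode_grad J A b \<kappa> (fst z) (snd z)) \<in> L2 (cylinder S G)"
    using mode_grad_bound[of J b _ S A \<kappa>] b1
    by (intro bounded_in_L2[OF mode_grad_measurable Q, of _ _ _ _ "\<Sum>i\<in>J. \<bar>A i\<bar> * g_kernel (b i) S * norm (\<kappa> i)"])
       (auto simp: cylinder_def less_imp_le)
  show "AE t in lebesgue_on {0<..<S}. H1_with_grad G (\<lambda>x. mode_sum J A b \<kappa> (fst (t, x)) (snd (t, x))) (\<lambda>x. mode_grad J A b \<kappa> (fst (t, x)) (snd (t, x)))"
    using mode_H1_with_grad[OF G J] by (intro AE_I2) (simp only: fst_conv snd_conv)
qed

lemma C_vanishing:
  "C_L2_vanishing_at 0 S G (time_conv (g_kernel (1 - \<alpha>)) (\<lambda>(s, x). mode_sum J A b \<kappa> s x))"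
proof -
  \<comment> \<open>The continuous representative in closed form, by the semigroup law. At t = 0 it
    vanishes because 0 \<open>powr\<close> anything is 0, and this is the correct limit since all
    exponents \<open>1 - \<alpha> + b i\<close> exceed 1.\<close>
  define W where "W = mode_sum J A (\<lambda>i. 1 - \<alpha> + b i) \<kappa>"
  have m: "W t \<in> borel_measurable borel" for t
    unfolding W_def mode_sum_def[abs_def] by measurable
  have WL: "W t \<in> L2 G" if "t \<in> {0..S}" for t
  proof (rule bounded_in_L2[OF m Gm])
    show "norm (W t x) \<le> (\<Sum>i\<in>J. \<bar>A i\<bar> * g_kernel (1 - \<alpha> + b i) S)" for x
      unfolding W_def real_norm_def using that \<alpha> b1 by (intro mode_sum_bound) (auto dest!: b1)
  qed
  have cont: "((\<lambda>s. L2_norm G (\<lambda>x. W s x - W t x)) \<longlongrightarrow> 0) (at t within {0..S})" if t: "t \<in> {0..S}" for t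
  proof -
    let ?d = "\<lambda>s. \<Sum>i\<in>J. \<bar>A i\<bar> * \<bar>g_kernel (1 - \<alpha> + b i) s - g_kernel (1 - \<alpha> + b i) t\<bar>"
    have "continuous_on {0..S} (\<lambda>s. ?d s * sqrt (measure lebesgue G))"
      using \<alpha> by (intro continuous_intros continuous_on_subset[OF g_kernel_continuous]) (auto dest!: b1)
    then have "((\<lambda>s. ?d s * sqrt (measure lebesgue G)) \<longlongrightarrow> ?d t * sqrt (measure lebesgue G)) (at t within {0..S})"
      using t unfolding continuous_on_def by blast
    moreover have "?d t = 0" by simp
    ultimately have lim0: "((\<lambda>s. ?d s * sqrt (measure lebesgue G)) \<longlongrightarrow> 0) (at t within {0..S})"
      by (simp only: mult_zero_left)
    have "norm (L2_norm G (\<lambda>x. W s x - W t x)) \<le> ?d s * sqrt (measure lebesgue G)" for s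
    proof -
      have "norm (W s x - W t x) \<le> ?d s" for x
      proof -
        have "W s x - W t x = (\<Sum>i\<in>J. A i * (g_kernel (1 - \<alpha> + b i) s - g_kernel (1 - \<alpha> + b i) t) * cos (\<kappa> i \<bullet> x))"
          by (simp add: W_def mode_sum_def sum_subtractf algebra_simps)
        then show ?thesis
          unfolding real_norm_def
          by (simp only:) (rule order_trans[OF sum_abs sum_mono], simp add: abs_mult mult_left_le)
      qed
      moreover have "(\<lambda>x. W s x - W t x) \<in> borel_measurable borel" by (intro borel_measurable_diff m)
      ultimately have "L2_norm G (\<lambda>x. W s x - W t x) \<le> ?d s * sqrt (measure lebesgue G)"
        by (intro L2_norm_bound Gm sum_nonneg) auto
      then show ?thesis by (simp add: L2_norm_def)
    qed
    then have "\<forall>\<^sub>F s in at t within {0..S}. norm (L2_norm G (\<lambda>x. W s x - W t x)) \<le> ?d s * sqrt (measure lebesgue G)"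
      by (rule always_eventually[OF allI])
    then show ?thesis using lim0 by (rule Lim_null_comparison)
  qed
  have "AE t in lebesgue_on {0<..<S}. AE x in lebesgue_on G. W t x = time_conv (g_kernel (1 - \<alpha>)) (\<lambda>(s, x). mode_sum J A b \<kappa> s x) (t, x)"
  proof (intro AE_I2)
    fix t x assume "t \<in> space (lebesgue_on {0<..<S})"
    then have "0 < t" by simp
    then show "W t x = time_conv (g_kernel (1 - \<alpha>)) (\<lambda>(s, x). mode_sum J A b \<kappa> s x) (t, x)"
      unfolding W_def using \<alpha> by (intro time_conv_mode_sum[symmetric] J) (auto dest!: b1)
  qed
  moreover have "W 0 x = 0" for x by (simp add: W_def mode_sum_def)
  ultimately show ?thesis
    unfolding C_L2_vanishing_at_def cont_rep_def using WL cont by (intro exI[of _ W]) auto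
qed

text \<open>One mode at a time. In time, the kernel of exponent \<open>1 - \<alpha> + b i\<close> is
  the primitive of the one of exponent \<open>b i - \<alpha>\<close>, so the derivative passes from
  \<zeta> to the kernel. In space, the eigenfunction identity is applied on almost every time slice.
  The integrability claims allow the finite sum to be taken out of the integral.\<close>

lemma mode_term_identity:
  assumes i: "i \<in> J" and \<zeta>: "nonneg_test_function S G \<zeta> \<zeta>t D\<zeta>"
  shows "(\<integral>z. \<zeta>t z * (g_kernel (1 - \<alpha> + b i) (fst z) * cos (\<kappa> i \<bullet> snd z)) \<partial>lebesgue_on (cylinder S G))
     = - (\<integral>z. \<zeta> z * (g_kernel (b i - \<alpha>) (fst z) * cos (\<kappa> i \<bullet> snd z)) \<partial>lebesgue_on (cylinder S G))"
    and "(\<integral>z. (g_kernel (b i) (fst z) *\<^sub>R (- (sin (\<kappa> i \<bullet> snd z) *\<^sub>R \<kappa> i))) \<bullet> D\<zeta> z \<partial>lebesgue_on (cylinder S G))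
     = (\<integral>z. \<zeta> z * ((norm (\<kappa> i))\<^sup>2 * g_kernel (b i) (fst z) * cos (\<kappa> i \<bullet> snd z)) \<partial>lebesgue_on (cylinder S G))"
    and "integrable (lebesgue_on (cylinder S G)) (\<lambda>z. \<zeta>t z * (g_kernel (1 - \<alpha> + b i) (fst z) * cos (\<kappa> i \<bullet> snd z)))"
    and "integrable (lebesgue_on (cylinder S G)) (\<lambda>z. \<zeta> z * (g_kernel (b i - \<alpha>) (fst z) * cos (\<kappa> i \<bullet> snd z)))"
    and "integrable (lebesgue_on (cylinder S G)) (\<lambda>z. (g_kernel (b i) (fst z) *\<^sub>R (- (sin (\<kappa> i \<bullet> snd z) *\<^sub>R \<kappa> i))) \<bullet> D\<zeta> z)"
    and "integrable (lebesgue_on (cylinder S G)) (\<lambda>z. \<zeta> z * ((norm (\<kappa> i))\<^sup>2 * g_kernel (b i) (fst z) * cos (\<kappa> i \<bullet> snd z)))"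
proof -
  note Q = lmeasurable_cylinder[OF G, of S]
  have bi: "1 \<le> b i - \<alpha>" "1 \<le> b i" "1 \<le> 1 - \<alpha> + b i" using b[OF i] \<alpha> by auto
  have L: "\<zeta> \<in> L2 (cylinder S G)" "\<zeta>t \<in> L2 (cylinder S G)" "D\<zeta> \<in> L2 (cylinder S G)"
    using \<zeta> by (auto simp: nonneg_test_function_def H1_L2_with_deriv_def L2_H1_zero_with_grad_def)
  have g: "\<bar>g_kernel c t\<bar> \<le> g_kernel c S" if "1 \<le> c" "t \<in> {0<..<S}" for c t
    using that g_kernel_mono[of c t S] g_kernel_nonneg[of c t] by auto
  have m: "(\<lambda>z::real \<times> (real^'n). g_kernel c (fst z) * cos (\<kappa> i \<bullet> snd z)) \<in> borel_measurable borel" for c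
    unfolding borel_prod[symmetric] by measurable
  have int: "integrable (lebesgue_on (cylinder S G)) (\<lambda>z. F z * (g_kernel c (fst z) * cos (\<kappa> i \<bullet> snd z)))"
    if F: "F \<in> L2 (cylinder S G)" and c: "1 \<le> c" for F c
  proof (rule integrable_L2_mult_bounded[OF F Q borel_measurable_lebesgue_on[OF m], where K="g_kernel c S"])
    fix z assume "z \<in> cylinder S G"
    then have "\<bar>g_kernel c (fst z)\<bar> \<le> g_kernel c S" using g[OF c] by (auto simp: cylinder_def)
    then show "\<bar>g_kernel c (fst z) * cos (\<kappa> i \<bullet> snd z)\<bar> \<le> g_kernel c S"
      using mult_mono[of "\<bar>g_kernel c (fst z)\<bar>" "g_kernel c S" "\<bar>cos (\<kappa> i \<bullet> snd z)\<bar>" 1] by (simp add: abs_mult)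
  qed
  show "integrable (lebesgue_on (cylinder S G)) (\<lambda>z. \<zeta>t z * (g_kernel (1 - \<alpha> + b i) (fst z) * cos (\<kappa> i \<bullet> snd z)))"
    by (rule int[OF L(2) bi(3)])
  show "integrable (lebesgue_on (cylinder S G)) (\<lambda>z. \<zeta> z * (g_kernel (b i - \<alpha>) (fst z) * cos (\<kappa> i \<bullet> snd z)))"
    by (rule int[OF L(1) bi(1)])
  have s: "integrable (lebesgue_on (cylinder S G)) (\<lambda>z. (norm (\<kappa> i))\<^sup>2 * (\<zeta> z * (g_kernel (b i) (fst z) * cos (\<kappa> i \<bullet> snd z))))"
    by (intro integrable_mult_right int L bi)
  then show s': "integrable (lebesgue_on (cylinder S G)) (\<lambda>z. \<zeta> z * ((norm (\<kappa> i))\<^sup>2 * g_kernel (b i) (fst z) * cos (\<kappa> i \<bullet> snd z)))"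
    by (simp only: mult_ac)
  have gradL: "(\<lambda>z. g_kernel (b i) (fst z) *\<^sub>R (- (sin (\<kappa> i \<bullet> snd z) *\<^sub>R \<kappa> i))) \<in> L2 (cylinder S G)"
  proof (rule bounded_in_L2[OF _ Q, of _ "g_kernel (b i) S * norm (\<kappa> i)"])
    show "(\<lambda>z. g_kernel (b i) (fst z) *\<^sub>R (- (sin (\<kappa> i \<bullet> snd z) *\<^sub>R \<kappa> i))) \<in> borel_measurable borel"
      unfolding borel_prod[symmetric] by measurable
    fix z assume "z \<in> cylinder S G"
    then have "\<bar>g_kernel (b i) (fst z)\<bar> \<le> g_kernel (b i) S" using g[OF bi(2)] by (auto simp: cylinder_def)
    then have "\<bar>g_kernel (b i) (fst z)\<bar> * (\<bar>sin (\<kappa> i \<bullet> snd z)\<bar> * norm (\<kappa> i)) \<le> g_kernel (b i) S * (1 * norm (\<kappa> i))"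
      by (intro mult_mono) auto
    then show "norm (g_kernel (b i) (fst z) *\<^sub>R (- (sin (\<kappa> i \<bullet> snd z) *\<^sub>R \<kappa> i))) \<le> g_kernel (b i) S * norm (\<kappa> i)"
      by (simp add: abs_mult)
  qed
  show gi: "integrable (lebesgue_on (cylinder S G)) (\<lambda>z. (g_kernel (b i) (fst z) *\<^sub>R (- (sin (\<kappa> i \<bullet> snd z) *\<^sub>R \<kappa> i))) \<bullet> D\<zeta> z)"
    by (rule L2_inner_integrable[OF gradL L(3)])
  show "(\<integral>z. \<zeta>t z * (g_kernel (1 - \<alpha> + b i) (fst z) * cos (\<kappa> i \<bullet> snd z)) \<partial>lebesgue_on (cylinder S G))
     = - (\<integral>z. \<zeta> z * (g_kernel (b i - \<alpha>) (fst z) * cos (\<kappa> i \<bullet> snd z)) \<partial>lebesgue_on (cylinder S G))"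
  proof (rule weak_time_identity[OF S G, where M="max (g_kernel (b i - \<alpha>) S) (g_kernel (1 - \<alpha> + b i) S)"])
    show "H1_L2_with_deriv S G \<zeta> \<zeta>t" "C_L2_vanishing_at S S G \<zeta>" using \<zeta> by (auto simp: nonneg_test_function_def)
    fix s assume "s \<in> {0<..<S}"
    then show "g_kernel (1 - \<alpha> + b i) s = (\<integral>t. indicator {0<..<s} t * g_kernel (b i - \<alpha>) t \<partial>lborel)"
      using has_bochner_integral_integral_eq[OF has_bochner_integral_g_kernel[of "b i - \<alpha>" s]] bi
      by (simp add: algebra_simps)
  qed (use g[OF bi(1)] g[OF bi(3)] in \<open>auto simp: le_max_iff_disj\<close>)
  show "(\<integral>z. (g_kernel (b i) (fst z) *\<^sub>R (- (sin (\<kappa> i \<bullet> snd z) *\<^sub>R \<kappa> i))) \<bullet> D\<zeta> z \<partial>lebesgue_on (cylinder S G))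
     = (\<integral>z. \<zeta> z * ((norm (\<kappa> i))\<^sup>2 * g_kernel (b i) (fst z) * cos (\<kappa> i \<bullet> snd z)) \<partial>lebesgue_on (cylinder S G))"
    unfolding integral_cylinder_fst[OF G(1) gi, symmetric] integral_cylinder_fst[OF G(1) s', symmetric]
  proof (rule integral_cong_AE)
    show "(\<lambda>t. \<integral>x. (g_kernel (b i) (fst (t, x)) *\<^sub>R (- (sin (\<kappa> i \<bullet> snd (t, x)) *\<^sub>R \<kappa> i))) \<bullet> D\<zeta> (t, x) \<partial>lebesgue_on G) \<in> borel_measurable (lebesgue_on {0<..<S})"
      by (rule borel_measurable_integrable[OF integrable_cylinder_fst[OF G(1) gi]])
    show "(\<lambda>t. \<integral>x. \<zeta> (t, x) * ((norm (\<kappa> i))\<^sup>2 * g_kernel (b i) (fst (t, x)) * cos (\<kappa> i \<bullet> snd (t, x))) \<partial>lebesgue_on G) \<in> borel_measurable (lebesgue_on {0<..<S})"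
      by (rule borel_measurable_integrable[OF integrable_cylinder_fst[OF G(1) s']])
    have "AE t in lebesgue_on {0<..<S}. H1_zero_with_grad G (\<lambda>x. \<zeta> (t, x)) (\<lambda>x. D\<zeta> (t, x))"
      using \<zeta> by (auto simp: nonneg_test_function_def L2_H1_zero_with_grad_def)
    then show "AE t in lebesgue_on {0<..<S}.
        (\<integral>x. (g_kernel (b i) (fst (t, x)) *\<^sub>R (- (sin (\<kappa> i \<bullet> snd (t, x)) *\<^sub>R \<kappa> i))) \<bullet> D\<zeta> (t, x) \<partial>lebesgue_on G)
      = (\<integral>x. \<zeta> (t, x) * ((norm (\<kappa> i))\<^sup>2 * g_kernel (b i) (fst (t, x)) * cos (\<kappa> i \<bullet> snd (t, x))) \<partial>lebesgue_on G)"
    proof eventually_elim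
      case (elim t)
      have "(\<integral>x. (g_kernel (b i) t *\<^sub>R (- (sin (\<kappa> i \<bullet> x) *\<^sub>R \<kappa> i))) \<bullet> D\<zeta> (t, x) \<partial>lebesgue_on G)
        = g_kernel (b i) t * (\<integral>x. (- (sin (\<kappa> i \<bullet> x) *\<^sub>R \<kappa> i)) \<bullet> D\<zeta> (t, x) \<partial>lebesgue_on G)"
        unfolding inner_scaleR_left by (rule integral_mult_right_zero)
      also have "\<dots> = g_kernel (b i) t * ((norm (\<kappa> i))\<^sup>2 * (\<integral>x. \<zeta> (t, x) * cos (\<kappa> i \<bullet> x) \<partial>lebesgue_on G))"
        unfolding H1_zero_cos_identity[OF G elim] ..
      also have "\<dots> = (\<integral>x. (g_kernel (b i) t * (norm (\<kappa> i))\<^sup>2) * (\<zeta> (t, x) * cos (\<kappa> i \<bullet> x)) \<partial>lebesgue_on G)"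
        unfolding mult.assoc[symmetric] by (simp only: integral_mult_right_zero mult.assoc)
      finally show ?case by (simp only: fst_conv snd_conv mult_ac)
    qed
  qed
qed

text \<open>Summed over the modes, the weak form equals the integral of \<zeta> times the classical
  source, so the sign of the source decides.\<close>

theorem weak_supersolution_mode_sum:
  assumes f: "\<And>t x. t \<in> {0<..<S} \<Longrightarrow> x \<in> G \<Longrightarrow> 0 \<le> mode_source \<alpha> J A b \<kappa> t x"
  shows "weak_supersolution \<alpha> S G (\<lambda>_. mat 1) (\<lambda>_. 0) (\<lambda>(t, x). mode_sum J A b \<kappa> t x)"
proof -
  note Q = lmeasurable_cylinder[OF G, of S]
  let ?u = "\<lambda>(t, x). mode_sum J A b \<kappa> t x" and ?Du = "\<lambda>z. mode_grad J A b \<kappa> (fst z) (snd z)"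
  have u: "?u = (\<lambda>z. mode_sum J A b \<kappa> (fst z) (snd z))" by (simp add: case_prod_beta')
  have "?u \<in> Z_space \<alpha> S G"
    unfolding Z_space_def mem_Collect_eq
    using weak_Lq[of "2 / (1 - \<alpha>)"] L2_H1 C_vanishing \<alpha> unfolding u by auto
  moreover have "0 \<le> (\<integral>z. - \<zeta>t z * time_conv (g_kernel (1 - \<alpha>)) (\<lambda>(s, x). ?u (s, x) - 0) z
               + (mat 1 *v ?Du z) \<bullet> D\<zeta> z \<partial>lebesgue_on (cylinder S G))"
    if \<zeta>: "nonneg_test_function S G \<zeta> \<zeta>t D\<zeta>" for \<zeta> \<zeta>t D\<zeta>
  proof -
    note ids = mode_term_identity[OF _ \<zeta>]
    let ?a = "\<lambda>i z. \<zeta>t z * (g_kernel (1 - \<alpha> + b i) (fst z) * cos (\<kappa> i \<bullet> snd z))"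
    let ?c = "\<lambda>i z. (g_kernel (b i) (fst z) *\<^sub>R (- (sin (\<kappa> i \<bullet> snd z) *\<^sub>R \<kappa> i))) \<bullet> D\<zeta> z"
    let ?p = "\<lambda>i z. \<zeta> z * (g_kernel (b i - \<alpha>) (fst z) * cos (\<kappa> i \<bullet> snd z))"
    let ?q = "\<lambda>i z. \<zeta> z * ((norm (\<kappa> i))\<^sup>2 * g_kernel (b i) (fst z) * cos (\<kappa> i \<bullet> snd z))"
    have "(\<integral>z. - \<zeta>t z * time_conv (g_kernel (1 - \<alpha>)) (\<lambda>(s, x). ?u (s, x) - 0) z
               + (mat 1 *v ?Du z) \<bullet> D\<zeta> z \<partial>lebesgue_on (cylinder S G))
      = (\<integral>z. (\<Sum>i\<in>J. A i * (?c i z - ?a i z)) \<partial>lebesgue_on (cylinder S G))"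
    proof (rule Bochner_Integration.integral_cong[OF refl])
      fix z assume "z \<in> space (lebesgue_on (cylinder S G))"
      then obtain t x where z: "z = (t, x)" "0 < t" by (auto simp: cylinder_def)
      have "time_conv (g_kernel (1 - \<alpha>)) (\<lambda>(s, x). ?u (s, x) - 0) z = mode_sum J A (\<lambda>i. 1 - \<alpha> + b i) \<kappa> t x"
        using time_conv_mode_sum[of J b "1 - \<alpha>" t A \<kappa> x] J \<alpha> z b1 by (simp add: less_imp_le less_trans[OF zero_less_one])
      then show "- \<zeta>t z * time_conv (g_kernel (1 - \<alpha>)) (\<lambda>(s, x). ?u (s, x) - 0) z + (mat 1 *v ?Du z) \<bullet> D\<zeta> z
         = (\<Sum>i\<in>J. A i * (?c i z - ?a i z))"
        unfolding z(1)
        by (simp add: mode_sum_def mode_grad_def inner_sum_left sum_subtractf sum_distrib_left right_diff_distrib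
            sum_negf mult_ac del: inner_minus_left scaleR_minus_right)
    qed
    also have "\<dots> = (\<Sum>i\<in>J. A i * ((\<integral>z. ?c i z \<partial>lebesgue_on (cylinder S G)) - (\<integral>z. ?a i z \<partial>lebesgue_on (cylinder S G))))"
      using ids(3,5) by (simp add: Bochner_Integration.integral_sum del: inner_scaleR_left inner_minus_left scaleR_minus_right)
    also have "\<dots> = (\<Sum>i\<in>J. A i * ((\<integral>z. ?q i z \<partial>lebesgue_on (cylinder S G)) + (\<integral>z. ?p i z \<partial>lebesgue_on (cylinder S G))))"
      by (intro sum.cong refl) (simp only: ids(1,2) diff_minus_eq_add)
    also have "\<dots> = (\<integral>z. (\<Sum>i\<in>J. A i * (?q i z + ?p i z)) \<partial>lebesgue_on (cylinder S G))"
      using ids(4,6) by (simp add: Bochner_Integration.integral_sum)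
    also have "0 \<le> \<dots>"
    proof (rule integral_nonneg_AE)
      have "AE z in lebesgue_on (cylinder S G). \<zeta> z \<ge> 0" using \<zeta> by (auto simp: nonneg_test_function_def)
      moreover have "AE z in lebesgue_on (cylinder S G). z \<in> cylinder S G"
        using Q by (intro AE_I2) auto
      ultimately show "AE z in lebesgue_on (cylinder S G). 0 \<le> (\<Sum>i\<in>J. A i * (?q i z + ?p i z))"
      proof eventually_elim
        case (elim z)
        have "(\<Sum>i\<in>J. A i * (?q i z + ?p i z)) = \<zeta> z * mode_source \<alpha> J A b \<kappa> (fst z) (snd z)"
          by (simp add: mode_source_def sum_distrib_left algebra_simps)
        then show ?case using elim f[of "fst z" "snd z"] by (auto simp: cylinder_def)
      qed
    qed
    finally show ?thesis .
  qed
  ultimately show ?thesis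
    unfolding weak_supersolution_def using L2_H1 unfolding u by blast
qed

end

section \<open>The maximum principle\<close>

text \<open>Subtract the nearest multiple of 2 pi in each coordinate. The point is chosen before the
  frequency, so a single point serves all modes of a sum.\<close>

lemma cos_reduce_to_cell:
  fixes x :: "real ^ 'n"
  obtains x' where "x' \<in> cbox (- (\<chi> i. pi)) (\<chi> i. pi)"
    "\<And>\<kappa> :: real ^ 'n. (\<And>j. \<kappa> $ j \<in> \<int>) \<Longrightarrow> cos (\<kappa> \<bullet> x') = cos (\<kappa> \<bullet> x)"
proof
  define n where "n j = round (x $ j / (2 * pi))" for j
  define x' where "x' = (\<chi> j. x $ j - 2 * pi * of_int (n j))"
  show "x' \<in> cbox (- (\<chi> i. pi)) (\<chi> i. pi)"
  proof (subst mem_box_cart, intro allI)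
    fix j
    have "\<bar>of_int (n j) - x $ j / (2 * pi)\<bar> \<le> 1/2"
      unfolding n_def by (rule of_int_round_abs_le)
    then have "(2 * pi) * \<bar>of_int (n j) - x $ j / (2 * pi)\<bar> \<le> (2 * pi) * (1/2)"
      by (intro mult_left_mono) auto
    moreover have "(2 * pi) * \<bar>of_int (n j) - x $ j / (2 * pi)\<bar> = \<bar>2 * pi * (of_int (n j) - x $ j / (2 * pi))\<bar>"
      by (simp add: abs_mult)
    moreover have "2 * pi * (of_int (n j) - x $ j / (2 * pi)) = - (x' $ j)"
      by (simp add: x'_def field_simps)
    ultimately have "\<bar>x' $ j\<bar> \<le> pi" by simp
    then show "(- (\<chi> i. pi)) $ j \<le> x' $ j \<and> x' $ j \<le> (\<chi> i. pi) $ j" by auto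
  qed
  fix \<kappa> :: "real ^ 'n" assume \<kappa>: "\<And>j. \<kappa> $ j \<in> \<int>"
  have "(\<Sum>j\<in>UNIV. \<kappa> $ j * of_int (n j)) \<in> \<int>"
    using \<kappa> by (intro Ints_sum Ints_mult) auto
  then obtain m :: int where m: "(\<Sum>j\<in>UNIV. \<kappa> $ j * of_int (n j)) = of_int m" by (auto elim: Ints_cases)
  have "\<kappa> \<bullet> x' = \<kappa> \<bullet> x - 2 * pi * (\<Sum>j\<in>UNIV. \<kappa> $ j * of_int (n j))"
    by (simp add: inner_vec_def x'_def right_diff_distrib sum_subtractf sum_distrib_left mult_ac)
  then show "cos (\<kappa> \<bullet> x') = cos (\<kappa> \<bullet> x)"
    by (simp add: m cos_diff cos_int_2pin sin_int_2pin)
qed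

text \<open>Compare the convolutions of \<open>g\<^bsub>1-\<alpha>\<^esub>\<close> with \<open>u - u t\<close> at the times \<open>t\<close> and \<open>t - h\<close>: the kernel
  decreases, so the contribution of times before \<open>t - h\<close> does not grow, and that of \<open>(t - h, t)\<close> is
  at most \<open>L h g\<^bsub>2-\<alpha>\<^esub>(h) = o(h)\<close>.\<close>

lemma fractional_derivative_at_minimum:
  fixes u W :: "real \<Rightarrow> real"
  assumes \<alpha>: "0 < \<alpha>" "\<alpha> < 1" and t: "0 < t"
    and W: "\<And>r. 0 < r \<Longrightarrow> r \<le> t \<Longrightarrow>
        has_bochner_integral lborel (\<lambda>s. indicator {0<..<r} s * (g_kernel (1 - \<alpha>) (r - s) * u s)) (W r)"
    and dW: "(W has_real_derivative D) (at t)" and du: "(u has_real_derivative D') (at t)"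
    and min: "\<And>s. 0 \<le> s \<Longrightarrow> s \<le> t \<Longrightarrow> u t \<le> u s"
  shows "D \<le> u t * g_kernel (1 - \<alpha>) t"
proof -
  define m where "m = u t"
  \<comment> \<open>As g_{1-\<alpha>} * 1 = g_{2-\<alpha>}, \<open>V\<close> is the convolution of
    the kernel with u - u t, a function that is nonnegative up to time t.\<close>
  define V where "V r = W r - m * g_kernel (2 - \<alpha>) r" for r
  have V: "has_bochner_integral lborel (\<lambda>s. indicator {0<..<r} s * (g_kernel (1 - \<alpha>) (r - s) * (u s - m))) (V r)"
    if r: "0 < r" "r \<le> t" for r
  proof -
    have "has_bochner_integral lborel (\<lambda>s. indicator {0<..<r} s * (g_kernel (1 - \<alpha>) (r - s) * g_kernel 1 s)) (g_kernel (1 - \<alpha> + 1) r)"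
      using \<alpha> r by (intro has_bochner_integral_g_kernel_conv) auto
    then have "has_bochner_integral lborel (\<lambda>s. m * (indicator {0<..<r} s * (g_kernel (1 - \<alpha>) (r - s) * g_kernel 1 s))) (m * g_kernel (2 - \<alpha>) r)"
      by (intro has_bochner_integral_mult_right) (simp add: add.commute)
    from has_bochner_integral_diff[OF W[OF r] this]
    have "has_bochner_integral lborel (\<lambda>s. indicator {0<..<r} s * (g_kernel (1 - \<alpha>) (r - s) * u s)
        - m * (indicator {0<..<r} s * (g_kernel (1 - \<alpha>) (r - s) * g_kernel 1 s))) (V r)" by (simp add: V_def)
    also have "(\<lambda>s. indicator {0<..<r} s * (g_kernel (1 - \<alpha>) (r - s) * u s)
        - m * (indicator {0<..<r} s * (g_kernel (1 - \<alpha>) (r - s) * g_kernel 1 s)))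
       = (\<lambda>s. indicator {0<..<r} s * (g_kernel (1 - \<alpha>) (r - s) * (u s - m)))"
      by (auto simp: fun_eq_iff indicator_def algebra_simps)
    finally show ?thesis .
  qed
  have dV: "(V has_real_derivative D - m * g_kernel (1 - \<alpha>) t) (at t)"
    unfolding V_def[abs_def]
    using g_kernel_has_derivative[of "2 - \<alpha>" t] \<alpha> t by (intro DERIV_diff dW DERIV_cmult) auto
  \<comment> \<open>A bound for the difference quotients of u close to t; on (t - h, t) it gives u -
    u t \<le> L h. The summand 1 makes the bound strict.\<close>
  define L where "L = \<bar>D'\<bar> + 1"
  have "((\<lambda>s. (u s - u t) / (s - t)) \<longlongrightarrow> D') (at t)"
    using du by (simp add: has_field_derivative_iff)
  then have "eventually (\<lambda>s. \<bar>(u s - u t) / (s - t)\<bar> < L) (at t)"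
    by (intro order_tendstoD(2)[OF tendsto_rabs]) (auto simp: L_def)
  then obtain d where d: "d > 0" "\<And>s. s \<noteq> t \<Longrightarrow> dist s t < d \<Longrightarrow> \<bar>(u s - u t) / (s - t)\<bar> < L"
    by (auto simp: eventually_at)
  have Lip: "u s - m \<le> L * h" if "0 < h" "h < d" "t - h < s" "s < t" for h s
  proof -
    have "\<bar>(u s - u t) / (s - t)\<bar> < L" using that by (intro d) (auto simp: dist_real_def)
    then have "\<bar>u s - u t\<bar> < L * \<bar>s - t\<bar>" using that by (simp add: abs_divide divide_less_eq)
    also have "L * \<bar>s - t\<bar> \<le> L * h" using that by (intro mult_left_mono) (auto simp: L_def)
    finally show ?thesis by (simp add: m_def)
  qed
  have diff: "(V t - V (t - h)) / h \<le> L * g_kernel (2 - \<alpha>) h" if h: "0 < h" "h < d" "h < t" for h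
  proof -
    have "has_bochner_integral lborel (\<lambda>s. indicator {0<..<h} s * g_kernel (1 - \<alpha>) s) (g_kernel (1 - \<alpha> + 1) h)"
      using \<alpha> h by (intro has_bochner_integral_g_kernel) auto
    then have "has_bochner_integral lborel (\<lambda>s. indicator {0<..<h} (t + (-1) * s) * g_kernel (1 - \<alpha>) (t + (-1) * s)) (g_kernel (2 - \<alpha>) h)"
      by (subst (asm) lborel_has_bochner_integral_real_affine_iff[where c="-1" and t=t]) (auto simp: add.commute)
    then have R: "has_bochner_integral lborel (\<lambda>s. (L * h) * (indicator {t-h<..<t} s * g_kernel (1 - \<alpha>) (t - s))) ((L * h) * g_kernel (2 - \<alpha>) h)"
      by (intro has_bochner_integral_mult_right) (simp add: indicator_def conj_commute less_diff_eq diff_less_eq add.commute)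
    have I1: "has_bochner_integral lborel (\<lambda>s. indicator {0<..<t} s * (g_kernel (1 - \<alpha>) (t - s) * (u s - m))) (V t)"
      using V[of t] t by simp
    have I2: "has_bochner_integral lborel (\<lambda>s. indicator {0<..<t-h} s * (g_kernel (1 - \<alpha>) (t - h - s) * (u s - m))
        + (L * h) * (indicator {t-h<..<t} s * g_kernel (1 - \<alpha>) (t - s))) (V (t - h) + (L * h) * g_kernel (2 - \<alpha>) h)"
      using V[of "t - h"] h by (intro has_bochner_integral_add R) auto
    have "V t \<le> V (t - h) + (L * h) * g_kernel (2 - \<alpha>) h"
      unfolding has_bochner_integral_integral_eq[OF I1, symmetric] has_bochner_integral_integral_eq[OF I2, symmetric]
    proof (rule integral_mono_AE)
      show "AE s in lborel. indicator {0<..<t} s * (g_kernel (1 - \<alpha>) (t - s) * (u s - m))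
         \<le> indicator {0<..<t-h} s * (g_kernel (1 - \<alpha>) (t - h - s) * (u s - m))
        + (L * h) * (indicator {t-h<..<t} s * g_kernel (1 - \<alpha>) (t - s))"
        using AE_lborel_singleton[of "t - h"]
      proof eventually_elim
        case (elim s)
        consider "s \<notin> {0<..<t}" | "0 < s" "s < t - h" | "t - h < s" "s < t" "0 < s" using elim by fastforce
        then show ?case
        proof cases
          case 1
          then show ?thesis using h \<alpha> by (auto simp: indicator_def L_def intro!: mult_nonneg_nonneg g_kernel_nonneg)
        next
          case 2
          have "g_kernel (1 - \<alpha>) (t - s) * (u s - m) \<le> g_kernel (1 - \<alpha>) (t - h - s) * (u s - m)"
            using 2 h \<alpha> min[of s] by (intro mult_right_mono g_kernel_antimono) (auto simp: m_def)
          then show ?thesis using 2 h by (auto simp: indicator_def)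
        next
          case 3
          have "g_kernel (1 - \<alpha>) (t - s) * (u s - m) \<le> g_kernel (1 - \<alpha>) (t - s) * (L * h)"
            using 3 h \<alpha> by (intro mult_left_mono Lip g_kernel_nonneg) auto
          then show ?thesis using 3 h by (auto simp: indicator_def mult.commute)
        qed
      qed
    qed (use I1 I2 in \<open>auto simp: has_bochner_integral_iff\<close>)
    then show ?thesis using h by (simp add: field_simps)
  qed
  have "((\<lambda>k. - V (t - k)) has_real_derivative D - m * g_kernel (1 - \<alpha>) t) (at 0)"
  proof -
    have "((\<lambda>k. V (t - k)) has_real_derivative (D - m * g_kernel (1 - \<alpha>) t) * (-1)) (at 0)"
      by (rule DERIV_chain2[where g="\<lambda>k. t - k"]) (auto simp: dV intro!: derivative_eq_intros)
    from DERIV_minus[OF this] show ?thesis by simp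
  qed
  then have "((\<lambda>k. (V t - V (t - k)) / k) \<longlongrightarrow> D - m * g_kernel (1 - \<alpha>) t) (at 0)"
    by (simp add: has_field_derivative_iff)
  then have lim: "((\<lambda>k. (V t - V (t - k)) / k) \<longlongrightarrow> D - m * g_kernel (1 - \<alpha>) t) (at_right 0)"
    by (simp add: filterlim_at_split)
  \<comment> \<open>Since 2 - \<alpha> > 1, this kernel is continuous at 0 with value 0, so the
    upper bound for the left difference quotients of \<open>V\<close> tends to 0.\<close>
  have "continuous (at 0 within {0..}) (g_kernel (2 - \<alpha>))"
    using g_kernel_continuous[of "2 - \<alpha>"] \<alpha> by (simp add: continuous_on_eq_continuous_within)
  then have "(g_kernel (2 - \<alpha>) \<longlongrightarrow> g_kernel (2 - \<alpha>) 0) (at_right 0)"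
    by (auto simp: continuous_within intro: tendsto_within_subset)
  then have "((\<lambda>k. L * g_kernel (2 - \<alpha>) k) \<longlongrightarrow> L * g_kernel (2 - \<alpha>) 0) (at_right 0)"
    by (rule tendsto_mult_left)
  moreover have "eventually (\<lambda>k. (V t - V (t - k)) / k \<le> L * g_kernel (2 - \<alpha>) k) (at_right 0)"
  proof -
    have "eventually (\<lambda>k. k \<in> {0<..<min d t}) (at_right 0)"
      using d t by (intro eventually_at_right_real) auto
    then show ?thesis by eventually_elim (auto intro: diff)
  qed
  ultimately have "D - m * g_kernel (1 - \<alpha>) t \<le> L * g_kernel (2 - \<alpha>) 0"
    using lim by (intro tendsto_le[of "at_right 0"]) auto
  then show ?thesis by (simp add: m_def)
qed

lemma cos_second_difference_tendsto:
  "((\<lambda>s. 2 * (cos (s * k) - 1) / s\<^sup>2) \<longlongrightarrow> - (k\<^sup>2)) (at_right (0::real))"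
proof (cases "k = 0")
  case False
  then have "((\<lambda>s. 2 * (cos (s * k) - 1) / s\<^sup>2) \<longlongrightarrow> - (k * k)) (at_right (0::real))" by real_asymp
  then show ?thesis by (simp only: power2_eq_square)
qed simp

text \<open>By periodicity the minimum over [0,S] and one cell is a minimum over the whole space, so
  no spatial boundary interferes. A negative minimum occurs at a positive time; there the negative
  Laplacian is at most 0 and the fractional derivative is at most u g_{1-\<alpha>} < 0, so the
  source would be negative. The strict sign comes from the kernel factor, hence a source that is
  merely nonnegative suffices.\<close>

lemma mode_sum_nonneg:
  fixes \<kappa> :: "'i \<Rightarrow> real ^ 'n"
  assumes \<alpha>: "0 < \<alpha>" "\<alpha> < 1" and J: "finite J" and b: "\<And>i. i \<in> J \<Longrightarrow> 1 + \<alpha> \<le> b i"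
    and \<kappa>: "\<And>i j. i \<in> J \<Longrightarrow> \<kappa> i $ j \<in> \<int>"
    and f: "\<And>t x. 0 < t \<Longrightarrow> t \<le> S \<Longrightarrow> 0 \<le> mode_source \<alpha> J A b \<kappa> t x"
    and t: "0 \<le> t" "t \<le> S"
  shows "0 \<le> mode_sum J A b \<kappa> t x"
proof (rule ccontr)
  assume neg: "\<not> 0 \<le> mode_sum J A b \<kappa> t x"
  have b1: "1 < b i" if "i \<in> J" for i using b[OF that] \<alpha> by linarith
  let ?u = "mode_sum J A b \<kappa>"
  let ?C = "cbox (- (\<chi> i. pi)) (\<chi> i. pi) :: (real ^ 'n) set"
  have red: "\<exists>x'\<in>?C. \<forall>s. ?u s x' = ?u s x" for x
  proof -
    obtain x' where "x' \<in> ?C" "\<And>\<kappa> :: real ^ 'n. (\<And>j. \<kappa> $ j \<in> \<int>) \<Longrightarrow> cos (\<kappa> \<bullet> x') = cos (\<kappa> \<bullet> x)"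
      using cos_reduce_to_cell[of x] by blast
    then show ?thesis using \<kappa> by (intro bexI[of _ x']) (auto simp: mode_sum_def intro!: sum.cong)
  qed
  have "compact ({0..S} \<times> ?C)" by (intro compact_Times) auto
  moreover have "{0..S} \<times> ?C \<noteq> {}" using t red[of x] by auto
  moreover have "continuous_on ({0..S} \<times> ?C) (\<lambda>z. ?u (fst z) (snd z))"
    by (rule continuous_on_subset[OF mode_sum_continuous[OF b1]]) auto
  ultimately have "\<exists>z\<in>{0..S} \<times> ?C. \<forall>z'\<in>{0..S} \<times> ?C. ?u (fst z) (snd z) \<le> ?u (fst z') (snd z')"
    by (rule continuous_attains_inf)
  then obtain z where z: "z \<in> {0..S} \<times> ?C" "\<And>z'. z' \<in> {0..S} \<times> ?C \<Longrightarrow> ?u (fst z) (snd z) \<le> ?u (fst z') (snd z')"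
    by blast
  define t0 x0 where "t0 = fst z" and "x0 = snd z"
  have t0: "0 \<le> t0" "t0 \<le> S" using z by (auto simp: t0_def)
  have min: "?u t0 x0 \<le> ?u s y" if "0 \<le> s" "s \<le> S" for s y
  proof -
    obtain y' where "y' \<in> ?C" "?u s y' = ?u s y" using red[of y] by blast
    then show ?thesis using z(2)[of "(s, y')"] that by (auto simp: t0_def x0_def)
  qed
  have m: "?u t0 x0 < 0" using min[OF t] neg by (meson not_le order.strict_trans1)
  have "t0 \<noteq> 0" using m by (auto simp: mode_sum_def)
  then have t0p: "0 < t0" using t0 by simp
  \<comment> \<open>Second differences in direction j are nonnegative at the minimum; divided by s^2
    they tend to the second derivative, which multiplies each mode by -(\<kappa>_j)^2.\<close>
  have space: "(\<Sum>i\<in>J. A i * g_kernel (b i) t0 * cos (\<kappa> i \<bullet> x0) * (\<kappa> i $ j)\<^sup>2) \<le> 0" for j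
  proof -
    let ?q = "\<lambda>s. \<Sum>i\<in>J. A i * g_kernel (b i) t0 * cos (\<kappa> i \<bullet> x0) * (2 * (cos (s * \<kappa> i $ j) - 1) / s\<^sup>2)"
    have "(?q \<longlongrightarrow> (\<Sum>i\<in>J. A i * g_kernel (b i) t0 * cos (\<kappa> i \<bullet> x0) * (- (\<kappa> i $ j)\<^sup>2))) (at_right 0)"
      by (intro tendsto_intros cos_second_difference_tendsto)
    moreover have "0 \<le> ?q s" if "s > 0" for s
    proof -
      have "?u t0 (x0 + s *\<^sub>R axis j 1) + ?u t0 (x0 - s *\<^sub>R axis j 1) - 2 * ?u t0 x0
         = (\<Sum>i\<in>J. A i * g_kernel (b i) t0 * cos (\<kappa> i \<bullet> x0) * (2 * (cos (s * \<kappa> i $ j) - 1)))"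
        by (simp add: mode_sum_def inner_add_right inner_diff_right inner_axis cos_add cos_diff
            sum_distrib_left sum.distrib[symmetric] sum_subtractf[symmetric] algebra_simps)
      moreover have "0 \<le> ?u t0 (x0 + s *\<^sub>R axis j 1) + ?u t0 (x0 - s *\<^sub>R axis j 1) - 2 * ?u t0 x0"
        using min[OF t0, of "x0 + s *\<^sub>R axis j 1"] min[OF t0, of "x0 - s *\<^sub>R axis j 1"] by linarith
      ultimately have "0 \<le> (\<Sum>i\<in>J. A i * g_kernel (b i) t0 * cos (\<kappa> i \<bullet> x0) * (2 * (cos (s * \<kappa> i $ j) - 1))) / s\<^sup>2"
        by simp
      then show ?thesis by (simp add: sum_divide_distrib)
    qed
    then have "eventually (\<lambda>s. 0 \<le> ?q s) (at_right 0)"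
      by (auto simp: eventually_at_right_field intro: exI[of _ 1])
    ultimately have "0 \<le> (\<Sum>i\<in>J. A i * g_kernel (b i) t0 * cos (\<kappa> i \<bullet> x0) * (- (\<kappa> i $ j)\<^sup>2))"
      by (intro tendsto_lowerbound[of ?q _ "at_right 0"]) auto
    then show ?thesis by (simp add: sum_negf)
  qed
  have "(\<Sum>j\<in>UNIV. (\<Sum>i\<in>J. A i * g_kernel (b i) t0 * cos (\<kappa> i \<bullet> x0) * (\<kappa> i $ j)\<^sup>2)) \<le> 0"
    by (intro sum_nonpos space)
  also have "(\<Sum>j\<in>UNIV. (\<Sum>i\<in>J. A i * g_kernel (b i) t0 * cos (\<kappa> i \<bullet> x0) * (\<kappa> i $ j)\<^sup>2))
     = (\<Sum>i\<in>J. A i * g_kernel (b i) t0 * cos (\<kappa> i \<bullet> x0) * (norm (\<kappa> i))\<^sup>2)"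
  proof -
    have "(norm (\<kappa> i))\<^sup>2 = (\<Sum>j\<in>UNIV. (\<kappa> i $ j)\<^sup>2)" for i
      unfolding power2_norm_eq_inner inner_vec_def by (simp add: power2_eq_square)
    then show ?thesis by (subst sum.swap) (simp only: sum_distrib_left)
  qed
  finally have lap: "(\<Sum>i\<in>J. A i * g_kernel (b i) t0 * cos (\<kappa> i \<bullet> x0) * (norm (\<kappa> i))\<^sup>2) \<le> 0" .
  have "(\<Sum>i\<in>J. A i * cos (\<kappa> i \<bullet> x0) * g_kernel (b i - \<alpha>) t0) \<le> ?u t0 x0 * g_kernel (1 - \<alpha>) t0"
  proof (rule fractional_derivative_at_minimum[OF \<alpha> t0p])
    show "has_bochner_integral lborel (\<lambda>s. indicator {0<..<r} s * (g_kernel (1 - \<alpha>) (r - s) * ?u s x0)) (mode_sum J A (\<lambda>i. 1 - \<alpha> + b i) \<kappa> r x0)"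
      if "0 < r" for r
      using that \<alpha> b1 by (intro has_bochner_integral_mode_conv J) (auto dest!: b1)
    have "((\<lambda>r. \<Sum>i\<in>J. A i * cos (\<kappa> i \<bullet> x0) * g_kernel (1 - \<alpha> + b i) r) has_real_derivative (\<Sum>i\<in>J. A i * cos (\<kappa> i \<bullet> x0) * g_kernel (b i - \<alpha>) t0)) (at t0)"
    proof (intro DERIV_sum DERIV_cmult)
      fix i assume "i \<in> J"
      then have "1 < 1 - \<alpha> + b i" using b1[of i] \<alpha> by linarith
      from g_kernel_has_derivative[OF this t0p]
      show "(g_kernel (1 - \<alpha> + b i) has_real_derivative g_kernel (b i - \<alpha>) t0) (at t0)" by (simp add: algebra_simps)
    qed
    then show "((\<lambda>r. mode_sum J A (\<lambda>i. 1 - \<alpha> + b i) \<kappa> r x0) has_real_derivative (\<Sum>i\<in>J. A i * cos (\<kappa> i \<bullet> x0) * g_kernel (b i - \<alpha>) t0)) (at t0)"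
      by (simp add: mode_sum_def mult_ac)
    have "((\<lambda>r. \<Sum>i\<in>J. A i * cos (\<kappa> i \<bullet> x0) * g_kernel (b i) r) has_real_derivative (\<Sum>i\<in>J. A i * cos (\<kappa> i \<bullet> x0) * g_kernel (b i - 1) t0)) (at t0)"
      by (intro DERIV_sum DERIV_cmult g_kernel_has_derivative t0p b1)
    then show "((\<lambda>r. ?u r x0) has_real_derivative (\<Sum>i\<in>J. A i * cos (\<kappa> i \<bullet> x0) * g_kernel (b i - 1) t0)) (at t0)"
      by (simp add: mode_sum_def mult_ac)
  qed (use min t0 in auto)
  also have "\<dots> < 0" using m g_kernel_pos[of "1 - \<alpha>" t0] \<alpha> t0p by (simp add: mult_neg_pos)
  finally have "mode_source \<alpha> J A b \<kappa> t0 x0 < 0"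
    using lap by (simp add: mode_source_def algebra_simps sum.distrib)
  then show False using f[OF t0p t0(2), of x0] by simp
qed

section \<open>Testing with a parabolic cutoff\<close>

lemma
  fixes p :: "'i \<Rightarrow> real \<Rightarrow> real" and q :: "'i \<Rightarrow> real ^ 'n \<Rightarrow> real"
  assumes "\<And>i. i \<in> J \<Longrightarrow> integrable lborel (p i)" "\<And>i. i \<in> J \<Longrightarrow> integrable lborel (q i)"
  shows integral_separable_sum: "(\<integral>z. (\<Sum>i\<in>J. A i * (p i (fst z) * q i (snd z))) \<partial>(lborel \<Otimes>\<^sub>M lborel))
      = (\<Sum>i\<in>J. A i * (integral\<^sup>L lborel (p i) * integral\<^sup>L lborel (q i)))"
    and integrable_separable_sum: "integrable (lborel \<Otimes>\<^sub>M lborel) (\<lambda>z. \<Sum>i\<in>J. A i * (p i (fst z) * q i (snd z)))"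
proof -
  have i: "integrable (lborel \<Otimes>\<^sub>M lborel) (\<lambda>z. A i * (p i (fst z) * q i (snd z)))" if "i \<in> J" for i
    using assms that by (intro integrable_mult_right integrable_lborel_mult)
  then show "integrable (lborel \<Otimes>\<^sub>M lborel) (\<lambda>z. \<Sum>i\<in>J. A i * (p i (fst z) * q i (snd z)))"
    by (intro Bochner_Integration.integrable_sum)
  have "(\<integral>z. (\<Sum>i\<in>J. A i * (p i (fst z) * q i (snd z))) \<partial>(lborel \<Otimes>\<^sub>M lborel))
      = (\<Sum>i\<in>J. \<integral>z. A i * (p i (fst z) * q i (snd z)) \<partial>(lborel \<Otimes>\<^sub>M lborel))"
    using i by (rule Bochner_Integration.integral_sum)
  also have "\<dots> = (\<Sum>i\<in>J. A i * (integral\<^sup>L lborel (p i) * integral\<^sup>L lborel (q i)))"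
    using assms by (intro sum.cong refl) (simp add: integral_lborel_mult)
  finally show "(\<integral>z. (\<Sum>i\<in>J. A i * (p i (fst z) * q i (snd z))) \<partial>(lborel \<Otimes>\<^sub>M lborel))
      = (\<Sum>i\<in>J. A i * (integral\<^sup>L lborel (p i) * integral\<^sup>L lborel (q i)))" .
qed

text \<open>Since g_2(s) = s, the ramp is \<open>g_kernel 2 (T - t) / T\<close> on (0,T), and the
  integral becomes an instance of the semigroup law.\<close>

lemma has_bochner_integral_g_kernel_ramp:
  assumes "0 < b" "0 < T"
  shows "has_bochner_integral lborel (\<lambda>t. indicator {0<..<T} t * (1 - t / T) * g_kernel b t) (g_kernel (b + 2) T / T)"
proof -
  have "has_bochner_integral lborel (\<lambda>s. indicator {0<..<T} s * (g_kernel 2 (T - s) * g_kernel b s)) (g_kernel (2 + b) T)"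
    using assms by (intro has_bochner_integral_g_kernel_conv) auto
  then have "has_bochner_integral lborel (\<lambda>s. (1 / T) * (indicator {0<..<T} s * (g_kernel 2 (T - s) * g_kernel b s))) ((1 / T) * g_kernel (2 + b) T)"
    by (intro has_bochner_integral_mult_right) auto
  also have "(\<lambda>s. (1 / T) * (indicator {0<..<T} s * (g_kernel 2 (T - s) * g_kernel b s))) = (\<lambda>t. indicator {0<..<T} t * (1 - t / T) * g_kernel b t)"
    using assms by (auto simp: fun_eq_iff indicator_def g_kernel_def Gamma_numeral field_simps)
  finally show ?thesis by (simp add: add.commute)
qed

text \<open>An exponent of at least 2 makes both branches meet at 0 with slope 0; writing it as
  \<open>k + 2\<close> avoids subtraction in the derivative.\<close>

lemma max_power_has_derivative:
  "((\<lambda>y::real. (max 0 y) ^ (k + 2)) has_real_derivative real (k + 2) * (max 0 y) ^ (k + 1)) (at y)"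
proof -
  consider "y < 0" | "y > 0" | "y = 0" by linarith
  then show ?thesis
  proof cases
    case 1
    have "((\<lambda>_. 0) has_real_derivative 0) (at y)" by simp
    then have "((\<lambda>y::real. (max 0 y) ^ (k + 2)) has_real_derivative 0) (at y)"
      by (rule has_field_derivative_transform_within_open[of _ _ _ "{..<0}"]) (use 1 in \<open>auto simp: max_def\<close>)
    then show ?thesis using 1 by (simp add: max_def)
  next
    case 2
    have "((\<lambda>y. y ^ (k + 2)) has_real_derivative real (k + 2) * y ^ (k + 1)) (at y)"
      using DERIV_pow[of "k + 2" y] by simp
    then have "((\<lambda>y::real. (max 0 y) ^ (k + 2)) has_real_derivative real (k + 2) * y ^ (k + 1)) (at y)"
      by (rule has_field_derivative_transform_within_open[of _ _ _ "{0<..}"]) (use 2 in \<open>auto simp: max_def\<close>)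
    then show ?thesis using 2 by (simp add: max_def)
  next
    case 3
    have "((\<lambda>h::real. \<bar>h\<bar> ^ (k + 1)) \<longlongrightarrow> \<bar>0\<bar> ^ (k + 1)) (at 0)" by (intro tendsto_intros)
    then have "((\<lambda>h::real. \<bar>h\<bar> ^ (k + 1)) \<longlongrightarrow> 0) (at 0)" by simp
    moreover have "norm ((max 0 h) ^ (k + 2) / h) \<le> \<bar>h\<bar> ^ (k + 1)" for h :: real
    proof (cases "h > 0")
      case False
      then have "(max 0 h) ^ (k + 2) / h = 0" by simp
      then show ?thesis by (simp only: norm_zero zero_le_power abs_ge_zero)
    qed (simp add: max_def)
    then have "\<forall>\<^sub>F h in at (0::real). norm ((max 0 h) ^ (k + 2) / h) \<le> \<bar>h\<bar> ^ (k + 1)"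
      by (rule always_eventually[OF allI])
    ultimately have "((\<lambda>h::real. (max 0 h) ^ (k + 2) / h) \<longlongrightarrow> 0) (at 0)"
      by (rule Lim_null_comparison[rotated])
    then show ?thesis using 3 by (simp add: has_field_derivative_iff)
  qed
qed

definition cutoff_base :: "real \<Rightarrow> real ^ 'n \<Rightarrow> real" where
  "cutoff_base \<rho> x = max 0 (1 - (norm x)\<^sup>2 / \<rho>\<^sup>2)"

text \<open>The cube is the smallest natural power for which this radial function is twice
  continuously differentiable.\<close>

definition cutoff :: "real \<Rightarrow> real ^ 'n \<Rightarrow> real" where
  "cutoff \<rho> x = cutoff_base \<rho> x ^ 3"

text \<open>This is minus the Laplacian of \<open>cutoff \<rho>\<close>: coordinate i contributes
  6/\<rho>^2 base^2 - 24 (x_i)^2/\<rho>^4 base, where base is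
  \<open>cutoff_base \<rho> x\<close>.\<close>

definition neg_lap_cutoff :: "real \<Rightarrow> real ^ 'n \<Rightarrow> real" where
  "neg_lap_cutoff \<rho> x = real CARD('n) * (6 / \<rho>\<^sup>2 * cutoff_base \<rho> x ^ 2) - 24 * (norm x)\<^sup>2 / \<rho> ^ 4 * cutoff_base \<rho> x"

lemma cutoff_base_zero: "0 < \<rho> \<Longrightarrow> \<rho> \<le> norm x \<Longrightarrow> cutoff_base \<rho> x = 0"
  unfolding cutoff_base_def by (simp add: max_def field_simps power_mono)

lemma cutoff_base_nonneg: "0 \<le> cutoff_base \<rho> x"
  and cutoff_base_le_1: "cutoff_base \<rho> x \<le> 1"
  by (auto simp: cutoff_base_def)

lemma cutoff_base_continuous: "continuous_on UNIV (cutoff_base \<rho>)"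
  unfolding cutoff_base_def[abs_def] divide_inverse by (intro continuous_intros)

lemma norm_axis_shift: "(norm (x + s *\<^sub>R axis i 1 :: real ^ 'n))\<^sup>2 = (norm x)\<^sup>2 + 2 * s * x $ i + s\<^sup>2"
  unfolding power2_norm_eq_inner
  by (simp add: inner_add_left inner_add_right inner_axis inner_axis' power2_eq_square inner_commute)

lemma cutoff_derivatives:
  fixes x :: "real ^ 'n"
  assumes \<rho>: "0 < \<rho>"
  shows "((\<lambda>s. cutoff \<rho> (x + s *\<^sub>R axis i 1)) has_real_derivative - (6 * x $ i / \<rho>\<^sup>2 * cutoff_base \<rho> x ^ 2)) (at 0)"
    and "((\<lambda>s. - (6 * (x + s *\<^sub>R axis i 1) $ i / \<rho>\<^sup>2 * cutoff_base \<rho> (x + s *\<^sub>R axis i 1) ^ 2)) has_real_derivative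
        - (6 / \<rho>\<^sup>2 * cutoff_base \<rho> x ^ 2 - 24 * (x $ i)\<^sup>2 / \<rho> ^ 4 * cutoff_base \<rho> x)) (at 0)"
proof -
  let ?y = "\<lambda>s. 1 - ((norm x)\<^sup>2 + 2 * s * x $ i + s\<^sup>2) / \<rho>\<^sup>2"
  have dy: "(?y has_real_derivative - (2 * x $ i / \<rho>\<^sup>2)) (at 0)"
  proof -
    have "((\<lambda>s. (norm x)\<^sup>2 + 2 * s * x $ i + s\<^sup>2) has_real_derivative 2 * x $ i) (at 0)"
      by (auto intro!: derivative_eq_intros)
    from DERIV_diff[OF DERIV_const[of 1] DERIV_cdivide[OF this, of "\<rho>\<^sup>2"]]
    show ?thesis by simp
  qed
  have base: "cutoff_base \<rho> (x + s *\<^sub>R axis i 1) = max 0 (?y s)" for s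
    by (simp add: cutoff_base_def norm_axis_shift)
  have d: "((\<lambda>s. (max 0 (?y s)) ^ (k + 2)) has_real_derivative real (k + 2) * (cutoff_base \<rho> x) ^ (k + 1) * - (2 * x $ i / \<rho>\<^sup>2)) (at 0)" for k
    using DERIV_chain2[OF max_power_has_derivative[of k "?y 0"] dy] by (simp add: cutoff_base_def)
  show "((\<lambda>s. cutoff \<rho> (x + s *\<^sub>R axis i 1)) has_real_derivative - (6 * x $ i / \<rho>\<^sup>2 * cutoff_base \<rho> x ^ 2)) (at 0)"
    unfolding cutoff_def base using d[of 1] by (simp add: mult_ac numeral_3_eq_3 numeral_2_eq_2)
  have "((\<lambda>s. - (6 * (x $ i + s) / \<rho>\<^sup>2 * (max 0 (?y s)) ^ (0 + 2))) has_real_derivative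
      - ((6 * (0 + 1) / \<rho>\<^sup>2) * (max 0 (?y 0)) ^ (0 + 2) + (real (0 + 2) * (cutoff_base \<rho> x) ^ (0 + 1) * - (2 * x $ i / \<rho>\<^sup>2)) * (6 * (x $ i + 0) / \<rho>\<^sup>2))) (at 0)"
    by (intro DERIV_minus DERIV_mult d DERIV_cdivide DERIV_cmult DERIV_add DERIV_const DERIV_ident)
  then show "((\<lambda>s. - (6 * (x + s *\<^sub>R axis i 1) $ i / \<rho>\<^sup>2 * cutoff_base \<rho> (x + s *\<^sub>R axis i 1) ^ 2)) has_real_derivative
        - (6 / \<rho>\<^sup>2 * cutoff_base \<rho> x ^ 2 - 24 * (x $ i)\<^sup>2 / \<rho> ^ 4 * cutoff_base \<rho> x)) (at 0)"
    unfolding base using \<rho> by (simp add: cutoff_base_def field_simps power2_eq_square power4_eq_xxxx)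
qed

lemma cutoff_continuous: "continuous_on UNIV (cutoff \<rho>)" "continuous_on UNIV (neg_lap_cutoff \<rho>)"
  unfolding cutoff_def[abs_def] neg_lap_cutoff_def[abs_def] divide_inverse
  by (intro continuous_intros cutoff_base_continuous)+

text \<open>Two integrations by parts in each coordinate move the Laplacian from the cosine to the
  cutoff; the coordinates are then added up.\<close>

lemma integral_cutoff_cos:
  fixes \<kappa> :: "real ^ 'n"
  assumes \<rho>: "0 < \<rho>"
  shows "(norm \<kappa>)\<^sup>2 * (\<integral>x. cutoff \<rho> x * cos (\<kappa> \<bullet> x) \<partial>lborel) = (\<integral>x. neg_lap_cutoff \<rho> x * cos (\<kappa> \<bullet> x) \<partial>lborel)"
proof -
  let ?d1 = "\<lambda>i (x::real^'n). - (6 * x $ i / \<rho>\<^sup>2 * cutoff_base \<rho> x ^ 2)"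
  let ?d2 = "\<lambda>i (x::real^'n). - (6 / \<rho>\<^sup>2 * cutoff_base \<rho> x ^ 2 - 24 * (x $ i)\<^sup>2 / \<rho> ^ 4 * cutoff_base \<rho> x)"
  have c: "continuous_on UNIV (?d1 i)" "continuous_on UNIV (?d2 i)" for i
    unfolding divide_inverse by (intro continuous_intros cutoff_base_continuous)+
  have z: "cutoff \<rho> x = 0" "?d1 i x = 0" "?d2 i x = 0" if "\<rho> < norm x" for i and x :: "real ^ 'n"
    using cutoff_base_zero[OF \<rho>, of x] that by (auto simp: cutoff_def)
  have i: "(\<kappa> $ i)\<^sup>2 * (\<integral>x. cutoff \<rho> x * cos (\<kappa> \<bullet> x) \<partial>lborel) = (\<integral>x. - ?d2 i x * cos (\<kappa> \<bullet> x) \<partial>lborel)" for i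
  proof -
    have 1: "(\<integral>x. (\<kappa> $ i * sin (\<kappa> \<bullet> x)) * ?d1 i x \<partial>lborel) = - (\<integral>x. (\<kappa> $ i * (\<kappa> $ i * cos (\<kappa> \<bullet> x))) * cutoff \<rho> x \<partial>lborel)"
      by (rule integral_by_parts_directional[where e="axis i 1" and R=\<rho>])
         (intro DERIV_cmult cos_directional_derivative cutoff_derivatives \<rho> continuous_intros cutoff_continuous c z; assumption)+
    have 2: "(\<integral>x. cos (\<kappa> \<bullet> x) * ?d2 i x \<partial>lborel) = - (\<integral>x. - (\<kappa> $ i * sin (\<kappa> \<bullet> x)) * ?d1 i x \<partial>lborel)"
      by (rule integral_by_parts_directional[where e="axis i 1" and R=\<rho>])
         (intro DERIV_cmult cos_directional_derivative cutoff_derivatives \<rho> continuous_intros cutoff_continuous c z; assumption)+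
    have "(\<kappa> $ i)\<^sup>2 * (\<integral>x. cutoff \<rho> x * cos (\<kappa> \<bullet> x) \<partial>lborel) = (\<integral>x. (\<kappa> $ i * (\<kappa> $ i * cos (\<kappa> \<bullet> x))) * cutoff \<rho> x \<partial>lborel)"
      by (subst integral_mult_right_zero[symmetric]) (simp add: power2_eq_square mult_ac)
    also have "\<dots> = - (\<integral>x. cos (\<kappa> \<bullet> x) * ?d2 i x \<partial>lborel)"
      using 1 2 by simp
    also have "\<dots> = (\<integral>x. - ?d2 i x * cos (\<kappa> \<bullet> x) \<partial>lborel)"
      by (simp only: integral_minus[symmetric] mult_minus_left mult.commute[of "cos _"])
    finally show ?thesis .
  qed
  have n: "(norm x)\<^sup>2 = (\<Sum>i\<in>UNIV. (x $ i)\<^sup>2)" for x :: "real ^ 'n"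
    unfolding power2_norm_eq_inner inner_vec_def by (simp add: power2_eq_square)
  have "(norm \<kappa>)\<^sup>2 * (\<integral>x. cutoff \<rho> x * cos (\<kappa> \<bullet> x) \<partial>lborel) = (\<Sum>i\<in>UNIV. \<integral>x. - ?d2 i x * cos (\<kappa> \<bullet> x) \<partial>lborel)"
    unfolding n sum_distrib_right by (intro sum.cong refl i)
  also have "\<dots> = (\<integral>x. (\<Sum>i\<in>UNIV. - ?d2 i x * cos (\<kappa> \<bullet> x)) \<partial>lborel)"
  proof (rule Bochner_Integration.integral_sum[symmetric])
    fix i
    show "integrable lborel (\<lambda>x. - ?d2 i x * cos (\<kappa> \<bullet> x))"
    proof (rule integrable_continuous_bounded_support[where R=\<rho>])
      show "continuous_on UNIV (\<lambda>x. - ?d2 i x * cos (\<kappa> \<bullet> x))"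
        by (intro continuous_on_mult continuous_on_minus c) (intro continuous_intros)
    qed (simp only: z(3) minus_zero mult_zero_left)
  qed
  also have "(\<lambda>x. \<Sum>i\<in>UNIV. - ?d2 i x * cos (\<kappa> \<bullet> x)) = (\<lambda>x. neg_lap_cutoff \<rho> x * cos (\<kappa> \<bullet> x))"
  proof
    fix x :: "real ^ 'n"
    have "(\<Sum>i\<in>UNIV. - ?d2 i x) = neg_lap_cutoff \<rho> x"
      unfolding neg_lap_cutoff_def n by (simp add: sum_subtractf sum_distrib_left sum_distrib_right sum_divide_distrib)
    then show "(\<Sum>i\<in>UNIV. - ?d2 i x * cos (\<kappa> \<bullet> x)) = neg_lap_cutoff \<rho> x * cos (\<kappa> \<bullet> x)"
      by (simp only: sum_distrib_right[symmetric])
  qed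
  finally show ?thesis .
qed

text \<open>For minus the Laplacian a one-sided bound is enough, as it will be multiplied by a
  nonnegative u; the subtracted term is nonnegative and is dropped.\<close>

lemma cutoff_bounds:
  fixes x :: "real ^ 'n"
  assumes "0 < \<rho>"
  shows "0 \<le> cutoff \<rho> x" "cutoff \<rho> x \<le> indicator (ball 0 \<rho>) x"
    "neg_lap_cutoff \<rho> x \<le> 6 * real CARD('n) / \<rho>\<^sup>2 * indicator (ball 0 \<rho>) x"
proof -
  show "0 \<le> cutoff \<rho> x" by (simp add: cutoff_def cutoff_base_nonneg)
  show "cutoff \<rho> x \<le> indicator (ball 0 \<rho>) x"
    using cutoff_base_zero[OF assms, of x] cutoff_base_nonneg[of \<rho> x] cutoff_base_le_1[of \<rho> x]
    by (cases "norm x < \<rho>") (auto simp: cutoff_def power_le_one)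
  show "neg_lap_cutoff \<rho> x \<le> 6 * real CARD('n) / \<rho>\<^sup>2 * indicator (ball 0 \<rho>) x"
  proof (cases "norm x < \<rho>")
    case True
    have "0 \<le> 24 * (norm x)\<^sup>2 / \<rho> ^ 4 * cutoff_base \<rho> x"
      using assms by (intro mult_nonneg_nonneg divide_nonneg_nonneg cutoff_base_nonneg) auto
    then have "neg_lap_cutoff \<rho> x \<le> real CARD('n) * (6 / \<rho>\<^sup>2 * cutoff_base \<rho> x ^ 2)"
      by (simp add: neg_lap_cutoff_def)
    also have "\<dots> \<le> real CARD('n) * (6 / \<rho>\<^sup>2 * 1)"
      by (intro mult_left_mono power_le_one cutoff_base_nonneg cutoff_base_le_1) auto
    finally show ?thesis using True by (simp add: mult_ac)
  next
    case False
    then show ?thesis using cutoff_base_zero[OF assms, of x] by (simp add: neg_lap_cutoff_def)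
  qed
qed

lemma integrable_cutoff_cos:
  fixes \<kappa> :: "real ^ 'n"
  assumes \<rho>: "0 < \<rho>"
  shows "integrable lborel (\<lambda>x. cutoff \<rho> x * cos (\<kappa> \<bullet> x))" "integrable lborel (\<lambda>x. neg_lap_cutoff \<rho> x * cos (\<kappa> \<bullet> x))"
proof -
  have z: "cutoff \<rho> x = 0" "neg_lap_cutoff \<rho> x = 0" if "\<rho> < norm x" for x :: "real ^ 'n"
    using cutoff_base_zero[OF \<rho>, of x] that by (auto simp: cutoff_def neg_lap_cutoff_def)
  show "integrable lborel (\<lambda>x. cutoff \<rho> x * cos (\<kappa> \<bullet> x))" "integrable lborel (\<lambda>x. neg_lap_cutoff \<rho> x * cos (\<kappa> \<bullet> x))"
    by (rule integrable_continuous_bounded_support[where R=\<rho>];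
        (simp add: z | intro continuous_on_mult cutoff_continuous continuous_intros))+
qed

lemma integrable_mode_sum_bounded:
  fixes X :: "(real ^ 'n) set"
  assumes b: "\<And>i. i \<in> J \<Longrightarrow> 1 \<le> b i" and X: "bounded X" "X \<in> sets borel"
  shows "integrable (lborel \<Otimes>\<^sub>M lborel) (\<lambda>z. indicator ({0<..<T} \<times> X) z * mode_sum J A b \<kappa> (fst z) (snd z))"
proof -
  have m: "{0<..<T} \<times> X \<in> sets (lborel \<Otimes>\<^sub>M lborel)"
    using X(2) by (intro pair_measureI) auto
  have "bounded ({0<..<T} \<times> X)" using X by (intro bounded_Times) auto
  then have fin: "emeasure (lborel \<Otimes>\<^sub>M lborel) ({0<..<T} \<times> X) < \<infinity>"
    unfolding lborel_prod by (rule emeasure_bounded_finite)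
  have [measurable]: "(\<lambda>z. mode_sum J A b \<kappa> (fst z) (snd z)) \<in> borel_measurable (lborel \<Otimes>\<^sub>M lborel)"
    using mode_sum_measurable unfolding lborel_prod by simp
  have "integrable (lborel \<Otimes>\<^sub>M lborel) (\<lambda>z. (\<Sum>i\<in>J. \<bar>A i\<bar> * g_kernel (b i) T) * indicator ({0<..<T} \<times> X) z)"
    by (intro integrable_mult_right integrable_real_indicator m fin)
  then show ?thesis
  proof (rule Bochner_Integration.integrable_bound)
    show "(\<lambda>z. indicator ({0<..<T} \<times> X) z * mode_sum J A b \<kappa> (fst z) (snd z)) \<in> borel_measurable (lborel \<Otimes>\<^sub>M lborel)"
      using m by (intro borel_measurable_times borel_measurable_indicator) auto
    show "AE z in lborel \<Otimes>\<^sub>M lborel. norm (indicator ({0<..<T} \<times> X) z * mode_sum J A b \<kappa> (fst z) (snd z))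
       \<le> norm ((\<Sum>i\<in>J. \<bar>A i\<bar> * g_kernel (b i) T) * indicator ({0<..<T} \<times> X) z)"
    proof (rule AE_I2)
      fix z :: "real \<times> (real ^ 'n)"
      have "\<bar>mode_sum J A b \<kappa> (fst z) (snd z)\<bar> \<le> (\<Sum>i\<in>J. \<bar>A i\<bar> * g_kernel (b i) T)" if "z \<in> {0<..<T} \<times> X"
        using that by (intro mode_sum_bound b) auto
      then show "norm (indicator ({0<..<T} \<times> X) z * mode_sum J A b \<kappa> (fst z) (snd z))
       \<le> norm ((\<Sum>i\<in>J. \<bar>A i\<bar> * g_kernel (b i) T) * indicator ({0<..<T} \<times> X) z)"
        by (cases "z \<in> {0<..<T} \<times> X") (auto intro: order_trans[OF _ abs_ge_self])
    qed
  qed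
qed

text \<open>The equation is tested with the ramp in time times the cutoff in space. Moving the
  Laplacian to the cutoff costs 6 N/\<rho>^2. Moving the fractional derivative to the ramp leaves
  g_{2-\<alpha>}(T - t)/T, which is at most T^(-\<alpha>)/Gamma(2 - \<alpha>). The choice of T makes
  T^(-\<alpha>) = \<rho>^(-2), so both costs scale alike.\<close>

lemma source_duality:
  fixes \<kappa> :: "'i \<Rightarrow> real ^ 'n"
  assumes \<alpha>: "0 < \<alpha>" "\<alpha> < 1" and \<rho>: "0 < \<rho>" and J: "finite J" and b: "\<And>i. i \<in> J \<Longrightarrow> 1 + \<alpha> \<le> b i"
    and T: "T = \<rho> powr (2 / \<alpha>)"
    and u: "\<And>t x. 0 < t \<Longrightarrow> t < T \<Longrightarrow> 0 \<le> mode_sum J A b \<kappa> t x"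
  shows "integrable (lborel \<Otimes>\<^sub>M lborel) (\<lambda>z. indicator {0<..<T} (fst z) * (1 - fst z / T) * cutoff \<rho> (snd z) * mode_source \<alpha> J A b \<kappa> (fst z) (snd z))" (is ?int)
    and "(\<integral>z. indicator {0<..<T} (fst z) * (1 - fst z / T) * cutoff \<rho> (snd z) * mode_source \<alpha> J A b \<kappa> (fst z) (snd z) \<partial>(lborel \<Otimes>\<^sub>M lborel))
      \<le> (1 / Gamma (2 - \<alpha>) + 6 * real CARD('n)) / \<rho>\<^sup>2 *
        (\<integral>z. indicator ({0<..<T} \<times> ball 0 \<rho>) z * mode_sum J A b \<kappa> (fst z) (snd z) \<partial>(lborel \<Otimes>\<^sub>M lborel))" (is "?L \<le> ?R")
proof -
  have Tp: "0 < T" using \<rho> by (simp add: T)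
  have TA: "T powr (- \<alpha>) = 1 / \<rho>\<^sup>2"
    using \<rho> \<alpha> by (simp add: T powr_powr powr_minus_divide)
  have b1: "1 < b i" if "i \<in> J" for i using b[OF that] \<alpha> by linarith
  have bp: "0 < b i" "1 \<le> b i - \<alpha>" "0 < b i - \<alpha>" "1 \<le> b i" if "i \<in> J" for i
    using b[OF that] \<alpha> by linarith+
  let ?q = "\<lambda>i x. cutoff \<rho> x * cos (\<kappa> i \<bullet> x)" and ?q' = "\<lambda>i x. neg_lap_cutoff \<rho> x * cos (\<kappa> i \<bullet> x)"
  let ?p1 = "\<lambda>i t. indicator {0<..<T} t * (1 - t / T) * g_kernel (b i - \<alpha>) t"
  let ?p2 = "\<lambda>i t. indicator {0<..<T} t * (1 - t / T) * g_kernel (b i) t"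
  let ?p3 = "\<lambda>i t. (1 / T) * (indicator {0<..<T} t * (g_kernel (2 - \<alpha>) (T - t) * g_kernel (b i) t))"
  note q = integrable_cutoff_cos[OF \<rho>]
  have p1: "has_bochner_integral lborel (?p1 i) (g_kernel (b i - \<alpha> + 2) T / T)" if "i \<in> J" for i
    by (rule has_bochner_integral_g_kernel_ramp[OF bp(3)[OF that] Tp])
  have p2: "integrable lborel (?p2 i)" if "i \<in> J" for i
    using has_bochner_integral_g_kernel_ramp[OF bp(1)[OF that] Tp] by (simp add: has_bochner_integral_iff)
  have p3: "has_bochner_integral lborel (?p3 i) (1 / T * g_kernel (2 - \<alpha> + b i) T)" if "i \<in> J" for i
    using \<alpha> bp[OF that] Tp by (intro has_bochner_integral_mult_right has_bochner_integral_g_kernel_conv) auto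
  have I1: "integrable lborel (?p1 i)" and I3: "integrable lborel (?p3 i)"
    and I13: "integral\<^sup>L lborel (?p1 i) = integral\<^sup>L lborel (?p3 i)" if "i \<in> J" for i
    using p1[OF that] p3[OF that] by (auto simp: has_bochner_integral_iff algebra_simps)
  \<comment> \<open>\<open>?F1\<close> and \<open>?F2\<close> are the fractional and the Laplace
    part of the tested source, \<open>?F3\<close> and \<open>?F4\<close> the same after the
    operators have moved to the test function. All are sums of products of a function of time and
    one of space, so equality of the integrals is checked factor by factor.\<close>
  let ?F1 = "\<lambda>z. \<Sum>i\<in>J. A i * (?p1 i (fst z) * ?q i (snd z))"
  let ?F2 = "\<lambda>z. \<Sum>i\<in>J. (A i * (norm (\<kappa> i))\<^sup>2) * (?p2 i (fst z) * ?q i (snd z))"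
  let ?F3 = "\<lambda>z. \<Sum>i\<in>J. A i * (?p3 i (fst z) * ?q i (snd z))"
  let ?F4 = "\<lambda>z. \<Sum>i\<in>J. A i * (?p2 i (fst z) * ?q' i (snd z))"
  have F: "integrable (lborel \<Otimes>\<^sub>M lborel) ?F1" "integrable (lborel \<Otimes>\<^sub>M lborel) ?F2"
    "integrable (lborel \<Otimes>\<^sub>M lborel) ?F3" "integrable (lborel \<Otimes>\<^sub>M lborel) ?F4"
    by (intro integrable_separable_sum I1 p2 I3 q; assumption)+
  have e13: "integral\<^sup>L (lborel \<Otimes>\<^sub>M lborel) ?F1 = integral\<^sup>L (lborel \<Otimes>\<^sub>M lborel) ?F3"
  proof -
    have "integral\<^sup>L (lborel \<Otimes>\<^sub>M lborel) ?F1 = (\<Sum>i\<in>J. A i * (integral\<^sup>L lborel (?p1 i) * integral\<^sup>L lborel (?q i)))"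
      by (rule integral_separable_sum[OF I1 q(1)])
    also have "\<dots> = (\<Sum>i\<in>J. A i * (integral\<^sup>L lborel (?p3 i) * integral\<^sup>L lborel (?q i)))"
      by (intro sum.cong refl) (simp only: I13)
    also have "\<dots> = integral\<^sup>L (lborel \<Otimes>\<^sub>M lborel) ?F3"
      by (rule integral_separable_sum[OF I3 q(1), symmetric])
    finally show ?thesis .
  qed
  have e24: "integral\<^sup>L (lborel \<Otimes>\<^sub>M lborel) ?F2 = integral\<^sup>L (lborel \<Otimes>\<^sub>M lborel) ?F4"
  proof -
    have "integral\<^sup>L (lborel \<Otimes>\<^sub>M lborel) ?F2 = (\<Sum>i\<in>J. (A i * (norm (\<kappa> i))\<^sup>2) * (integral\<^sup>L lborel (?p2 i) * integral\<^sup>L lborel (?q i)))"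
      by (rule integral_separable_sum[OF p2 q(1)])
    also have "\<dots> = (\<Sum>i\<in>J. A i * (integral\<^sup>L lborel (?p2 i) * integral\<^sup>L lborel (?q' i)))"
      by (intro sum.cong refl) (simp only: integral_cutoff_cos[OF \<rho>, symmetric] mult_ac)
    also have "\<dots> = integral\<^sup>L (lborel \<Otimes>\<^sub>M lborel) ?F4"
      by (rule integral_separable_sum[OF p2 q(2), symmetric])
    finally show ?thesis .
  qed
  have src: "indicator {0<..<T} (fst z) * (1 - fst z / T) * cutoff \<rho> (snd z) * mode_source \<alpha> J A b \<kappa> (fst z) (snd z) = ?F1 z + ?F2 z" for z
    unfolding mode_source_def sum_distrib_left sum.distrib[symmetric]
    by (intro sum.cong refl) (simp add: distrib_left distrib_right mult_ac)
  show ?int unfolding src using F by simp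
  have "?L = integral\<^sup>L (lborel \<Otimes>\<^sub>M lborel) ?F3 + integral\<^sup>L (lborel \<Otimes>\<^sub>M lborel) ?F4"
    unfolding src using F e13 e24 by simp
  also have "\<dots> = (\<integral>z. ?F3 z + ?F4 z \<partial>(lborel \<Otimes>\<^sub>M lborel))" using F by simp
  also have "\<dots> \<le> (\<integral>z. (1 / Gamma (2 - \<alpha>) + 6 * real CARD('n)) / \<rho>\<^sup>2 *
        (indicator ({0<..<T} \<times> ball 0 \<rho>) z * mode_sum J A b \<kappa> (fst z) (snd z)) \<partial>(lborel \<Otimes>\<^sub>M lborel))"
  proof (rule integral_mono)
    show "integrable (lborel \<Otimes>\<^sub>M lborel) (\<lambda>z. (1 / Gamma (2 - \<alpha>) + 6 * real CARD('n)) / \<rho>\<^sup>2 *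
        (indicator ({0<..<T} \<times> ball 0 \<rho>) z * mode_sum J A b \<kappa> (fst z) (snd z)))"
      by (intro integrable_mult_right integrable_mode_sum_bounded bp) auto
    show "integrable (lborel \<Otimes>\<^sub>M lborel) (\<lambda>z. ?F3 z + ?F4 z)" using F by simp
    fix z :: "real \<times> (real ^ 'n)"
    obtain t x where z: "z = (t, x)" by (cases z)
    show "?F3 z + ?F4 z \<le> (1 / Gamma (2 - \<alpha>) + 6 * real CARD('n)) / \<rho>\<^sup>2 *
        (indicator ({0<..<T} \<times> ball 0 \<rho>) z * mode_sum J A b \<kappa> (fst z) (snd z))"
    proof (cases "t \<in> {0<..<T}")
      case True
      have eq: "?F3 z + ?F4 z = (g_kernel (2 - \<alpha>) (T - t) / T * cutoff \<rho> x + (1 - t / T) * neg_lap_cutoff \<rho> x) * mode_sum J A b \<kappa> t x"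
        unfolding z mode_sum_def sum_distrib_left sum.distrib[symmetric] using True
        by (intro sum.cong refl) (simp add: algebra_simps)
      have "g_kernel (2 - \<alpha>) (T - t) / T \<le> g_kernel (2 - \<alpha>) T / T"
        using True \<alpha> by (intro divide_right_mono g_kernel_mono) auto
      also have "g_kernel (2 - \<alpha>) T / T = (1 / Gamma (2 - \<alpha>)) / \<rho>\<^sup>2"
      proof -
        have "T powr (1 - \<alpha>) = T * (1 / \<rho>\<^sup>2)"
          using powr_mult_base[of T "- \<alpha>"] Tp by (simp add: TA)
        then show ?thesis using Tp by (simp add: g_kernel_def)
      qed
      finally have g: "g_kernel (2 - \<alpha>) (T - t) / T \<le> (1 / Gamma (2 - \<alpha>)) / \<rho>\<^sup>2" .
      have G: "0 \<le> (1 / Gamma (2 - \<alpha>)) / \<rho>\<^sup>2" using \<alpha> Gamma_real_pos[of "2 - \<alpha>"] by simp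
      have 1: "g_kernel (2 - \<alpha>) (T - t) / T * cutoff \<rho> x \<le> (1 / Gamma (2 - \<alpha>)) / \<rho>\<^sup>2 * indicator (ball 0 \<rho>) x"
        by (intro mult_mono g G cutoff_bounds \<rho>)
      have t1: "0 \<le> 1 - t / T" "1 - t / T \<le> 1" using True by auto
      have 2: "(1 - t / T) * neg_lap_cutoff \<rho> x \<le> 6 * real CARD('n) / \<rho>\<^sup>2 * indicator (ball 0 \<rho>) x"
      proof -
        have "(1 - t / T) * neg_lap_cutoff \<rho> x \<le> (1 - t / T) * (6 * real CARD('n) / \<rho>\<^sup>2 * indicator (ball 0 \<rho>) x)"
          by (intro mult_left_mono cutoff_bounds \<rho> t1)
        also have "\<dots> \<le> 1 * (6 * real CARD('n) / \<rho>\<^sup>2 * indicator (ball 0 \<rho>) x)"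
          by (intro mult_right_mono t1) simp
        finally show ?thesis by simp
      qed
      have "?F3 z + ?F4 z \<le> ((1 / Gamma (2 - \<alpha>)) / \<rho>\<^sup>2 * indicator (ball 0 \<rho>) x + 6 * real CARD('n) / \<rho>\<^sup>2 * indicator (ball 0 \<rho>) x) * mode_sum J A b \<kappa> t x"
        unfolding eq using u[of t x] True by (intro mult_right_mono add_mono 1 2) auto
      also have "\<dots> = (1 / Gamma (2 - \<alpha>) + 6 * real CARD('n)) / \<rho>\<^sup>2 *
        (indicator ({0<..<T} \<times> ball 0 \<rho>) z * mode_sum J A b \<kappa> (fst z) (snd z))"
        using True by (simp add: z indicator_times add_divide_distrib algebra_simps)
      finally show ?thesis .
    qed (simp add: z indicator_times)
  qed
  also have "\<dots> = ?R" by (rule integral_mult_right_zero)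
  finally show "?L \<le> ?R" .
qed

section \<open>The Fejer kernel\<close>

text \<open>The codomain is kept general because complex exponentials and real Fejer kernels are
  both integrated in this way.\<close>

lemma
  fixes h :: "'n::finite \<Rightarrow> real \<Rightarrow> 'b::{real_normed_field,banach,second_countable_topology}"
  assumes h: "\<And>i. integrable lborel (h i)"
  shows integral_lborel_prod_vec: "(\<integral>x. (\<Prod>i\<in>UNIV. h i ((x :: real ^ 'n) $ i)) \<partial>lborel) = (\<Prod>i\<in>UNIV. integral\<^sup>L lborel (h i))"
    and integrable_lborel_prod_vec: "integrable lborel (\<lambda>x :: real ^ 'n. \<Prod>i\<in>UNIV. h i (x $ i))"
proof -
  let ?a = "\<lambda>i :: 'n. axis i (1::real) :: real ^ 'n"
  have inj: "inj ?a" by (auto simp: inj_def axis_eq_axis)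
  have B: "(Basis :: (real ^ 'n) set) = range ?a" by (auto simp: Basis_vec_def)
  define H where "H b = h (inv ?a b)" for b
  have H: "H (?a i) = h i" for i by (simp only: H_def inv_f_f[OF inj, of i])
  have eq: "(\<Prod>b\<in>Basis. H b (x \<bullet> b)) = (\<Prod>i\<in>UNIV. h i (x $ i))" for x :: "real ^ 'n"
    unfolding B by (subst prod.reindex[OF inj]) (simp add: H inner_axis)
  have eq2: "(\<Prod>b\<in>Basis. integral\<^sup>L lborel (H b)) = (\<Prod>i\<in>UNIV. integral\<^sup>L lborel (h i))"
    unfolding B by (subst prod.reindex[OF inj]) (simp add: H)
  have Hi: "integrable lborel (H b)" for b using h by (simp add: H_def)
  show "(\<integral>x. (\<Prod>i\<in>UNIV. h i ((x :: real ^ 'n) $ i)) \<partial>lborel) = (\<Prod>i\<in>UNIV. integral\<^sup>L lborel (h i))"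
    using integral_lborel_prod_Basis[of H, OF Hi] by (simp only: eq eq2)
  show "integrable lborel (\<lambda>x :: real ^ 'n. \<Prod>i\<in>UNIV. h i (x $ i))"
    using integrable_lborel_prod_Basis[of H, OF Hi] by (simp only: eq)
qed

lemma cis_sum: "cis (sum f I) = (\<Prod>i\<in>I. cis (f i))"
  by (induction I rule: infinite_finite_induct) (simp_all add: cis_mult[symmetric])

definition cell :: "(real ^ 'n) set" where "cell = {x. \<forall>i. x $ i \<in> {-pi..pi}}"

lemma indicator_cell: "indicator cell x = (\<Prod>i\<in>UNIV. indicator {-pi..pi} (x $ i) :: 'b::field)"
  by (auto simp: indicator_def cell_def)

lemma cell_eq_cbox: "cell = cbox (- (\<chi> i. pi)) (\<chi> i. pi)"
  by (auto simp: cell_def mem_box_cart)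

lemma cell_measurable: "cell \<in> sets borel" and bounded_cell: "bounded cell"
  by (simp_all add: cell_eq_cbox)

lemma indicator_scaleR_complex: "indicator S y *\<^sub>R z = indicator S y * (z :: complex)"
  by (simp add: indicator_def)

lemma integrable_cis: "integrable lborel (\<lambda>y. indicator {a..b} y * cis (k * y))"
proof -
  have "integrable lborel (\<lambda>y. indicator {a..b} y *\<^sub>R cis (k * y))"
    by (rule borel_integrable_compact) (auto intro!: continuous_intros)
  then show ?thesis by (simp only: indicator_scaleR_complex)
qed

lemma integral_cis_period:
  assumes k: "k \<in> \<int>" "k \<noteq> 0"
  shows "(\<integral>y. indicator {-pi..pi} y * cis (k * y) \<partial>lborel) = 0"
proof -
  let ?F = "\<lambda>y. cis (k * y) / (\<i> * of_real k)"
  have "(\<integral>y. indicator {-pi..pi} y *\<^sub>R cis (k * y) \<partial>lborel) = ?F pi - ?F (-pi)"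
  proof (rule integral_FTC_Icc)
    fix y
    have "((\<lambda>y. cis (k * y)) has_vector_derivative k *\<^sub>R (\<i> * cis (k * y))) (at y within {-pi..pi})"
      unfolding has_vector_derivative_def
      by (rule has_derivative_eq_rhs, rule has_derivative_cis, rule has_derivative_mult_right, rule has_derivative_ident)
         (simp add: fun_eq_iff scaleR_conv_of_real mult_ac)
    then have "(?F has_vector_derivative (k *\<^sub>R (\<i> * cis (k * y))) / (\<i> * of_real k)) (at y within {-pi..pi})"
      by (rule has_vector_derivative_divide)
    then show "(?F has_vector_derivative cis (k * y)) (at y within {-pi..pi})"
      using k by (simp add: scaleR_conv_of_real)
  qed (auto intro!: continuous_intros)
  also have "?F pi - ?F (-pi) = 0"
  proof -
    obtain m :: int where m: "k = of_int m" using k by (auto elim: Ints_cases)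
    have "cis (k * pi) = cis (k * (-pi))"
      by (simp add: complex_eq_iff m sin_zero_iff_int2)
    then show ?thesis by simp
  qed
  finally show ?thesis by (simp only: indicator_scaleR_complex)
qed

lemma integrable_cell_cos: "integrable lborel (\<lambda>x. indicator cell x * cos (\<kappa> \<bullet> x) :: real)"
proof -
  have "integrable lborel (\<lambda>x. indicator cell x *\<^sub>R cos (\<kappa> \<bullet> x))"
    by (rule borel_integrable_compact) (auto intro!: continuous_intros simp: cell_eq_cbox)
  then show ?thesis by simp
qed

text \<open>The cosine of a sum does not factor over the coordinates, but the complex exponential
  does; a single coordinate with nonzero integer frequency makes the product of integrals
  vanish.\<close>

lemma integral_cell_cos:
  fixes \<kappa> :: "real ^ 'n"
  assumes \<kappa>: "\<And>i. \<kappa> $ i \<in> \<int>" and nz: "\<kappa> \<noteq> 0"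
  shows "(\<integral>x. indicator cell x * cos (\<kappa> \<bullet> x) \<partial>lborel) = 0"
proof -
  let ?h = "\<lambda>i y. indicator {-pi..pi} y * cis (\<kappa> $ i * y)"
  obtain j where j: "\<kappa> $ j \<noteq> 0" using nz by (auto simp: vec_eq_iff)
  have "(\<integral>x. (\<Prod>i\<in>UNIV. ?h i ((x :: real ^ 'n) $ i)) \<partial>lborel) = (\<Prod>i\<in>UNIV. integral\<^sup>L lborel (?h i))"
    by (rule integral_lborel_prod_vec[OF integrable_cis])
  also have "\<dots> = 0"
    using integral_cis_period[OF \<kappa> j] by (intro prod_zero) auto
  finally have "Re (\<integral>x. (\<Prod>i\<in>UNIV. ?h i ((x :: real ^ 'n) $ i)) \<partial>lborel) = 0" by simp
  then have "(\<integral>x. Re (\<Prod>i\<in>UNIV. ?h i ((x :: real ^ 'n) $ i)) \<partial>lborel) = 0"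
    by (subst (asm) integral_Re[symmetric]) (rule integrable_lborel_prod_vec[OF integrable_cis])
  moreover have "(\<Prod>i\<in>UNIV. ?h i (x $ i)) = indicator cell x * cis (\<kappa> \<bullet> x)" for x :: "real ^ 'n"
    by (simp add: prod.distrib indicator_cell inner_vec_def cis_sum)
  moreover have "Re (indicator cell x * cis (\<kappa> \<bullet> x)) = indicator cell x * cos (\<kappa> \<bullet> x)" for x :: "real ^ 'n"
    by (simp add: indicator_def)
  ultimately show ?thesis by simp
qed

section \<open>The kernel in one dimension\<close>

lemma norm_sum_cis_squared:
  assumes "finite I"
  shows "(cmod (\<Sum>j\<in>I. cis (\<theta> j)))\<^sup>2 = (\<Sum>j\<in>I. \<Sum>l\<in>I. cos (\<theta> j - \<theta> l))"
proof -
  have "(cmod (\<Sum>j\<in>I. cis (\<theta> j)))\<^sup>2 = (\<Sum>j\<in>I. cos (\<theta> j))\<^sup>2 + (\<Sum>j\<in>I. sin (\<theta> j))\<^sup>2"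
    by (simp add: cmod_power2)
  also have "\<dots> = (\<Sum>j\<in>I. \<Sum>l\<in>I. cos (\<theta> j - \<theta> l))"
    by (simp add: power2_eq_square sum_product cos_diff sum.distrib)
  finally show ?thesis .
qed

text \<open>Normalised to mass 1 on a period (for n > 0). Three properties matter: it is
  nonnegative, it is a cosine polynomial with integer frequencies, and it concentrates at 0.\<close>

definition fejer :: "nat \<Rightarrow> real \<Rightarrow> real" where
  "fejer n y = (cmod (\<Sum>m<n. cis (real m * y)))\<^sup>2 / (2 * pi * real n)"

lemma fejer_nonneg: "0 \<le> fejer n y" by (simp add: fejer_def)

lemma fejer_continuous: "continuous_on UNIV (fejer n)"
  unfolding fejer_def[abs_def] divide_inverse by (intro continuous_intros)

lemma integrable_fejer: "integrable lborel (\<lambda>y. indicator {a..b} y * fejer n y)"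
proof -
  have "integrable lborel (\<lambda>y. indicator {a..b} y *\<^sub>R fejer n y)"
    by (rule borel_integrable_compact) (auto intro: continuous_on_subset[OF fejer_continuous])
  then show ?thesis by simp
qed

lemma integral_cos_period:
  assumes "k \<in> \<int>"
  shows "(\<integral>y. indicator {-pi..pi} y * cos (k * y) \<partial>lborel) = (if k = 0 then 2 * pi else 0)"
proof (cases "k = 0")
  case False
  have "Re (\<integral>y. indicator {-pi..pi} y * cis (k * y) \<partial>lborel) = 0"
    using integral_cis_period[OF assms False] by simp
  then have "(\<integral>y. Re (indicator {-pi..pi} y * cis (k * y)) \<partial>lborel) = 0"
    by (subst (asm) integral_Re[symmetric]) (rule integrable_cis)
  moreover have "Re (indicator {-pi..pi} y * cis (k * y)) = indicator {-pi..pi} y * cos (k * y)" for y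
    by (simp add: indicator_def)
  ultimately show ?thesis using False by simp
qed simp

text \<open>In the double sum of cosines only the n diagonal pairs survive, each contributing 2
  pi/(2 pi n).\<close>

lemma integral_fejer:
  assumes "0 < n" shows "(\<integral>y. indicator {-pi..pi} y * fejer n y \<partial>lborel) = 1"
proof -
  have i: "integrable lborel (\<lambda>y. indicator {-pi..pi} y * cos (k * y) :: real)" for k
  proof -
    have "integrable lborel (\<lambda>y. indicator {-pi..pi} y *\<^sub>R cos (k * y))"
      by (rule borel_integrable_compact) (auto intro!: continuous_intros)
    then show ?thesis by simp
  qed
  have "indicator {-pi..pi} y * fejer n y = (\<Sum>m<n. \<Sum>l<n. (1 / (2 * pi * real n)) * (indicator {-pi..pi} y * cos ((real m - real l) * y)))" for y
    unfolding fejer_def by (subst norm_sum_cis_squared) (simp_all add: sum_distrib_left sum_divide_distrib algebra_simps)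
  then have "(\<integral>y. indicator {-pi..pi} y * fejer n y \<partial>lborel)
     = (\<Sum>m<n. \<Sum>l<n. (1 / (2 * pi * real n)) * (\<integral>y. indicator {-pi..pi} y * cos ((real m - real l) * y) \<partial>lborel))"
    using i by (simp add: Bochner_Integration.integral_sum)
  also have "\<dots> = (\<Sum>m<n. \<Sum>l<n. (1 / (2 * pi * real n)) * (if l = m then 2 * pi else 0))"
    by (intro sum.cong refl arg_cong2[where f="(*)"]) (subst integral_cos_period, auto)
  also have "\<dots> = 1" using assms by (simp add: if_distrib sum.delta cong: if_cong)
  finally show ?thesis .
qed

text \<open>The sum of exponentials is geometric: its numerator has modulus at most 2, and |exp(iy)
  - 1|^2 = 2 - 2 cos y.\<close>

lemma fejer_bound:
  assumes y: "cos y \<noteq> 1"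
  shows "fejer n y \<le> (4 / (2 - 2 * cos y)) / (2 * pi * real n)"
proof -
  have ne: "cis y \<noteq> 1" using y by (auto simp: complex_eq_iff)
  have "(\<Sum>m<n. cis (real m * y)) = (\<Sum>m<n. cis y ^ m)" by (simp add: Complex.DeMoivre)
  also have "\<dots> = (cis y ^ n - 1) / (cis y - 1)" using ne by (rule geometric_sum)
  finally have "cmod (\<Sum>m<n. cis (real m * y)) = cmod (cis y ^ n - 1) / cmod (cis y - 1)"
    by (simp add: norm_divide)
  moreover have "cmod (cis y ^ n - 1) \<le> 2"
    using norm_triangle_ineq4[of "cis y ^ n" 1] by (simp add: norm_power)
  ultimately have "(cmod (\<Sum>m<n. cis (real m * y)))\<^sup>2 \<le> (2 / cmod (cis y - 1))\<^sup>2"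
    by (intro power_mono) (auto intro: divide_right_mono)
  also have "\<dots> = 4 / (cmod (cis y - 1))\<^sup>2" by (simp add: power_divide)
  also have "(cmod (cis y - 1))\<^sup>2 = 2 - 2 * cos y"
    using sin_cos_squared_add[of y] unfolding cmod_power2 by (simp add: power2_eq_square algebra_simps)
  finally show ?thesis unfolding fejer_def by (intro divide_right_mono) auto
qed

lemma integral_fejer_concentrates:
  assumes r: "0 < r" "r \<le> pi"
  shows "(\<lambda>n. \<integral>y. indicator {-r..r} y * fejer n y \<partial>lborel) \<longlonglongrightarrow> 1"
proof (rule tendsto_sandwich)
  \<comment> \<open>For r \<le> |y| \<le> pi the quotient 4/(2 - 2 cos y) is at most
    \<open>c\<close>, so the kernel is at most c/(2 pi n) there and the mass outside [-r,r] is at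
    most c/n.\<close>
  define c where "c = 4 / (2 - 2 * cos r)"
  have cr: "cos r < 1" using cos_monotone_0_pi[of 0 r] r by simp
  show "\<forall>\<^sub>F n in sequentially. (\<integral>y. indicator {-r..r} y * fejer n y \<partial>lborel) \<le> 1"
    using eventually_gt_at_top[of 0]
  proof eventually_elim
    case (elim n)
    have "(\<integral>y. indicator {-r..r} y * fejer n y \<partial>lborel) \<le> (\<integral>y. indicator {-pi..pi} y * fejer n y \<partial>lborel)"
      using r by (intro integral_mono integrable_fejer) (auto simp: indicator_def fejer_nonneg)
    then show ?case using integral_fejer[OF elim] by simp
  qed
  show "\<forall>\<^sub>F n in sequentially. 1 - c / real n \<le> (\<integral>y. indicator {-r..r} y * fejer n y \<partial>lborel)"
    using eventually_gt_at_top[of 0]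
  proof eventually_elim
    case (elim n)
    have pc: "integrable lborel (\<lambda>y::real. indicator {-pi..pi} y * (c / (2 * pi * real n)))"
      by (intro integrable_mult_left) simp
    have "1 = (\<integral>y. indicator {-pi..pi} y * fejer n y \<partial>lborel)" using integral_fejer[OF elim] by simp
    also have "\<dots> \<le> (\<integral>y. indicator {-r..r} y * fejer n y + indicator {-pi..pi} y * (c / (2 * pi * real n)) \<partial>lborel)"
    proof (rule integral_mono[OF integrable_fejer Bochner_Integration.integrable_add[OF integrable_fejer pc]])
      fix y
      have c0: "0 \<le> c / (2 * pi * real n)" using cr by (simp add: c_def)
      show "indicator {-pi..pi} y * fejer n y \<le> indicator {-r..r} y * fejer n y + indicator {-pi..pi} y * (c / (2 * pi * real n))"
      proof (cases "y \<in> {-pi..pi} \<and> y \<notin> {-r..r}")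
        case True
        then have y: "r \<le> \<bar>y\<bar>" "\<bar>y\<bar> \<le> pi" by auto
        have "cos y \<le> cos r" using cos_monotone_0_pi_le[of r "\<bar>y\<bar>"] r y by simp
        then have "4 / (2 - 2 * cos y) \<le> c" "cos y \<noteq> 1" using cr by (auto simp: c_def intro!: divide_left_mono mult_pos_pos)
        then have "fejer n y \<le> c / (2 * pi * real n)"
          using fejer_bound[of y n] by (intro order_trans[OF fejer_bound divide_right_mono]) auto
        then show ?thesis using True by simp
      next
        case False
        then show ?thesis using c0 fejer_nonneg[of n y] by (auto simp: indicator_def)
      qed
    qed
    also have "\<dots> = (\<integral>y. indicator {-r..r} y * fejer n y \<partial>lborel) + c / real n"
      by (subst Bochner_Integration.integral_add[OF integrable_fejer pc]) (simp add: field_simps)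
    finally show ?case by simp
  qed
  have "(\<lambda>n. 1 - c * inverse (real n)) \<longlonglongrightarrow> 1 - c * 0"
    by (intro tendsto_intros lim_inverse_n)
  then show "(\<lambda>n. 1 - c / real n) \<longlonglongrightarrow> 1" by (simp add: divide_inverse)
qed simp

section \<open>The product kernel in N dimensions\<close>

definition Fejer :: "nat \<Rightarrow> real ^ 'n \<Rightarrow> real" where
  "Fejer n x = (\<Prod>i\<in>UNIV. fejer n (x $ i))"

definition freq_set :: "nat \<Rightarrow> ('n::finite \<Rightarrow> nat) set" where
  "freq_set n = PiE UNIV (\<lambda>_. {..<n})"

lemma finite_freq_set: "finite (freq_set n)"
  unfolding freq_set_def by (intro finite_PiE) auto

lemma Fejer_nonneg: "0 \<le> Fejer n x"
  unfolding Fejer_def by (intro prod_nonneg ballI fejer_nonneg)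

text \<open>Multiplying out the product gives one exponential per multi-index, and its squared
  modulus one cosine per pair of multi-indices. The frequencies are differences of multi-indices,
  hence integer vectors, as the periodicity argument requires.\<close>

lemma Fejer_cos_expansion:
  fixes x :: "real ^ 'n"
  shows "Fejer n x = (\<Sum>j\<in>freq_set n. \<Sum>l\<in>freq_set n.
    (1 / (2 * pi * real n) ^ CARD('n)) * cos ((\<chi> i. real (j i) - real (l i)) \<bullet> x))"
proof -
  let ?\<theta> = "\<lambda>j :: 'n \<Rightarrow> nat. \<Sum>i\<in>UNIV. real (j i) * x $ i"
  have "(\<Prod>i\<in>UNIV. \<Sum>m<n. cis (real m * x $ i)) = (\<Sum>j\<in>freq_set n. \<Prod>i\<in>UNIV. cis (real (j i) * x $ i))"
    unfolding freq_set_def by (rule prod_sum_PiE) auto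
  also have "\<dots> = (\<Sum>j\<in>freq_set n. cis (?\<theta> j))" by (simp add: cis_sum)
  finally have "(cmod (\<Prod>i\<in>UNIV. \<Sum>m<n. cis (real m * x $ i)))\<^sup>2 = (\<Sum>j\<in>freq_set n. \<Sum>l\<in>freq_set n. cos (?\<theta> j - ?\<theta> l))"
    by (simp add: norm_sum_cis_squared[OF finite_freq_set])
  moreover have "?\<theta> j - ?\<theta> l = (\<chi> i. real (j i) - real (l i)) \<bullet> x" for j l
    by (simp add: inner_vec_def sum_subtractf left_diff_distrib)
  moreover have "Fejer n x = (cmod (\<Prod>i\<in>UNIV. \<Sum>m<n. cis (real m * x $ i)))\<^sup>2 / (2 * pi * real n) ^ CARD('n)"
    by (simp add: Fejer_def fejer_def prod_dividef prod_norm[symmetric] prod_power_distrib)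
  ultimately show ?thesis by (simp add: sum_divide_distrib)
qed

lemma
  fixes r :: real
  shows integral_Fejer_cube: "(\<integral>x. indicator {x. \<forall>i. x $ i \<in> {-r..r}} x * Fejer n (x :: real ^ 'n) \<partial>lborel)
       = (\<integral>y. indicator {-r..r} y * fejer n y \<partial>lborel) ^ CARD('n)"
    and integrable_Fejer_cube: "integrable lborel (\<lambda>x. indicator {x. \<forall>i. x $ i \<in> {-r..r}} x * Fejer n (x :: real ^ 'n))"
proof -
  have eq: "(\<Prod>i\<in>UNIV. indicator {-r..r} (x $ i) * fejer n (x $ i)) = indicator {x. \<forall>i. x $ i \<in> {-r..r}} x * Fejer n x" for x :: "real ^ 'n"
    by (auto simp: prod.distrib Fejer_def indicator_def)
  show "(\<integral>x. indicator {x. \<forall>i. x $ i \<in> {-r..r}} x * Fejer n (x :: real ^ 'n) \<partial>lborel)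
       = (\<integral>y. indicator {-r..r} y * fejer n y \<partial>lborel) ^ CARD('n)"
    using integral_lborel_prod_vec[of "\<lambda>(_::'n) y. indicator {-r..r} y * fejer n y", OF integrable_fejer] by (simp only: eq prod_constant)
  show "integrable lborel (\<lambda>x. indicator {x. \<forall>i. x $ i \<in> {-r..r}} x * Fejer n (x :: real ^ 'n))"
    using integrable_lborel_prod_vec[of "\<lambda>(_::'n) y. indicator {-r..r} y * fejer n y", OF integrable_fejer] by (simp only: eq)
qed

section \<open>Solutions with a concentrated source\<close>

text \<open>Integrate the equation over (0,S) and one cell. The Laplacian disappears, since modes of
  nonzero frequency have integral 0. The fractional derivative becomes the convolution
  g_{1-\<alpha>} * u at time S, in which g_{1-\<alpha>}(S - t) is at least
  g_{1-\<alpha>}(S).\<close>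

lemma mode_mass_bound:
  fixes \<kappa> :: "'i \<Rightarrow> real ^ 'n"
  assumes \<alpha>: "0 < \<alpha>" "\<alpha> < 1" and S: "0 < S" and J: "finite J" and b: "\<And>i. i \<in> J \<Longrightarrow> 1 + \<alpha> \<le> b i"
    and \<kappa>: "\<And>i j. i \<in> J \<Longrightarrow> \<kappa> i $ j \<in> \<int>"
    and u: "\<And>t x. 0 < t \<Longrightarrow> t < S \<Longrightarrow> 0 \<le> mode_sum J A b \<kappa> t x"
  shows "integrable (lborel \<Otimes>\<^sub>M lborel) (\<lambda>z. indicator {0<..<S} (fst z) * indicator cell (snd z) * mode_source \<alpha> J A b \<kappa> (fst z) (snd z))" (is ?int)
    and "g_kernel (1 - \<alpha>) S * (\<integral>z. indicator ({0<..<S} \<times> cell) z * mode_sum J A b \<kappa> (fst z) (snd z) \<partial>(lborel \<Otimes>\<^sub>M lborel))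
      \<le> (\<integral>z. indicator {0<..<S} (fst z) * indicator cell (snd z) * mode_source \<alpha> J A b \<kappa> (fst z) (snd z) \<partial>(lborel \<Otimes>\<^sub>M lborel))" (is "?L \<le> ?R")
proof -
  have bp: "0 < b i" "1 \<le> b i - \<alpha>" "0 < b i - \<alpha>" "1 \<le> b i" if "i \<in> J" for i
    using b[OF that] \<alpha> by linarith+
  let ?q = "\<lambda>i x. indicator cell x * cos (\<kappa> i \<bullet> x)"
  let ?p1 = "\<lambda>i t. indicator {0<..<S} t * g_kernel (b i - \<alpha>) t"
  let ?p2 = "\<lambda>i t. indicator {0<..<S} t * g_kernel (b i) t"
  let ?p3 = "\<lambda>i t. indicator {0<..<S} t * (g_kernel (1 - \<alpha>) (S - t) * g_kernel (b i) t)"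
  note q = integrable_cell_cos
  have p1: "has_bochner_integral lborel (?p1 i) (g_kernel (b i - \<alpha> + 1) S)" if "i \<in> J" for i
    by (rule has_bochner_integral_g_kernel[OF bp(3)[OF that] S])
  have p2: "integrable lborel (?p2 i)" if "i \<in> J" for i
    using has_bochner_integral_g_kernel[OF bp(1)[OF that] S] by (simp add: has_bochner_integral_iff)
  have p3: "has_bochner_integral lborel (?p3 i) (g_kernel (1 - \<alpha> + b i) S)" if "i \<in> J" for i
    using \<alpha> bp[OF that] S by (intro has_bochner_integral_g_kernel_conv) auto
  have I1: "integrable lborel (?p1 i)" and I3: "integrable lborel (?p3 i)"
    and I13: "integral\<^sup>L lborel (?p1 i) = integral\<^sup>L lborel (?p3 i)" if "i \<in> J" for i
    using p1[OF that] p3[OF that] by (auto simp: has_bochner_integral_iff algebra_simps)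
  let ?F1 = "\<lambda>z. \<Sum>i\<in>J. A i * (?p1 i (fst z) * ?q i (snd z))"
  let ?F2 = "\<lambda>z. \<Sum>i\<in>J. (A i * (norm (\<kappa> i))\<^sup>2) * (?p2 i (fst z) * ?q i (snd z))"
  let ?F3 = "\<lambda>z. \<Sum>i\<in>J. A i * (?p3 i (fst z) * ?q i (snd z))"
  have F: "integrable (lborel \<Otimes>\<^sub>M lborel) ?F1" "integrable (lborel \<Otimes>\<^sub>M lborel) ?F2"
    "integrable (lborel \<Otimes>\<^sub>M lborel) ?F3"
    by (intro integrable_separable_sum I1 p2 I3 q; assumption)+
  have e13: "integral\<^sup>L (lborel \<Otimes>\<^sub>M lborel) ?F1 = integral\<^sup>L (lborel \<Otimes>\<^sub>M lborel) ?F3"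
  proof -
    have "integral\<^sup>L (lborel \<Otimes>\<^sub>M lborel) ?F1 = (\<Sum>i\<in>J. A i * (integral\<^sup>L lborel (?p1 i) * integral\<^sup>L lborel (?q i)))"
      by (rule integral_separable_sum[OF I1 q])
    also have "\<dots> = (\<Sum>i\<in>J. A i * (integral\<^sup>L lborel (?p3 i) * integral\<^sup>L lborel (?q i)))"
      by (intro sum.cong refl) (simp only: I13)
    also have "\<dots> = integral\<^sup>L (lborel \<Otimes>\<^sub>M lborel) ?F3"
      by (rule integral_separable_sum[OF I3 q, symmetric])
    finally show ?thesis .
  qed
  have e2: "integral\<^sup>L (lborel \<Otimes>\<^sub>M lborel) ?F2 = 0"
  proof -
    have "integral\<^sup>L (lborel \<Otimes>\<^sub>M lborel) ?F2 = (\<Sum>i\<in>J. (A i * (norm (\<kappa> i))\<^sup>2) * (integral\<^sup>L lborel (?p2 i) * integral\<^sup>L lborel (?q i)))"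
      by (rule integral_separable_sum[OF p2 q])
    also have "\<dots> = 0"
    proof (intro sum.neutral ballI)
      fix i assume "i \<in> J"
      then show "(A i * (norm (\<kappa> i))\<^sup>2) * (integral\<^sup>L lborel (?p2 i) * integral\<^sup>L lborel (?q i)) = 0"
        using integral_cell_cos[OF \<kappa>, of i] by (cases "\<kappa> i = 0") auto
    qed
    finally show ?thesis .
  qed
  have src: "indicator {0<..<S} (fst z) * indicator cell (snd z) * mode_source \<alpha> J A b \<kappa> (fst z) (snd z) = ?F1 z + ?F2 z" for z
    unfolding mode_source_def sum_distrib_left sum.distrib[symmetric]
    by (intro sum.cong refl) (simp add: distrib_left distrib_right mult_ac)
  show ?int unfolding src using F by simp
  have "?L = (\<integral>z. g_kernel (1 - \<alpha>) S * (indicator ({0<..<S} \<times> cell) z * mode_sum J A b \<kappa> (fst z) (snd z)) \<partial>(lborel \<Otimes>\<^sub>M lborel))"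
    by (rule integral_mult_right_zero[symmetric])
  also have "\<dots> \<le> integral\<^sup>L (lborel \<Otimes>\<^sub>M lborel) ?F3"
  proof (rule integral_mono)
    show "integrable (lborel \<Otimes>\<^sub>M lborel) (\<lambda>z. g_kernel (1 - \<alpha>) S * (indicator ({0<..<S} \<times> cell) z * mode_sum J A b \<kappa> (fst z) (snd z)))"
      by (intro integrable_mult_right integrable_mode_sum_bounded bp bounded_cell cell_measurable)
    show "integrable (lborel \<Otimes>\<^sub>M lborel) ?F3" by (rule F)
    fix z :: "real \<times> (real ^ 'n)"
    obtain t x where z: "z = (t, x)" by (cases z)
    show "g_kernel (1 - \<alpha>) S * (indicator ({0<..<S} \<times> cell) z * mode_sum J A b \<kappa> (fst z) (snd z)) \<le> ?F3 z"
    proof (cases "t \<in> {0<..<S} \<and> x \<in> cell")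
      case True
      have eq: "?F3 z = g_kernel (1 - \<alpha>) (S - t) * mode_sum J A b \<kappa> t x"
        unfolding z mode_sum_def sum_distrib_left using True
        by (intro sum.cong refl) (simp add: algebra_simps)
      have "g_kernel (1 - \<alpha>) S * mode_sum J A b \<kappa> t x \<le> g_kernel (1 - \<alpha>) (S - t) * mode_sum J A b \<kappa> t x"
        using True \<alpha> u[of t x] by (intro mult_right_mono g_kernel_antimono) auto
      then show ?thesis using True unfolding eq by (simp add: z)
    qed (auto simp: z indicator_def)
  qed
  also have "\<dots> = ?R" unfolding src using F e13 e2 by simp
  finally show "?L \<le> ?R" .
qed

text \<open>A probability density on [0,1] that concentrates at 0 as M grows. It is a polynomial in
  t, hence a finite combination of kernels with integer exponents.\<close>

definition time_peak :: "nat \<Rightarrow> real \<Rightarrow> real" where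
  "time_peak M t = real (Suc M) * (1 - t) ^ M"

lemma time_peak_nonneg: "t \<le> 1 \<Longrightarrow> 0 \<le> time_peak M t"
  by (simp add: time_peak_def)

lemma time_peak_expansion:
  assumes "0 < t"
  shows "time_peak M t = (\<Sum>m\<le>M. (real (Suc M) * real (M choose m) * (-1) ^ m * fact m) * g_kernel (real m + 1) t)"
proof -
  have "(1 - t) ^ M = (\<Sum>m\<le>M. real (M choose m) * (- t) ^ m)"
    using binomial_ring[of "- t" 1 M] by simp
  then show ?thesis
    unfolding time_peak_def sum_distrib_left g_kernel_nat[OF assms]
    by (simp add: sum_distrib_left power_minus[of t] mult_ac)
qed

lemma has_bochner_integral_time_peak:
  assumes "0 \<le> s"
  shows "has_bochner_integral lborel (\<lambda>t. indicator {0..s} t * time_peak M t) (1 - (1 - s) ^ Suc M)"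
proof -
  have d: "((\<lambda>t. - ((1 - t) ^ Suc M)) has_real_derivative time_peak M t) (at t)" for t
    unfolding time_peak_def by (auto intro!: derivative_eq_intros simp del: power_Suc)
  have "has_bochner_integral lborel (\<lambda>t. time_peak M t * indicator {0..s} t) (- ((1 - s) ^ Suc M) - - ((1 - 0) ^ Suc M))"
  proof (rule has_bochner_integral_FTC_Icc_real)
    show "isCont (time_peak M) t" for t
      unfolding time_peak_def[abs_def] by (intro continuous_intros)
  qed (use assms d in auto)
  then show ?thesis by (simp add: mult.commute)
qed

text \<open>Truncating the Mittag-Leffler series of the solution with source \<open>time_peak M t * Fejer n x\<close>
  leaves a remainder that is uniformly small; it is absorbed by a spatially constant term.\<close>

lemma mode_source_approximation:
  fixes \<epsilon> \<alpha> :: real and n M :: nat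
  assumes \<alpha>: "0 < \<alpha>" "\<alpha> < 1" and \<epsilon>: "0 < \<epsilon>"
  obtains J :: "(('n::finite \<Rightarrow> nat) \<times> ('n \<Rightarrow> nat) \<times> nat \<times> nat) option set" and A b and \<kappa> :: "_ \<Rightarrow> real ^ 'n"
  where "finite J" "\<And>i. 1 + \<alpha> \<le> b i" "\<And>i j. \<kappa> i $ j \<in> \<int>"
    "\<And>t x. 0 < t \<Longrightarrow> t \<le> 1 \<Longrightarrow> time_peak M t * Fejer n x \<le> mode_source \<alpha> J A b \<kappa> t x"
    "\<And>t x. 0 < t \<Longrightarrow> t \<le> 1 \<Longrightarrow> mode_source \<alpha> J A b \<kappa> t x \<le> time_peak M t * Fejer n x + 2 * \<epsilon>"
proof -
  let ?k = "\<lambda>j l :: 'n \<Rightarrow> nat. (\<chi> i. real (j i) - real (l i)) :: real ^ 'n"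
  let ?P = "freq_set n :: ('n \<Rightarrow> nat) set"
  define c where "c = 1 / (2 * pi * real n) ^ CARD('n)"
  define a where "a m = real (Suc M) * real (M choose m) * (-1) ^ m * fact m" for m
  define lam where "lam j l = (norm (?k j l))\<^sup>2" for j l
  \<comment> \<open>The total remainder after Q terms of the series, with each cosine bounded by 1
    and the kernels taken at t = 1, where they are largest on (0,1].\<close>
  define E where "E Q = (\<Sum>j\<in>?P. \<Sum>l\<in>?P. \<Sum>m\<le>M. \<bar>c * a m\<bar> * (lam j l ^ Q * g_kernel (real m + 1 + \<alpha> * real Q) 1))" for Q
  have "E \<longlonglongrightarrow> (\<Sum>j\<in>?P. \<Sum>l\<in>?P. \<Sum>m\<le>M. \<bar>c * a m\<bar> * 0)"
    unfolding E_def[abs_def]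
    by (intro tendsto_intros power_over_Gamma_tendsto_0 \<alpha>) (auto simp: lam_def)
  then have "eventually (\<lambda>Q. E Q < \<epsilon>) sequentially"
    using \<epsilon> by (intro order_tendstoD(2)) auto
  then obtain Q where Q: "E Q < \<epsilon>" by (auto simp: eventually_sequentially)
  \<comment> \<open>\<open>None\<close> is the spatially constant mode \<epsilon> g_{1+\<alpha>},
    whose source is exactly \<epsilon> for t > 0. \<open>Some (j, l, m, q)\<close> is the q-th
    Mittag-Leffler term for the frequency j - l and the monomial t^m.\<close>
  define J where "J = insert None (Some ` (?P \<times> ?P \<times> {..M} \<times> {..<Q}))"
  define A where "A i = (case i of None \<Rightarrow> \<epsilon> | Some (j, l, m, q) \<Rightarrow> c * a m * (- lam j l) ^ q)" for i :: "(('n \<Rightarrow> nat) \<times> ('n \<Rightarrow> nat) \<times> nat \<times> nat) option"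
  define b where "b i = (case i of None \<Rightarrow> 1 + \<alpha> | Some (j, l, m, q) \<Rightarrow> real m + 1 + \<alpha> * real (Suc q))" for i :: "(('n \<Rightarrow> nat) \<times> ('n \<Rightarrow> nat) \<times> nat \<times> nat) option"
  define \<kappa> where "\<kappa> i = (case i of None \<Rightarrow> 0 | Some (j, l, m, q) \<Rightarrow> ?k j l)" for i :: "(('n \<Rightarrow> nat) \<times> ('n \<Rightarrow> nat) \<times> nat \<times> nat) option"
  have fin: "finite J" unfolding J_def by (intro finite.insertI finite_imageI finite_cartesian_product finite_freq_set) auto
  have b1: "1 + \<alpha> \<le> b i" for i
    using \<alpha> by (auto simp: b_def algebra_simps split: option.split)
  have kZ: "\<kappa> i $ j \<in> \<int>" for i j
    by (auto simp: \<kappa>_def split: option.split)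
  have src: "mode_source \<alpha> J A b \<kappa> t x = \<epsilon> + (time_peak M t * Fejer n x
      - (\<Sum>j\<in>?P. \<Sum>l\<in>?P. \<Sum>m\<le>M. c * a m * ((- lam j l) ^ Q * g_kernel (real m + 1 + \<alpha> * real Q) t) * cos (?k j l \<bullet> x)))"
    if t: "0 < t" for t x
  proof -
    let ?h = "\<lambda>i. A i * (g_kernel (b i - \<alpha>) t + (norm (\<kappa> i))\<^sup>2 * g_kernel (b i) t) * cos (\<kappa> i \<bullet> x)"
    have "mode_source \<alpha> J A b \<kappa> t x = ?h None + (\<Sum>i\<in>Some ` (?P \<times> ?P \<times> {..M} \<times> {..<Q}). ?h i)"
      unfolding mode_source_def J_def
      by (rule sum.insert) (auto intro!: finite_imageI finite_cartesian_product finite_freq_set)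
    also have "?h None = \<epsilon>" using t by (simp add: A_def b_def \<kappa>_def)
    also have "(\<Sum>i\<in>Some ` (?P \<times> ?P \<times> {..M} \<times> {..<Q}). ?h i) = (\<Sum>i\<in>?P \<times> ?P \<times> {..M} \<times> {..<Q}. ?h (Some i))"
      by (simp add: sum.reindex)
    also have "\<dots> = (\<Sum>j\<in>?P. \<Sum>l\<in>?P. \<Sum>m\<le>M. \<Sum>q<Q. ?h (Some (j, l, m, q)))"
      unfolding sum.cartesian_product by (intro sum.cong refl) auto
    also have "\<dots> = (\<Sum>j\<in>?P. \<Sum>l\<in>?P. \<Sum>m\<le>M. c * a m * (g_kernel (real m + 1) t - (- lam j l) ^ Q * g_kernel (real m + 1 + \<alpha> * real Q) t) * cos (?k j l \<bullet> x))"
    proof (intro sum.cong refl)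
      fix j l m
      let ?G = "\<lambda>q. (- lam j l) ^ q * g_kernel (real m + 1 + \<alpha> * real q) t"
      \<comment> \<open>The fractional derivative lowers the exponent by \<alpha> and gives
        \<open>?G q\<close>; the Laplacian contributes \<open>- ?G (Suc q)\<close>. So the sources
        of the terms telescope, leaving the desired kernel and one remainder.\<close>
      have "?h (Some (j, l, m, q)) = (c * a m * cos (?k j l \<bullet> x)) * (?G q - ?G (Suc q))" for q
        by (simp add: A_def b_def \<kappa>_def lam_def[symmetric] algebra_simps)
      then have "(\<Sum>q<Q. ?h (Some (j, l, m, q))) = (c * a m * cos (?k j l \<bullet> x)) * (\<Sum>q<Q. ?G q - ?G (Suc q))"
        by (simp only: sum_distrib_left)
      also have "(\<Sum>q<Q. ?G q - ?G (Suc q)) = ?G 0 - ?G Q" by (rule sum_lessThan_telescope')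
      finally show "(\<Sum>q<Q. ?h (Some (j, l, m, q))) = c * a m * (g_kernel (real m + 1) t - (- lam j l) ^ Q * g_kernel (real m + 1 + \<alpha> * real Q) t) * cos (?k j l \<bullet> x)"
        by (simp add: mult_ac)
    qed
    also have "\<dots> = (\<Sum>j\<in>?P. \<Sum>l\<in>?P. \<Sum>m\<le>M. c * a m * g_kernel (real m + 1) t * cos (?k j l \<bullet> x))
        - (\<Sum>j\<in>?P. \<Sum>l\<in>?P. \<Sum>m\<le>M. c * a m * ((- lam j l) ^ Q * g_kernel (real m + 1 + \<alpha> * real Q) t) * cos (?k j l \<bullet> x))"
      by (simp add: sum_subtractf right_diff_distrib left_diff_distrib)
    also have "(\<Sum>j\<in>?P. \<Sum>l\<in>?P. \<Sum>m\<le>M. c * a m * g_kernel (real m + 1) t * cos (?k j l \<bullet> x)) = time_peak M t * Fejer n x"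
    proof -
      have "(\<Sum>m\<le>M. c * a m * g_kernel (real m + 1) t * cos (?k j l \<bullet> x)) = time_peak M t * (c * cos (?k j l \<bullet> x))" for j l
        unfolding time_peak_expansion[OF t] a_def[symmetric] sum_distrib_right by (simp add: mult_ac)
      then show ?thesis unfolding Fejer_cos_expansion c_def[symmetric] by (simp only: sum_distrib_left)
    qed
    finally show ?thesis .
  qed
  have err: "\<bar>\<Sum>j\<in>?P. \<Sum>l\<in>?P. \<Sum>m\<le>M. c * a m * ((- lam j l) ^ Q * g_kernel (real m + 1 + \<alpha> * real Q) t) * cos (?k j l \<bullet> x)\<bar> \<le> \<epsilon>"
    if t: "0 < t" "t \<le> 1" for t x
  proof -
    have "\<bar>\<Sum>j\<in>?P. \<Sum>l\<in>?P. \<Sum>m\<le>M. c * a m * ((- lam j l) ^ Q * g_kernel (real m + 1 + \<alpha> * real Q) t) * cos (?k j l \<bullet> x)\<bar> \<le> E Q"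
      unfolding E_def
    proof (intro order_trans[OF sum_abs sum_mono])
      fix j l m
      have g: "1 \<le> real m + 1 + \<alpha> * real Q" using \<alpha> by simp
      have "g_kernel (real m + 1 + \<alpha> * real Q) t \<le> g_kernel (real m + 1 + \<alpha> * real Q) 1"
        using t by (intro g_kernel_mono g) auto
      moreover have "0 \<le> g_kernel (real m + 1 + \<alpha> * real Q) t" using g by (intro g_kernel_nonneg) auto
      ultimately have "\<bar>c * a m\<bar> * (lam j l ^ Q * g_kernel (real m + 1 + \<alpha> * real Q) t) * \<bar>cos (?k j l \<bullet> x)\<bar> \<le> \<bar>c * a m\<bar> * (lam j l ^ Q * g_kernel (real m + 1 + \<alpha> * real Q) 1) * 1"
        by (intro mult_mono mult_nonneg_nonneg) (auto simp: lam_def)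
      moreover have "\<bar>c * a m * ((- lam j l) ^ Q * g_kernel (real m + 1 + \<alpha> * real Q) t) * cos (?k j l \<bullet> x)\<bar> = \<bar>c * a m\<bar> * (lam j l ^ Q * g_kernel (real m + 1 + \<alpha> * real Q) t) * \<bar>cos (?k j l \<bullet> x)\<bar>"
        using \<open>0 \<le> g_kernel (real m + 1 + \<alpha> * real Q) t\<close> by (simp add: abs_mult power_abs lam_def)
      ultimately show "\<bar>c * a m * ((- lam j l) ^ Q * g_kernel (real m + 1 + \<alpha> * real Q) t) * cos (?k j l \<bullet> x)\<bar>
         \<le> \<bar>c * a m\<bar> * (lam j l ^ Q * g_kernel (real m + 1 + \<alpha> * real Q) 1)" by linarith
    qed
    then show ?thesis using Q by linarith
  qed
  show ?thesis
  proof (rule that[of J b \<kappa> A])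
    show "finite J" by (rule fin)
    show "1 + \<alpha> \<le> b i" for i by (rule b1)
    show "\<kappa> i $ j \<in> \<int>" for i j by (rule kZ)
    fix t :: real and x :: "real ^ 'n" assume t: "0 < t" "t \<le> 1"
    show "time_peak M t * Fejer n x \<le> mode_source \<alpha> J A b \<kappa> t x"
      using src[OF t(1), of x] err[OF t, of x] by linarith
    show "mode_source \<alpha> J A b \<kappa> t x \<le> time_peak M t * Fejer n x + 2 * \<epsilon>"
      using src[OF t(1), of x] err[OF t, of x] by linarith
  qed
qed

text \<open>The cube lies in the ball of radius \<rho>/2, where the base is at least 3/4, and
  (3/4)^3 = 27/64.\<close>

lemma cutoff_ge_on_cube:
  fixes x :: "real ^ 'n"
  assumes \<rho>: "0 < \<rho>" and x: "\<And>i. \<bar>x $ i\<bar> \<le> \<rho> / (2 * sqrt (real CARD('n)))"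
  shows "1 / 4 \<le> cutoff \<rho> x"
proof -
  have n: "(norm x)\<^sup>2 = (\<Sum>i\<in>UNIV. (x $ i)\<^sup>2)"
    unfolding power2_norm_eq_inner inner_vec_def by (simp add: power2_eq_square)
  have "(x $ i)\<^sup>2 \<le> \<rho>\<^sup>2 / (4 * real CARD('n))" for i
    using power_mono[OF x[of i], of 2] by (simp add: power_divide power_mult_distrib)
  then have "(norm x)\<^sup>2 \<le> (\<Sum>i\<in>(UNIV::'n set). \<rho>\<^sup>2 / (4 * real CARD('n)))"
    unfolding n by (intro sum_mono)
  then have "(norm x)\<^sup>2 \<le> \<rho>\<^sup>2 / 4" by simp
  then have "3 / 4 \<le> cutoff_base \<rho> x" using \<rho> by (simp add: cutoff_base_def le_max_iff_disj field_simps)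
  then have "(3 / 4) ^ 3 \<le> cutoff \<rho> x" unfolding cutoff_def by (intro power_mono) auto
  moreover have "(1 / 4 :: real) \<le> (3 / 4) ^ 3" by (simp add: power3_eq_cube)
  ultimately show ?thesis by linarith
qed

text \<open>One source serves all scales k \<le> K: it is concentrated at the smallest scale K, and
  there the ramps and cutoffs of all larger scales are bounded below too. The bounds 2 and 1/32 do
  not depend on K, which is what the final argument lives on.\<close>

lemma concentrated_mode_source:
  fixes \<alpha> :: real and K :: nat
  assumes \<alpha>: "0 < \<alpha>" "\<alpha> < 1"
  obtains J :: "(('n::finite \<Rightarrow> nat) \<times> ('n \<Rightarrow> nat) \<times> nat \<times> nat) option set" and A b and \<kappa> :: "_ \<Rightarrow> real ^ 'n"
  where "finite J" "\<And>i. 1 + \<alpha> \<le> b i" "\<And>i j. \<kappa> i $ j \<in> \<int>"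
    "\<And>t x. 0 < t \<Longrightarrow> t \<le> 1 \<Longrightarrow> 0 \<le> mode_source \<alpha> J A b \<kappa> t x"
    "\<And>t x. 0 \<le> t \<Longrightarrow> t \<le> 1 \<Longrightarrow> 0 \<le> mode_sum J A b \<kappa> t x"
    "(\<integral>z. indicator {0<..<1} (fst z) * indicator cell (snd z) * mode_source \<alpha> J A b \<kappa> (fst z) (snd z) \<partial>(lborel \<Otimes>\<^sub>M lborel)) \<le> 2"
    "\<And>k T. k \<le> K \<Longrightarrow> T = ((1/2) ^ k) powr (2 / \<alpha>) \<Longrightarrow> 1 / 32 \<le> (\<integral>z. indicator {0<..<T} (fst z) * (1 - fst z / T) * cutoff ((1/2) ^ k) (snd z) *
        mode_source \<alpha> J A b \<kappa> (fst z) (snd z) \<partial>(lborel \<Otimes>\<^sub>M lborel))"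
proof -
  define \<rho> where "\<rho> k = (1/2 :: real) ^ k" for k :: nat
  define T where "T k = \<rho> k powr (2 / \<alpha>)" for k
  have \<rho>: "0 < \<rho> k" "\<rho> k \<le> 1" for k by (auto simp: \<rho>_def power_le_one)
  have \<rho>K: "\<rho> K \<le> \<rho> k" if "k \<le> K" for k unfolding \<rho>_def using that by (intro power_decreasing) auto
  have T: "0 < T k" "T k \<le> 1" for k using \<rho>[of k] \<alpha> by (auto simp: T_def powr_le_one_le intro!: powr_le1)
  have TK: "T K \<le> T k" if "k \<le> K" for k unfolding T_def using \<rho>K[OF that] \<rho>[of K] \<alpha> by (intro powr_mono2) auto
  \<comment> \<open>Half the side of a cube on which the cutoff of scale K, and so of every scale k
    \<le> K, is at least 1/4.\<close>
  define r where "r = \<rho> K / (2 * sqrt (real CARD('n)))"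
  have N1: "1 \<le> sqrt (real CARD('n))" by (simp add: Suc_leI)
  have r: "0 < r" "r \<le> 1"
  proof -
    have "\<rho> K \<le> 2 * sqrt (real CARD('n))" using \<rho>[of K] N1 by linarith
    then show "r \<le> 1" using N1 by (simp add: r_def divide_le_eq_1)
    show "0 < r" using \<rho>[of K] N1 by (simp add: r_def)
  qed
  then have rpi: "r \<le> pi" using pi_gt3 by linarith
  \<comment> \<open>Up to this time the ramp of every scale k \<le> K is at least 1/2.\<close>
  define s where "s = T K / 2"
  have s: "0 < s" "s < 1" "s \<le> T K / 2" using T[of K] by (auto simp: s_def)
  have "(\<lambda>n. (\<integral>y. indicator {-r..r} y * fejer n y \<partial>lborel) ^ CARD('n)) \<longlonglongrightarrow> 1 ^ CARD('n)"
    by (intro tendsto_power integral_fejer_concentrates r rpi)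
  then have "eventually (\<lambda>n. 1/2 < (\<integral>y. indicator {-r..r} y * fejer n y \<partial>lborel) ^ CARD('n)) sequentially"
    by (intro order_tendstoD(1)) auto
  then have "eventually (\<lambda>n. 0 < n \<and> 1/2 < (\<integral>y. indicator {-r..r} y * fejer n y \<partial>lborel) ^ CARD('n)) sequentially"
    using eventually_gt_at_top[of 0] by eventually_elim auto
  then obtain n where n: "0 < n" "1/2 < (\<integral>y. indicator {-r..r} y * fejer n y \<partial>lborel) ^ CARD('n)"
    by (auto simp: eventually_sequentially)
  have "(\<lambda>M. (1 - s) ^ Suc M) \<longlonglongrightarrow> 0"
    using s by (intro LIMSEQ_Suc LIMSEQ_power_zero) auto
  then have "eventually (\<lambda>M. (1 - s) ^ Suc M < 1/2) sequentially"
    by (intro order_tendstoD(2)) auto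
  then obtain M where M: "(1 - s) ^ Suc M < 1/2" by (auto simp: eventually_sequentially)
  define m where "m = measure lborel (cell :: (real ^ 'n) set)"
  \<comment> \<open>The excess 2 \<epsilon> of the source then adds at most 1 to the mass over the
    cell, whose volume is \<open>m\<close>.\<close>
  define \<epsilon> where "\<epsilon> = 1 / (2 * (m + 1))"
  have m: "0 \<le> m" by (simp add: m_def)
  have \<epsilon>: "0 < \<epsilon>" "2 * \<epsilon> * m \<le> 1" using m by (auto simp: \<epsilon>_def field_simps)
  obtain J :: "(('n::finite \<Rightarrow> nat) \<times> ('n \<Rightarrow> nat) \<times> nat \<times> nat) option set" and A b and \<kappa> :: "_ \<Rightarrow> real ^ 'n"
    where J: "finite J" and b: "\<And>i. 1 + \<alpha> \<le> b i" and \<kappa>: "\<And>i j. \<kappa> i $ j \<in> \<int>"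
    and lo: "\<And>t x. 0 < t \<Longrightarrow> t \<le> 1 \<Longrightarrow> time_peak M t * Fejer n x \<le> mode_source \<alpha> J A b \<kappa> t x"
    and hi: "\<And>t x. 0 < t \<Longrightarrow> t \<le> 1 \<Longrightarrow> mode_source \<alpha> J A b \<kappa> t x \<le> time_peak M t * Fejer n x + 2 * \<epsilon>"
    by (rule mode_source_approximation[OF \<alpha> \<epsilon>(1), of M n]) (rule that; assumption)
  have pos: "0 \<le> mode_source \<alpha> J A b \<kappa> t x" if "0 < t" "t \<le> 1" for t x
    using lo[OF that, of x] time_peak_nonneg[OF that(2), of M] Fejer_nonneg[of n x] by (meson mult_nonneg_nonneg order_trans)
  have u: "0 \<le> mode_sum J A b \<kappa> t x" if "0 \<le> t" "t \<le> 1" for t x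
    using mode_sum_nonneg[OF \<alpha> J b \<kappa> pos that] .
  let ?f = "\<lambda>z. mode_source \<alpha> J A b \<kappa> (fst z) (snd z)"
  have P: "has_bochner_integral lborel (\<lambda>t. indicator {0..s} t * time_peak M t) (1 - (1 - s) ^ Suc M)" if "0 \<le> s" for s
    using that by (rule has_bochner_integral_time_peak)
  have mass: "(\<integral>z. indicator {0<..<1} (fst z) * indicator cell (snd z) * ?f z \<partial>(lborel \<Otimes>\<^sub>M lborel)) \<le> 2"
  proof -
    let ?p = "\<lambda>t. indicator {0..1} t * time_peak M t" and ?q = "\<lambda>x. indicator {x. \<forall>i. x $ i \<in> {-pi..pi}} x * Fejer n (x :: real ^ 'n)"
    have p: "integrable lborel ?p" "integral\<^sup>L lborel ?p = 1"
      using P[of 1] by (simp_all add: has_bochner_integral_iff)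
    have q: "integrable lborel ?q" "integral\<^sup>L lborel ?q = 1"
      using integrable_Fejer_cube[of pi n] integral_Fejer_cube[of pi n] integral_fejer[OF n(1)] by simp_all
    have c: "integrable lborel (indicator cell :: real ^ 'n \<Rightarrow> real)" "integral\<^sup>L lborel (indicator cell :: real ^ 'n \<Rightarrow> real) = m"
    proof -
      have "emeasure lborel (cell :: (real ^ 'n) set) < \<infinity>" by (rule emeasure_bounded_finite[OF bounded_cell])
      then show "integrable lborel (indicator cell :: real ^ 'n \<Rightarrow> real)"
        using cell_measurable by (intro integrable_real_indicator) auto
      show "integral\<^sup>L lborel (indicator cell :: real ^ 'n \<Rightarrow> real) = m"
        by (simp add: m_def)
    qed
    have i: "integrable lborel (\<lambda>t::real. 2 * \<epsilon> * indicator {0<..<1} t)" by simp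
    have "(\<integral>z. indicator {0<..<1} (fst z) * indicator cell (snd z) * ?f z \<partial>(lborel \<Otimes>\<^sub>M lborel))
       \<le> (\<integral>z. ?p (fst z) * ?q (snd z) + (2 * \<epsilon> * indicator {0<..<1} (fst z)) * indicator cell (snd z) \<partial>(lborel \<Otimes>\<^sub>M lborel))"
    proof (rule integral_mono)
      show "integrable (lborel \<Otimes>\<^sub>M lborel) (\<lambda>z. indicator {0<..<1} (fst z) * indicator cell (snd z) * ?f z)"
        by (rule mode_mass_bound(1)[OF \<alpha> zero_less_one J b \<kappa>]) (auto intro: u)
      show "integrable (lborel \<Otimes>\<^sub>M lborel) (\<lambda>z. ?p (fst z) * ?q (snd z) + (2 * \<epsilon> * indicator {0<..<1} (fst z)) * indicator cell (snd z))"
        by (intro Bochner_Integration.integrable_add integrable_lborel_mult p q c i)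
      fix z :: "real \<times> (real ^ 'n)"
      obtain t x where z: "z = (t, x)" by (cases z)
      show "indicator {0<..<1} (fst z) * indicator cell (snd z) * ?f z
         \<le> ?p (fst z) * ?q (snd z) + (2 * \<epsilon> * indicator {0<..<1} (fst z)) * indicator cell (snd z)"
      proof (cases "t \<in> {0<..<1} \<and> x \<in> cell")
        case True
        then show ?thesis using hi[of t x] by (simp add: z cell_def)
      next
        case False
        then have zero: "indicator {0<..<1} t * (indicator cell x :: real) * mode_source \<alpha> J A b \<kappa> t x = 0"
            "(2 * \<epsilon> * indicator {0<..<1} t) * (indicator cell x :: real) = 0" by (auto simp: indicator_def)
        have "0 \<le> ?p t * ?q x"
          using time_peak_nonneg[of t M] Fejer_nonneg[of n x] by (auto simp: indicator_def)
        then show ?thesis unfolding z fst_conv snd_conv zero by simp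
      qed
    qed
    also have "\<dots> = 1 + 2 * \<epsilon> * m"
      unfolding Bochner_Integration.integral_add[OF integrable_lborel_mult[OF p(1) q(1)] integrable_lborel_mult[OF i c(1)]]
        integral_lborel_mult[OF p(1) q(1)] integral_lborel_mult[OF i c(1)] p(2) q(2) c(2) by simp
    finally show ?thesis using \<epsilon> by simp
  qed
  have lower: "1 / 32 \<le> (\<integral>z. indicator {0<..<T k} (fst z) * (1 - fst z / T k) * cutoff (\<rho> k) (snd z) * ?f z \<partial>(lborel \<Otimes>\<^sub>M lborel))"
    if k: "k \<le> K" for k
  proof -
    let ?p = "\<lambda>t. 1/8 * (indicator {0..s} t * time_peak M t)" and ?q = "\<lambda>x. indicator {x. \<forall>i. x $ i \<in> {-r..r}} x * Fejer n (x :: real ^ 'n)"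
    have p: "integrable lborel ?p" "integral\<^sup>L lborel ?p = 1/8 * (1 - (1 - s) ^ Suc M)"
      using P[of s] s by (simp_all add: has_bochner_integral_iff)
    have q: "integrable lborel ?q" "1/2 \<le> integral\<^sup>L lborel ?q"
    proof -
      show "integrable lborel ?q" by (rule integrable_Fejer_cube)
      have "integral\<^sup>L lborel ?q = (\<integral>y. indicator {-r..r} y * fejer n y \<partial>lborel) ^ CARD('n)" by (rule integral_Fejer_cube)
      then show "1/2 \<le> integral\<^sup>L lborel ?q" using n(2) by linarith
    qed
    \<comment> \<open>The factor 1/8 is 1/2 from the ramp times 1/4 from the cutoff; the time peak
      and the Fejer kernel each have at least half of their mass in the region where these bounds
      hold.\<close>
    have "1 / 32 = (1/8 * (1/2)) * (1/2 :: real)" by simp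
    also have "\<dots> \<le> integral\<^sup>L lborel ?p * integral\<^sup>L lborel ?q"
      unfolding p(2) using M q(2) by (intro mult_mono) auto
    also have "\<dots> = (\<integral>z. ?p (fst z) * ?q (snd z) \<partial>(lborel \<Otimes>\<^sub>M lborel))"
      by (rule integral_lborel_mult[OF p(1) q(1), symmetric])
    also have "\<dots> \<le> (\<integral>z. indicator {0<..<T k} (fst z) * (1 - fst z / T k) * cutoff (\<rho> k) (snd z) * ?f z \<partial>(lborel \<Otimes>\<^sub>M lborel))"
    proof (rule integral_mono_AE)
      show "integrable (lborel \<Otimes>\<^sub>M lborel) (\<lambda>z. ?p (fst z) * ?q (snd z))" by (rule integrable_lborel_mult[OF p(1) q(1)])
      show "integrable (lborel \<Otimes>\<^sub>M lborel) (\<lambda>z. indicator {0<..<T k} (fst z) * (1 - fst z / T k) * cutoff (\<rho> k) (snd z) * ?f z)"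
      proof (rule source_duality(1)[OF \<alpha> \<rho>(1) J b T_def])
        show "0 \<le> mode_sum J A b \<kappa> t x" if "0 < t" "t < T k" for t x
          using u[of t x] that T(2)[of k] by linarith
      qed
      \<comment> \<open>The bounds on the source are available for t > 0 only, so the hyperplane t =
        0 is removed as a null set.\<close>
      have "AE z in lborel. (z :: real \<times> (real ^ 'n)) \<notin> {0} \<times> UNIV"
      proof (rule AE_not_in, rule null_setsI)
        have "emeasure (lborel \<Otimes>\<^sub>M lborel) ({0::real} \<times> (UNIV :: (real ^ 'n) set)) = emeasure lborel {0::real} * emeasure lborel (UNIV :: (real ^ 'n) set)"
          by (rule lborel.emeasure_pair_measure_Times) auto
        then show "emeasure lborel ({0::real} \<times> (UNIV :: (real ^ 'n) set)) = 0" by (simp add: lborel_prod)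
        show "{0::real} \<times> (UNIV :: (real ^ 'n) set) \<in> sets lborel"
          by (simp add: borel_closed closed_Times)
      qed
      then have "AE z in lborel \<Otimes>\<^sub>M lborel. (z :: real \<times> (real ^ 'n)) \<notin> {0} \<times> UNIV" by (simp only: lborel_prod)
      then show "AE z in lborel \<Otimes>\<^sub>M lborel. ?p (fst z) * ?q (snd z) \<le> indicator {0<..<T k} (fst z) * (1 - fst z / T k) * cutoff (\<rho> k) (snd z) * ?f z"
      proof eventually_elim
        case (elim z)
        obtain t x where z: "z = (t, x)" by (cases z)
        have t0: "t \<noteq> 0" using elim by (simp add: z)
        have nn: "0 \<le> indicator {0<..<T k} t * (1 - t / T k) * cutoff (\<rho> k) x * mode_source \<alpha> J A b \<kappa> t x"
        proof (cases "t \<in> {0<..<T k}")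
          case True
          then show ?thesis using T[of k] pos[of t x] cutoff_bounds(1)[OF \<rho>(1)] by (intro mult_nonneg_nonneg) auto
        qed simp
        show ?case
        proof (cases "t \<in> {0..s} \<and> (\<forall>i. x $ i \<in> {-r..r})")
          case True
          have t: "0 < t" "t \<le> T k / 2" "t < T k" "t \<le> 1"
            using True t0 s TK[OF k] T[of k] by auto
          have "\<bar>x $ i\<bar> \<le> \<rho> k / (2 * sqrt (real CARD('n)))" for i
          proof -
            have "\<bar>x $ i\<bar> \<le> r" using True by (auto simp: abs_le_iff minus_le_iff)
            also have "r \<le> \<rho> k / (2 * sqrt (real CARD('n)))"
              unfolding r_def using \<rho>K[OF k] by (intro divide_right_mono) auto
            finally show ?thesis .
          qed
          then have "1/4 \<le> cutoff (\<rho> k) x" by (intro cutoff_ge_on_cube \<rho>)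
          moreover have half: "1/2 \<le> 1 - t / T k" using t T(1)[of k] by (simp add: field_simps)
          moreover have "0 \<le> 1 - t / T k" using half by linarith
          ultimately have le8: "(1/2) * (1/4) \<le> (1 - t / T k) * cutoff (\<rho> k) x" by (intro mult_mono) simp_all
          have "((1/2) * (1/4)) * (time_peak M t * Fejer n x) \<le> ((1 - t / T k) * cutoff (\<rho> k) x) * mode_source \<alpha> J A b \<kappa> t x"
          proof (rule mult_mono[OF le8 lo[OF t(1,4)]])
            show "0 \<le> (1 - t / T k) * cutoff (\<rho> k) x" using le8 by linarith
            show "0 \<le> time_peak M t * Fejer n x"
              by (intro mult_nonneg_nonneg time_peak_nonneg Fejer_nonneg t)
          qed
          then show ?thesis using True t by (simp add: z)
        next
          case False
          then have "?p t * ?q x = 0" by (auto simp: indicator_def)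
          then show ?thesis using nn by (simp only: z fst_conv snd_conv)
        qed
      qed
    qed
    finally show ?thesis .
  qed
  show ?thesis
  proof (rule that[of J b \<kappa> A])
    show "1 / 32 \<le> (\<integral>z. indicator {0<..<T'} (fst z) * (1 - fst z / T') * cutoff ((1/2) ^ k) (snd z) * ?f z \<partial>(lborel \<Otimes>\<^sub>M lborel))"
      if "k \<le> K" "T' = ((1/2) ^ k) powr (2 / \<alpha>)" for k T'
      using lower[OF that(1)] that(2) by (simp only: T_def \<rho>_def)
  qed (use J b \<kappa> pos u mass in auto)
qed

text \<open>Collects what the final argument uses and hides the modes. The bound \<open>B\<close>
  may depend on K and serves integrability only. The constant 2 Gamma(1 - \<alpha>) is the mass
  bound 2 divided by g_{1-\<alpha>}(1), and 4^k is \<rho>^(-2) for \<rho> = 2^(-k).\<close>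

lemma concentrated_supersolution:
  fixes \<alpha> :: real and K :: nat
  assumes \<alpha>: "0 < \<alpha>" "\<alpha> < 1"
  obtains u :: "real \<times> (real ^ 'n) \<Rightarrow> real" and B
  where "weak_supersolution \<alpha> 1 (ball 0 2) (\<lambda>_. mat 1) (\<lambda>_. 0) u"
    "u \<in> borel_measurable borel" "\<And>z. 0 \<le> fst z \<Longrightarrow> fst z \<le> 1 \<Longrightarrow> 0 \<le> u z" "\<And>z. 0 \<le> fst z \<Longrightarrow> fst z \<le> 1 \<Longrightarrow> u z \<le> B"
    "(\<integral>z. indicator ({0<..<1} \<times> cell) z * u z \<partial>lborel) \<le> 2 * Gamma (1 - \<alpha>)"
    "\<And>k T. k \<le> K \<Longrightarrow> T = ((1/2) ^ k) powr (2 / \<alpha>) \<Longrightarrow>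
      1 / (32 * (1 / Gamma (2 - \<alpha>) + 6 * real CARD('n))) \<le> 4 ^ k * (\<integral>z. indicator ({0<..<T} \<times> ball 0 ((1/2) ^ k)) z * u z \<partial>lborel)"
proof -
  obtain J :: "(('n::finite \<Rightarrow> nat) \<times> ('n \<Rightarrow> nat) \<times> nat \<times> nat) option set" and A b and \<kappa> :: "_ \<Rightarrow> real ^ 'n"
    where J: "finite J" and b: "\<And>i. 1 + \<alpha> \<le> b i" and \<kappa>: "\<And>i j. \<kappa> i $ j \<in> \<int>"
    and pos: "\<And>t x. 0 < t \<Longrightarrow> t \<le> 1 \<Longrightarrow> 0 \<le> mode_source \<alpha> J A b \<kappa> t x"
    and u: "\<And>t x. 0 \<le> t \<Longrightarrow> t \<le> 1 \<Longrightarrow> 0 \<le> mode_sum J A b \<kappa> t x"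
    and mass: "(\<integral>z. indicator {0<..<1} (fst z) * indicator cell (snd z) * mode_source \<alpha> J A b \<kappa> (fst z) (snd z) \<partial>(lborel \<Otimes>\<^sub>M lborel)) \<le> 2"
    and low: "\<And>k T. k \<le> K \<Longrightarrow> T = ((1/2) ^ k) powr (2 / \<alpha>) \<Longrightarrow> 1 / 32 \<le> (\<integral>z. indicator {0<..<T} (fst z) * (1 - fst z / T) * cutoff ((1/2) ^ k) (snd z) *
        mode_source \<alpha> J A b \<kappa> (fst z) (snd z) \<partial>(lborel \<Otimes>\<^sub>M lborel))"
    by (rule concentrated_mode_source[OF \<alpha>, of K]) (rule that; assumption)
  let ?u = "\<lambda>(t, x). mode_sum J A b \<kappa> t x"
  have ueq: "?u z = mode_sum J A b \<kappa> (fst z) (snd z)" for z by (simp add: case_prod_beta)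
  interpret md: mode_data \<alpha> 1 "ball 0 2" J A b \<kappa>
    using \<alpha> J b by unfold_locales auto
  define D where "D = 1 / Gamma (2 - \<alpha>) + 6 * real CARD('n)"
  have D: "0 < D" using Gamma_real_pos[of "2 - \<alpha>"] \<alpha> unfolding D_def by (intro add_pos_pos) auto
  show ?thesis
  proof (rule that[of ?u "\<Sum>i\<in>J. \<bar>A i\<bar> * g_kernel (b i) 1"])
    show "weak_supersolution \<alpha> 1 (ball 0 2) (\<lambda>_. mat 1) (\<lambda>_. 0) ?u"
      by (rule md.weak_supersolution_mode_sum) (auto intro: pos)
    show "?u \<in> borel_measurable borel" using mode_sum_measurable[of J A b \<kappa>] by (simp add: case_prod_beta')
    show "0 \<le> ?u z" if "0 \<le> fst z" "fst z \<le> 1" for z unfolding ueq by (rule u[OF that])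
    show "?u z \<le> (\<Sum>i\<in>J. \<bar>A i\<bar> * g_kernel (b i) 1)" if "0 \<le> fst z" "fst z \<le> 1" for z
    proof -
      have "1 \<le> b i" for i using b[of i] \<alpha> by linarith
      then show ?thesis unfolding ueq using mode_sum_bound[of J b "fst z" 1 A \<kappa> "snd z"] that by auto
    qed
    have "g_kernel (1 - \<alpha>) 1 * (\<integral>z. indicator ({0<..<1} \<times> cell) z * mode_sum J A b \<kappa> (fst z) (snd z) \<partial>(lborel \<Otimes>\<^sub>M lborel)) \<le> 2"
      by (rule order_trans[OF mode_mass_bound(2)[OF \<alpha> zero_less_one J b \<kappa>] mass]) (auto intro: u)
    then show "(\<integral>z. indicator ({0<..<1} \<times> cell) z * ?u z \<partial>lborel) \<le> 2 * Gamma (1 - \<alpha>)"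
      using Gamma_real_pos[of "1 - \<alpha>"] \<alpha> unfolding ueq lborel_prod by (simp add: g_kernel_def field_simps)
    fix k :: nat and T assume k: "k \<le> K" and T: "T = ((1/2) ^ k) powr (2 / \<alpha>)"
    have T1: "T \<le> 1" unfolding T using \<alpha> by (intro powr_le1) (auto simp: power_le_one)
    have "1 / 32 \<le> D / ((1/2) ^ k)\<^sup>2 * (\<integral>z. indicator ({0<..<T} \<times> ball 0 ((1/2) ^ k)) z * mode_sum J A b \<kappa> (fst z) (snd z) \<partial>(lborel \<Otimes>\<^sub>M lborel))"
      unfolding D_def
      by (rule order_trans[OF low[OF k T] source_duality(2)[OF \<alpha> _ J b T]]) (use u T1 in auto)
    also have "D / ((1/2) ^ k)\<^sup>2 = D * 4 ^ k"
      by (simp add: power_divide power2_eq_square power_mult_distrib[symmetric])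
    finally show "1 / (32 * (1 / Gamma (2 - \<alpha>) + 6 * real CARD('n))) \<le> 4 ^ k * (\<integral>z. indicator ({0<..<T} \<times> ball 0 ((1/2) ^ k)) z * ?u z \<partial>lborel)"
      unfolding ueq lborel_prod D_def[symmetric] using D by (simp add: field_simps)
  qed
qed

section \<open>Failure of the inequality\<close>

text \<open>By geometric growth a sum of selected powers of 4 is at most 4/3 times the largest
  selected one. Hence the power q can be taken inside the sum with a constant independent of K,
  which keeps the estimate of the weight linear in K.\<close>

lemma powr_geometric_sum_le:
  fixes d :: "nat \<Rightarrow> real"
  assumes q: "0 < q" and d: "\<And>k. d k = 0 \<or> d k = 1"
  shows "(\<Sum>k=1..K. 4 ^ k * d k) powr q \<le> (4/3) powr q * (\<Sum>k=1..K. (4 ^ k) powr q * d k)"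
proof (induction K)
  case (Suc K)
  have d0: "0 \<le> d k" "d k \<le> 1" for k using d[of k] by auto
  show ?case
  proof (cases "d (Suc K) = 0")
    case True
    then show ?thesis using Suc by simp
  next
    case False
    then have d1: "d (Suc K) = 1" using d by blast
    have geo: "(\<Sum>k=1..L. (4::real) ^ k) \<le> 4/3 * 4 ^ L" for L by (induction L) auto
    have "(\<Sum>k=1..Suc K. 4 ^ k * d k) \<le> (\<Sum>k=1..Suc K. 4 ^ k * 1)"
      by (intro sum_mono mult_left_mono d0) auto
    also have "\<dots> \<le> 4/3 * 4 ^ Suc K" using geo[of "Suc K"] by simp
    finally have "(\<Sum>k=1..Suc K. 4 ^ k * d k) powr q \<le> (4/3 * 4 ^ Suc K) powr q"
      using q by (intro powr_mono2 sum_nonneg mult_nonneg_nonneg d0) auto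
    also have "\<dots> = (4/3) powr q * ((4 ^ Suc K) powr q * d (Suc K))"
      by (subst powr_mult) (simp_all add: d1 del: power_Suc)
    also have "\<dots> \<le> (4/3) powr q * (\<Sum>k=1..Suc K. (4 ^ k) powr q * d k)"
      by (intro mult_left_mono member_le_sum[of "Suc K" "{1..Suc K}" "\<lambda>k. (4 ^ k) powr q * d k"]) (auto intro!: mult_nonneg_nonneg d0)
    finally show ?thesis .
  qed
qed simp

lemma integrable_indicator_bounded:
  fixes g :: "'a::euclidean_space \<Rightarrow> real"
  assumes Y: "Y \<in> sets borel" "bounded Y" and g: "g \<in> borel_measurable borel" "\<And>z. z \<in> Y \<Longrightarrow> \<bar>g z\<bar> \<le> D"
  shows "integrable lborel (\<lambda>z. indicator Y z * g z)"
proof (rule Bochner_Integration.integrable_bound)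
  have "emeasure lborel Y < \<infinity>" using Y by (intro emeasure_bounded_finite)
  then show "integrable lborel (\<lambda>z. D * indicator Y z)"
    using Y by (intro integrable_mult_right integrable_real_indicator) auto
  show "(\<lambda>z. indicator Y z * g z) \<in> borel_measurable lborel" using Y g by simp
  show "AE z in lborel. norm (indicator Y z * g z) \<le> norm (D * indicator Y z)"
  proof (rule AE_I2)
    fix z show "norm (indicator Y z * g z) \<le> norm (D * indicator Y z)"
      using g(2)[of z] by (auto simp: indicator_def)
  qed
qed

text \<open>Duality is used as Young's inequality with a free factor \<open>s\<close>. The left side
  is K times a constant, and the last term is K times a constant that a large \<open>s\<close> makes
  small; so the integral of u^p has to grow linearly in K.\<close>

lemma concentration_Hoelder:
  fixes u :: "real \<times> (real ^ 'n) \<Rightarrow> real" and K :: nat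
  assumes \<alpha>: "0 < \<alpha>" "\<alpha> < 1" and pq: "1 < p" "1 < q" "1 / p + 1 / q = 1"
    and q: "2 * q \<le> real CARD('n) + 2 / \<alpha>"
    and um: "u \<in> borel_measurable borel" and u0: "\<And>z. 0 \<le> fst z \<Longrightarrow> fst z \<le> 1 \<Longrightarrow> 0 \<le> u z"
    and uB: "\<And>z. 0 \<le> fst z \<Longrightarrow> fst z \<le> 1 \<Longrightarrow> u z \<le> B"
    and low: "\<And>k T. k \<le> K \<Longrightarrow> T = ((1/2) ^ k) powr (2 / \<alpha>) \<Longrightarrow>
      c \<le> 4 ^ k * (\<integral>z. indicator ({0<..<T} \<times> ball 0 ((1/2) ^ k)) z * u z \<partial>lborel)"
    and s: "0 < s"
  shows "real K * c \<le> s powr p * (\<integral>z. indicator ({0<..<1/4} \<times> ball 0 (1/2)) z * u z powr p \<partial>lborel)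
     + real K * ((1 / s) powr q * (4/3) powr q * unit_ball_vol (real CARD('n)))"
proof -
  define \<rho> where "\<rho> k = (1/2 :: real) ^ k" for k :: nat
  define T where "T k = \<rho> k powr (2 / \<alpha>)" for k
  define cyl where "cyl k = {0<..<T k} \<times> (ball 0 (\<rho> k) :: (real ^ 'n) set)" for k
  define Q where "Q = {0<..<1/4::real} \<times> (ball 0 (1/2) :: (real ^ 'n) set)"
  have \<rho>: "0 < \<rho> k" "\<rho> k \<le> 1" for k by (auto simp: \<rho>_def power_le_one)
  have T: "0 < T k" "T k \<le> 1" for k using \<rho>[of k] \<alpha> by (auto simp: T_def intro!: powr_le1)
  \<comment> \<open>Since \<alpha> < 1, T k \<le> (1/2)^(2/\<alpha>) \<le> 1/4 for k \<ge> 1; the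
    cylinder of scale 0 does not fit into \<open>Q\<close>, so the sums start at 1.\<close>
  have sub: "cyl k \<subseteq> Q" if "1 \<le> k" for k
  proof -
    have r: "\<rho> k \<le> 1/2" unfolding \<rho>_def using power_decreasing[of 1 k "1/2::real"] that by simp
    have "T k \<le> (1/2) powr (2 / \<alpha>)" unfolding T_def using r \<rho>[of k] \<alpha> by (intro powr_mono2) auto
    also have "\<dots> \<le> (1/2) powr 2" using \<alpha> by (intro powr_mono') (auto simp: field_simps)
    also have "(1/2::real) powr 2 = 1/4" by (simp add: powr_numeral power2_eq_square)
    finally show ?thesis using r unfolding cyl_def Q_def by auto
  qed
  have Q1: "0 \<le> fst z" "fst z \<le> 1" if "z \<in> Q" for z using that by (auto simp: Q_def)
  have c1: "0 \<le> fst z" "fst z \<le> 1" if "z \<in> cyl k" for z k using that T(2)[of k] by (auto simp: cyl_def)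
  have op: "open (cyl k)" "open Q" for k unfolding cyl_def Q_def by (auto intro!: open_Times)
  have bd: "bounded (cyl k)" "bounded Q" for k unfolding cyl_def Q_def by (auto intro!: bounded_Times)
  have ui: "integrable lborel (\<lambda>z. indicator (cyl k) z * u z)" for k
    using u0[OF c1] uB[OF c1] by (intro integrable_indicator_bounded[OF borel_open[OF op(1)] bd(1) um, where D=B]) auto
  have upi: "integrable lborel (\<lambda>z. indicator Q z * u z powr p)"
  proof (rule integrable_indicator_bounded[OF borel_open[OF op(2)] bd(2), where D="B powr p"])
    show "(\<lambda>z. u z powr p) \<in> borel_measurable borel" using um by measurable
    show "\<bar>u z powr p\<bar> \<le> B powr p" if "z \<in> Q" for z
      using u0[OF Q1[OF that]] uB[OF Q1[OF that]] pq by (auto intro!: powr_mono2)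
  qed
  have ci: "integrable lborel (\<lambda>z. indicator (cyl k) z :: real)" for k
    using integrable_indicator_bounded[OF borel_open[OF op(1)[of k]] bd(1)[of k], of "\<lambda>_. 1" 1] by simp
  \<comment> \<open>Scale k contributes \<rho>^(-2q + 2/\<alpha> + N) times the volume of the unit
    ball, and the hypothesis on \<open>q\<close> says that this exponent is nonnegative. In the
    critical case it is 0 and all scales contribute equally.\<close>
  have vol: "(4 ^ k) powr q * (\<integral>z. indicator (cyl k) z \<partial>lborel) \<le> unit_ball_vol (real CARD('n))" for k
  proof -
    have fin: "emeasure lborel (ball 0 (\<rho> k) :: (real ^ 'n) set) < \<infinity>" by (intro emeasure_bounded_finite) simp
    have "(\<integral>z. indicator (cyl k) z \<partial>lborel) = (\<integral>z. (indicator {0<..<T k} (fst z) :: real) * indicator (ball 0 (\<rho> k) :: (real ^ 'n) set) (snd z) \<partial>(lborel \<Otimes>\<^sub>M lborel))"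
    proof -
      have "(\<lambda>z. indicator (cyl k) z :: real) = (\<lambda>z. indicator {0<..<T k} (fst z) * indicator (ball 0 (\<rho> k)) (snd z))"
        by (auto simp: cyl_def indicator_def fun_eq_iff)
      then show ?thesis by (simp only: lborel_prod)
    qed
    also have "\<dots> = T k * measure lborel (ball 0 (\<rho> k) :: (real ^ 'n) set)"
      using fin T[of k] by (subst integral_lborel_mult) (auto intro!: integrable_real_indicator)
    also have "measure lborel (ball 0 (\<rho> k) :: (real ^ 'n) set) = unit_ball_vol (real CARD('n)) * \<rho> k ^ CARD('n)"
      using content_ball[of "\<rho> k" "0 :: real ^ 'n"] \<rho>[of k] by simp
    finally have I: "(\<integral>z. (indicator (cyl k) z :: real) \<partial>lborel) = T k * (unit_ball_vol (real CARD('n)) * \<rho> k ^ CARD('n))" .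
    have "(4::real) ^ k = \<rho> k powr (- 2)"
      using \<rho>(1)[of k] by (simp add: powr_minus powr_numeral \<rho>_def power_divide power2_eq_square power_mult_distrib[symmetric] inverse_eq_divide)
    then have "(4 ^ k) powr q * T k * \<rho> k ^ CARD('n) = \<rho> k powr (-2 * q + 2 / \<alpha> + real CARD('n))"
      using powr_realpow[OF \<rho>(1)[of k], of "CARD('n)"] by (simp only: T_def powr_powr powr_add)
    also have "\<dots> \<le> 1" using \<rho>[of k] q by (intro powr_le1) auto
    finally have "((4 ^ k) powr q * T k * \<rho> k ^ CARD('n)) * unit_ball_vol (real CARD('n)) \<le> 1 * unit_ball_vol (real CARD('n))"
      by (intro mult_right_mono) auto
    then show ?thesis unfolding I by (simp add: mult_ac)
  qed
  let ?H = "\<lambda>z. \<Sum>k=1..K. 4 ^ k * indicator (cyl k) z :: real"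
  let ?c = "(1 / s) powr q * (4/3) powr q"
  have pw: "?H z * u z \<le> s powr p * (indicator Q z * u z powr p) + ?c * (\<Sum>k=1..K. (4 ^ k) powr q * indicator (cyl k) z)" for z
  proof (cases "z \<in> Q")
    case False
    have "?H z = 0"
    proof (intro sum.neutral ballI)
      fix k assume "k \<in> {1..K}"
      then have "z \<notin> cyl k" using sub[of k] False by auto
      then show "4 ^ k * indicator (cyl k) z = (0::real)" by simp
    qed
    moreover have "0 \<le> ?c * (\<Sum>k=1..K. (4 ^ k) powr q * indicator (cyl k) z)"
      by (intro mult_nonneg_nonneg sum_nonneg) auto
    ultimately show ?thesis using False by simp
  next
    case True
    have uz: "0 \<le> u z" using u0[OF Q1[OF True]] .
    have H0: "0 \<le> ?H z" by (intro sum_nonneg) auto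
    have "?H z * u z = (s * u z) * ((1 / s) * ?H z)" using s by simp
    also have "\<dots> \<le> (s * u z) powr p / p + ((1 / s) * ?H z) powr q / q"
      using s uz H0 by (intro Youngs_inequality pq mult_nonneg_nonneg) auto
    also have "\<dots> \<le> (s * u z) powr p + ((1 / s) * ?H z) powr q"
    proof -
      have "y / r \<le> y" if "0 \<le> y" "1 < r" for y r :: real
        using that mult_left_mono[of 1 r y] by (simp add: divide_le_eq)
      then show ?thesis using pq by (intro add_mono) simp_all
    qed
    also have "(s * u z) powr p = s powr p * u z powr p" using s uz by (simp add: powr_mult)
    also have "((1 / s) * ?H z) powr q = (1 / s) powr q * ?H z powr q" using s H0 by (simp only: powr_mult)
    also have "(1 / s) powr q * ?H z powr q \<le> (1 / s) powr q * ((4/3) powr q * (\<Sum>k=1..K. (4 ^ k) powr q * indicator (cyl k) z))"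
      using pq by (intro mult_left_mono powr_geometric_sum_le) (auto simp: indicator_def)
    finally show ?thesis using True by (simp add: mult.assoc)
  qed
  have "real K * c = (\<Sum>k=1..K. c)" by simp
  also have "\<dots> \<le> (\<Sum>k=1..K. 4 ^ k * (\<integral>z. indicator (cyl k) z * u z \<partial>lborel))"
    unfolding cyl_def \<rho>_def by (intro sum_mono low) (auto simp: T_def \<rho>_def)
  also have "\<dots> = (\<integral>z. (\<Sum>k=1..K. 4 ^ k * (indicator (cyl k) z * u z)) \<partial>lborel)"
    using ui by (simp add: Bochner_Integration.integral_sum)
  also have "\<dots> \<le> (\<integral>z. s powr p * (indicator Q z * u z powr p) + ?c * (\<Sum>k=1..K. (4 ^ k) powr q * indicator (cyl k) z) \<partial>lborel)"
  proof (rule integral_mono)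
    show "integrable lborel (\<lambda>z. \<Sum>k=1..K. 4 ^ k * (indicator (cyl k) z * u z))"
      by (intro Bochner_Integration.integrable_sum integrable_mult_right ui)
    show "integrable lborel (\<lambda>z. s powr p * (indicator Q z * u z powr p) + ?c * (\<Sum>k=1..K. (4 ^ k) powr q * indicator (cyl k) z))"
      by (intro Bochner_Integration.integrable_add Bochner_Integration.integrable_sum integrable_mult_right upi ci)
    show "(\<Sum>k=1..K. 4 ^ k * (indicator (cyl k) z * u z)) \<le> s powr p * (indicator Q z * u z powr p) + ?c * (\<Sum>k=1..K. (4 ^ k) powr q * indicator (cyl k) z)" for z
      using pw[of z] by (simp only: sum_distrib_right mult.assoc)
  qed
  also have "\<dots> = s powr p * (\<integral>z. indicator Q z * u z powr p \<partial>lborel) + ?c * (\<Sum>k=1..K. (4 ^ k) powr q * (\<integral>z. indicator (cyl k) z \<partial>lborel))"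
  proof -
    have "(\<integral>z. (\<Sum>k=1..K. (4 ^ k) powr q * indicator (cyl k) z) \<partial>lborel) = (\<Sum>k=1..K. (4 ^ k) powr q * (\<integral>z. indicator (cyl k) z \<partial>lborel))"
      using ci by (subst Bochner_Integration.integral_sum) (auto intro!: integrable_mult_right)
    then show ?thesis
      by (subst Bochner_Integration.integral_add)
         (intro Bochner_Integration.integrable_sum integrable_mult_right upi ci | simp only: integral_mult_right_zero)+
  qed
  also have "\<dots> \<le> s powr p * (\<integral>z. indicator Q z * u z powr p \<partial>lborel) + ?c * (\<Sum>k=1..K. unit_ball_vol (real CARD('n)))"
    by (intro add_left_mono mult_left_mono sum_mono vol) auto
  finally show ?thesis by (simp add: Q_def mult_ac)
qed

section \<open>The two sides of the inequality in terms of integrals\<close>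

lemma ess_inf_bounds:
  fixes u :: "'a::euclidean_space \<Rightarrow> real"
  assumes um: "u \<in> borel_measurable borel" and Q: "open Q" "bounded Q" and m: "0 < measure lborel Q"
    and u0: "\<And>z. z \<in> Q \<Longrightarrow> 0 \<le> u z" and i: "integrable lborel (\<lambda>z. indicator Q z * u z)"
    and I: "(\<integral>z. indicator Q z * u z \<partial>lborel) \<le> I"
  shows "0 \<le> ess_inf Q u" "ess_inf Q u \<le> ereal (I / measure lborel Q)"
proof -
  have m': "(\<lambda>z. - ereal (u z)) \<in> borel_measurable (lebesgue_on Q)"
    using borel_measurable_lebesgue_on[OF um] by measurable
  have "AE z in lebesgue_on Q. - ereal (u z) \<le> 0"
    using u0 by (intro AE_I2) auto
  then have "esssup (lebesgue_on Q) (\<lambda>z. - ereal (u z)) \<le> 0" by (rule esssup_I[OF m'])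
  then show "0 \<le> ess_inf Q u" unfolding ess_inf_def by (simp add: ereal_uminus_le_reorder)
  show "ess_inf Q u \<le> ereal (I / measure lborel Q)"
  proof (rule ccontr)
    assume "\<not> ess_inf Q u \<le> ereal (I / measure lborel Q)"
    \<comment> \<open>A level strictly between the mean bound and the essential infimum: u \<ge> r
      almost everywhere on \<open>Q\<close> would make the integral larger than
      \<open>I\<close>.\<close>
    then obtain r where r: "ereal (I / measure lborel Q) < ereal r" "ereal r < ess_inf Q u"
      using ereal_dense2[of "ereal (I / measure lborel Q)" "ess_inf Q u"] by (auto simp: not_le)
    have "AE z in lebesgue_on Q. - ereal (u z) \<le> esssup (lebesgue_on Q) (\<lambda>z. - ereal (u z))"
      by (rule esssup_AE)
    then have "AE z in lebesgue_on Q. ereal r \<le> ereal (u z)"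
    proof eventually_elim
      case (elim z)
      then have "ess_inf Q u \<le> ereal (u z)" unfolding ess_inf_def by (simp add: ereal_uminus_le_reorder)
      then show ?case using r(2) by (meson less_imp_le order_trans)
    qed
    then have "AE z in lebesgue. z \<in> Q \<longrightarrow> r \<le> u z"
      using Q by (subst (asm) AE_restrict_space_iff) auto
    then have "AE z in lborel. z \<in> Q \<longrightarrow> r \<le> u z" by (simp only: AE_completion_iff)
    then have "(\<integral>z. r * indicator Q z \<partial>lborel) \<le> (\<integral>z. indicator Q z * u z \<partial>lborel)"
    proof (intro integral_mono_AE i)
      have "emeasure lborel Q < \<infinity>" using Q by (intro emeasure_bounded_finite)
      then show "integrable lborel (\<lambda>z. r * indicator Q z)"
        using Q by (intro integrable_mult_right integrable_real_indicator) auto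
    qed (auto elim!: eventually_mono simp: indicator_def)
    also have "(\<integral>z. r * indicator Q z \<partial>lborel) = r * measure lborel Q" using Q by simp
    finally have "r * measure lborel Q \<le> I" using I by linarith
    then show False using r(1) m by (simp add: divide_less_eq)
  qed
qed

lemma p_mean_le_D:
  fixes u :: "'a::euclidean_space \<Rightarrow> real"
  assumes um: "u \<in> borel_measurable borel" and Q: "open Q" "bounded Q" and m: "0 < measure lborel Q"
    and i: "integrable lborel (\<lambda>z. indicator Q z * u z powr p)" and p: "0 < p" and M: "0 \<le> M"
    and le: "enn2ereal (p_mean p Q u) \<le> ereal M"
  shows "(\<integral>z. indicator Q z * u z powr p \<partial>lborel) \<le> measure lborel Q * M powr p"
proof -
  let ?R = "\<integral>z. indicator Q z * u z powr p \<partial>lborel"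
  have R: "0 \<le> ?R" by (intro integral_nonneg_AE) auto
  have "(\<integral>\<^sup>+z. ennreal (u z powr p) \<partial>lebesgue_on Q) = (\<integral>\<^sup>+z. ennreal (u z powr p) * indicator Q z \<partial>lebesgue)"
    using Q by (intro nn_integral_restrict_space) auto
  also have "\<dots> = (\<integral>\<^sup>+z. ennreal (indicator Q z * u z powr p) \<partial>lborel)"
    unfolding nn_integral_completion by (intro nn_integral_cong) (auto simp: indicator_def)
  also have "\<dots> = ennreal ?R" using i by (intro nn_integral_eq_integral) auto
  finally have I: "(\<integral>\<^sup>+z. ennreal (u z powr p) \<partial>lebesgue_on Q) = ennreal ?R" .
  have "emeasure lborel Q < \<infinity>" using Q by (intro emeasure_bounded_finite)
  then have E: "emeasure lebesgue Q = ennreal (measure lborel Q)"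
    using Q by (simp add: emeasure_eq_ennreal_measure)
  have "p_mean p Q u = ennreal ((?R / measure lborel Q) powr (1 / p))"
    unfolding p_mean_def I E using R m by (simp add: divide_ennreal ennreal_powr_def)
  then have "(?R / measure lborel Q) powr (1 / p) \<le> M"
    using le by (simp add: enn2ereal_ennreal)
  then have "((?R / measure lborel Q) powr (1 / p)) powr p \<le> M powr p"
    using p by (intro powr_mono2) auto
  then have "?R / measure lborel Q \<le> M powr p"
    using p R m by (simp add: powr_powr)
  then show ?thesis using m by (simp add: divide_le_eq mult.commute)
qed

theorem mainTheorem2:
  fixes \<alpha> p :: real and N :: nat
  assumes "0 < \<alpha>" and "\<alpha> < 1"
    and "N = CARD('n::finite)"
    and "p \<ge> (2 + real N * \<alpha>) / (2 + real N * \<alpha> - 2 * \<alpha>)"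
  shows "\<not> (\<forall>\<nu> \<Lambda> \<tau> \<delta> \<eta> :: real.
    \<nu> > 0 \<and> \<Lambda> > 0 \<and> \<tau> > 0 \<and> 0 < \<delta> \<and> \<delta> < 1 \<and> \<eta> > 1 \<longrightarrow>
    (\<exists>C::real.
      \<forall>(T::real) (\<Omega> :: (real ^ 'n) set) A u0 t0 r x0 u.
        T > 0 \<and> bounded_domain \<Omega> \<and>
        admissible_coeff \<nu> \<Lambda> (cylinder T \<Omega>) A \<and>
        u0 \<in> L2 \<Omega> \<and>
        t0 \<ge> 0 \<and> r > 0 \<and> t0 + 2 * \<tau> * r powr (2 / \<alpha>) \<le> T \<and>
        ball x0 (\<eta> * r) \<subseteq> \<Omega> \<and>
        weak_supersolution \<alpha> (t0 + 2 * \<tau> * r powr (2 / \<alpha>)) (ball x0 (\<eta> * r)) A u0 u \<and>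
        (AE z in lebesgue_on (cylinder (t0 + 2 * \<tau> * r powr (2 / \<alpha>)) (ball x0 (\<eta> * r))). u z \<ge> 0) \<and>
        (AE x in lebesgue_on (ball x0 (\<eta> * r)). u0 x \<ge> 0) \<longrightarrow>
        enn2ereal (p_mean p (Q_minus \<alpha> \<delta> \<tau> t0 x0 r) u)
          \<le> ereal C * ess_inf (Q_plus \<alpha> \<delta> \<tau> t0 x0 r) u))"
    (is "\<not> ?Harnack")
proof
  note \<alpha> = assms(1,2)
  let ?N = "real CARD('n)"
  assume ?Harnack
  \<comment> \<open>\<nu> = 1 and \<Lambda> = N admit the identity matrix, whose entries have square
    sum N \<le> N^2. With \<tau> = \<delta> = 1/2, \<eta> = 2, t0 = 0 and r = 1 the equation lives
    on (0,1) times B(0,2), and Q_- and Q_+ have time intervals (0,1/4) and (3/4,1) and the ball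
    B(0,1/2).\<close>
  from this[rule_format, of 1 ?N "1/2" "1/2" 2] obtain C :: real where
    C: "\<And>(T::real) (\<Omega> :: (real ^ 'n) set) A u0 t0 r x0 u.
        T > 0 \<and> bounded_domain \<Omega> \<and>
        admissible_coeff 1 ?N (cylinder T \<Omega>) A \<and>
        u0 \<in> L2 \<Omega> \<and>
        t0 \<ge> 0 \<and> r > 0 \<and> t0 + 2 * (1/2) * r powr (2 / \<alpha>) \<le> T \<and>
        ball x0 (2 * r) \<subseteq> \<Omega> \<and>
        weak_supersolution \<alpha> (t0 + 2 * (1/2) * r powr (2 / \<alpha>)) (ball x0 (2 * r)) A u0 u \<and>
        (AE z in lebesgue_on (cylinder (t0 + 2 * (1/2) * r powr (2 / \<alpha>)) (ball x0 (2 * r))). u z \<ge> 0) \<and>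
        (AE x in lebesgue_on (ball x0 (2 * r)). u0 x \<ge> 0) \<Longrightarrow>
        enn2ereal (p_mean p (Q_minus \<alpha> (1/2) (1/2) t0 x0 r) u)
          \<le> ereal C * ess_inf (Q_plus \<alpha> (1/2) (1/2) t0 x0 r) u"
    by auto
  define Qm where "Qm = {0<..<1/4::real} \<times> (ball 0 (1/2) :: (real ^ 'n) set)"
  define Qp where "Qp = {3/4<..<1::real} \<times> (ball 0 (1/2) :: (real ^ 'n) set)"
  have Qm: "Q_minus \<alpha> (1/2) (1/2) 0 0 1 = Qm" and Qp: "Q_plus \<alpha> (1/2) (1/2) 0 0 1 = Qp"
    by (simp_all add: Q_minus_def Q_plus_def Qm_def Qp_def)
  have op: "open Qm" "open Qp" unfolding Qm_def Qp_def by (auto intro!: open_Times)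
  have bd: "bounded Qm" "bounded Qp" unfolding Qm_def Qp_def by (auto intro!: bounded_Times)
  have mpos: "0 < measure lborel Q" if "open Q" "bounded Q" "Q \<noteq> {}" for Q :: "(real \<times> (real ^ 'n)) set"
  proof -
    have "emeasure lborel Q < \<infinity>" using that by (intro emeasure_bounded_finite)
    moreover have "emeasure lborel Q \<noteq> 0"
      using that open_not_negligible[of Q] by (auto simp: negligible_iff_null_sets null_sets_def)
    ultimately show ?thesis by (simp add: measure_def enn2real_positive_iff zero_less_iff_neq_zero)
  qed
  have m: "0 < measure lborel Qm" "0 < measure lborel Qp"
    by (intro mpos op bd; simp add: Qm_def Qp_def)+
  \<comment> \<open>X = 1/\<alpha> + N/2 is the conjugate of the critical exponent, which is X/(X -
    1). So p at or above the critical exponent means q \<le> X, that is, 2 q \<le> N +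
    2/\<alpha>.\<close>
  define X where "X = (2 + ?N * \<alpha>) / (2 * \<alpha>)"
  have "0 \<le> ?N * \<alpha>" using \<alpha> by simp
  then have "2 * \<alpha> < 2 + ?N * \<alpha>" using \<alpha> by linarith
  then have X1: "1 < X" using \<alpha> by (simp add: X_def less_divide_eq)
  have "(2 + ?N * \<alpha>) / (2 + ?N * \<alpha> - 2 * \<alpha>) = X / (X - 1)"
    using \<alpha> \<open>2 * \<alpha> < 2 + ?N * \<alpha>\<close> by (simp add: X_def divide_simps)
  then have pX: "X / (X - 1) \<le> p" using assms(3,4) by simp
  moreover have "1 < X / (X - 1)" using X1 by (simp add: field_simps)
  ultimately have p1: "1 < p" by linarith
  define q where "q = p / (p - 1)"
  have q: "1 < q" "1 / p + 1 / q = 1" using p1 by (auto simp: q_def field_simps)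
  have "X \<le> p * (X - 1)" using pX X1 by (simp add: divide_le_eq)
  then have "q \<le> X" using p1 by (simp add: q_def divide_le_eq algebra_simps)
  then have qN: "2 * q \<le> ?N + 2 / \<alpha>" using \<alpha> by (simp add: X_def field_simps)
  define c where "c = 1 / (32 * (1 / Gamma (2 - \<alpha>) + 6 * ?N))"
  have "0 < 1 / Gamma (2 - \<alpha>) + 6 * ?N" using Gamma_real_pos[of "2 - \<alpha>"] \<alpha> by (intro add_pos_pos) auto
  then have c: "0 < c" by (simp add: c_def)
  \<comment> \<open>\<open>M\<close> bounds the right side of the inequality for every supersolution
    obeying the mass bound. Like \<open>R\<close> and \<open>s\<close> below it does not depend on
    K, so K may be chosen after all of them.\<close>
  define M where "M = \<bar>C\<bar> * (2 * Gamma (1 - \<alpha>) / measure lborel Qp)"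
  have M: "0 \<le> M" using Gamma_real_pos[of "1 - \<alpha>"] \<alpha> m by (simp add: M_def)
  define R where "R = measure lborel Qm * M powr p"
  define V where "V = (4/3) powr q * unit_ball_vol ?N"
  have V: "0 < V" by (simp add: V_def)
  \<comment> \<open>Solves s^(-q) V = c/2, so that the weight term absorbs only half of K c.\<close>
  define s where "s = (2 * V / c) powr (1 / q)"
  have s: "0 < s" using V c by (simp add: s_def)
  have "(1 / s) powr q = c / (2 * V)"
    using V c q(1) by (simp add: s_def powr_divide powr_powr)
  then have "(1 / s) powr q * V = c / 2" using V by simp
  then have sV: "(1 / s) powr q * (4/3) powr q * unit_ball_vol ?N = c / 2"
    by (simp only: V_def mult.assoc)
  \<comment> \<open>The estimate at the end is K c \<le> 2 s^p R, and this K violates it.\<close>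
  obtain K :: nat where K: "2 * (s powr p * R) / c < real K" using reals_Archimedean2 by blast
  obtain u :: "real \<times> (real ^ 'n) \<Rightarrow> real" and B where
    sup: "weak_supersolution \<alpha> 1 (ball 0 2) (\<lambda>_. mat 1) (\<lambda>_. 0) u"
    and um: "u \<in> borel_measurable borel" and u0: "\<And>z. 0 \<le> fst z \<Longrightarrow> fst z \<le> 1 \<Longrightarrow> 0 \<le> u z"
    and uB: "\<And>z. 0 \<le> fst z \<Longrightarrow> fst z \<le> 1 \<Longrightarrow> u z \<le> B"
    and mass: "(\<integral>z. indicator ({0<..<1} \<times> cell) z * u z \<partial>lborel) \<le> 2 * Gamma (1 - \<alpha>)"
    and low: "\<And>k T. k \<le> K \<Longrightarrow> T = ((1/2) ^ k) powr (2 / \<alpha>) \<Longrightarrow>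
      c \<le> 4 ^ k * (\<integral>z. indicator ({0<..<T} \<times> ball 0 ((1/2) ^ k)) z * u z \<partial>lborel)"
    by (rule concentrated_supersolution[where 'n='n, OF \<alpha>, of K, folded c_def]) (rule that; assumption)
  have Qp1: "0 \<le> fst z" "fst z \<le> 1" if "z \<in> Qp" for z using that by (auto simp: Qp_def)
  have Qm1: "0 \<le> fst z" "fst z \<le> 1" if "z \<in> Qm" for z using that by (auto simp: Qm_def)
  have Qp_int: "integrable lborel (\<lambda>z. indicator Qp z * u z)"
    using u0[OF Qp1] uB[OF Qp1] op bd by (intro integrable_indicator_bounded[OF _ _ um, where D=B]) auto
  have Qm_int: "integrable lborel (\<lambda>z. indicator Qm z * u z powr p)"
  proof (rule integrable_indicator_bounded[where D="B powr p"])
    show "(\<lambda>z. u z powr p) \<in> borel_measurable borel" using um by measurable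
    show "\<bar>u z powr p\<bar> \<le> B powr p" if "z \<in> Qm" for z
      using u0[OF Qm1[OF that]] uB[OF Qm1[OF that]] p1 by (auto intro!: powr_mono2)
  qed (use op bd in auto)
  have "Qp \<subseteq> {0<..<1} \<times> cell"
  proof -
    have "x \<in> cell" if "norm x < 1/2" for x :: "real ^ 'n"
      unfolding cell_def
    proof (intro CollectI allI)
      fix i
      have "\<bar>x $ i\<bar> \<le> pi" using component_le_norm_cart[of x i] that pi_gt3 by linarith
      then show "x $ i \<in> {-pi..pi}" by auto
    qed
    then show ?thesis by (auto simp: Qp_def)
  qed
  then have "(\<integral>z. indicator Qp z * u z \<partial>lborel) \<le> (\<integral>z. indicator ({0<..<1} \<times> cell) z * u z \<partial>lborel)"
  proof (intro integral_mono Qp_int)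
    have "{0<..<1::real} \<times> (cell :: (real ^ 'n) set) \<in> sets borel"
      unfolding borel_prod[symmetric] using cell_measurable by (intro pair_measureI) auto
    moreover have "bounded ({0<..<1::real} \<times> (cell :: (real ^ 'n) set))" using bounded_cell by (intro bounded_Times) auto
    ultimately show "integrable lborel (\<lambda>z. indicator ({0<..<1} \<times> cell) z * u z)"
      using u0 uB by (intro integrable_indicator_bounded[OF _ _ um, where D=B]) auto
    show "indicator Qp z * u z \<le> indicator ({0<..<1} \<times> cell) z * u z" for z
      using \<open>Qp \<subseteq> {0<..<1} \<times> cell\<close> u0[of z] by (auto simp: indicator_def)
  qed
  then have Qp_mass: "(\<integral>z. indicator Qp z * u z \<partial>lborel) \<le> 2 * Gamma (1 - \<alpha>)" using mass by linarith
  note ei = ess_inf_bounds[OF um op(2) bd(2) m(2) u0[OF Qp1] Qp_int Qp_mass]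
  have "enn2ereal (p_mean p Qm u) \<le> ereal C * ess_inf Qp u"
    unfolding Qm[symmetric] Qp[symmetric]
  proof (rule C[of 1 "ball 0 2" "\<lambda>_. mat 1" "\<lambda>_. 0"], intro conjI)
    show "bounded_domain (ball (0 :: real ^ 'n) 2)" by (simp add: bounded_domain_def)
    show "admissible_coeff 1 ?N (cylinder 1 (ball 0 2)) (\<lambda>_. mat 1 :: real ^ 'n ^ 'n)"
    proof -
      have "(\<Sum>i\<in>UNIV. \<Sum>j\<in>UNIV. \<bar>(mat 1 :: real ^ 'n ^ 'n) $ i $ j\<bar>\<^sup>2) = ?N"
        by (simp add: mat_def if_distrib[of abs] if_distrib[of "\<lambda>x. x\<^sup>2"] cong: if_cong)
      also have "\<dots> \<le> ?N\<^sup>2" by (simp add: power2_eq_square)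
      finally show ?thesis by (simp add: admissible_coeff_def power2_norm_eq_inner)
    qed
    show "(\<lambda>_. 0 :: real) \<in> L2 (ball (0 :: real ^ 'n) 2)" by (simp add: L2_def)
    show "weak_supersolution \<alpha> (0 + 2 * (1/2) * 1 powr (2 / \<alpha>)) (ball 0 (2 * 1)) (\<lambda>_. mat 1) (\<lambda>_. 0) u" using sup by simp
    show "AE z in lebesgue_on (cylinder (0 + 2 * (1/2) * 1 powr (2 / \<alpha>)) (ball 0 (2 * 1))). 0 \<le> u z"
      using u0 by (intro AE_I2) (auto simp: cylinder_def)
  qed simp_all
  \<comment> \<open>Nothing is known about the sign of \<open>C\<close>; as the essential infimum is
    nonnegative, \<open>C\<close> may be replaced by its absolute value.\<close>
  also have "\<dots> \<le> ereal \<bar>C\<bar> * ess_inf Qp u" using ei(1) by (intro ereal_mult_right_mono) auto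
  also have "\<dots> \<le> ereal \<bar>C\<bar> * ereal (2 * Gamma (1 - \<alpha>) / measure lborel Qp)" using ei(2) by (intro ereal_mult_left_mono) auto
  also have "\<dots> = ereal M" by (simp add: M_def)
  finally have le: "enn2ereal (p_mean p Qm u) \<le> ereal M" .
  have "(\<integral>z. indicator Qm z * u z powr p \<partial>lborel) \<le> R"
    unfolding R_def using p1 by (intro p_mean_le_D[OF um op(1) bd(1) m(1) Qm_int _ M le]) auto
  then have "s powr p * (\<integral>z. indicator Qm z * u z powr p \<partial>lborel) \<le> s powr p * R" by (intro mult_left_mono) auto
  moreover have "real K * c \<le> s powr p * (\<integral>z. indicator Qm z * u z powr p \<partial>lborel) + real K * (c / 2)"
    unfolding sV[symmetric] Qm_def
  proof (rule concentration_Hoelder[where B=B, OF \<alpha> p1 q qN um _ _ _ s])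
    show "0 \<le> u z" "u z \<le> B" if "0 \<le> fst z" "fst z \<le> 1" for z
      using u0[OF that] uB[OF that] by blast+
    show "c \<le> 4 ^ k * (\<integral>z. indicator ({0<..<T} \<times> ball 0 ((1/2) ^ k)) z * u z \<partial>lborel)"
      if "k \<le> K" "T = ((1/2) ^ k) powr (2 / \<alpha>)" for k T
      by (rule low[OF that])
  qed
  ultimately have "real K * c \<le> 2 * (s powr p * R)" by simp
  then show False using K c by (simp add: divide_less_eq)
qed

end
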